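(* Let $\mathsf{B}^\mathsf{t}\subseteq\{\mathbf{U},\mathbf{R},\mathbf{W},\mathbf{M}\}$ and $\mathsf{B}^\mathsf{l}\subseteq\mathrm{Bin}_{lg}$ with $\mathsf{B}^\mathsf{l}\cup\mathsf{B}^\mathsf{t}\neq\emptyset$. Then for every $\mathsf{U}^\mathsf{t}\subseteq\{\neg,\mathbf{X},\mathbf{F},\mathbf{G}\}$, the decision problem $\mathrm{LTL}_{\mathrm{Learn}}(\mathsf{U}^\mathsf{t},\mathsf{B}^\mathsf{t},\mathsf{B}^\mathsf{l},\infty)$ is NP-hard (under logarithmic-space reductions).
   Context: Operators: unary $\mathrm{Un}=\{\neg,\mathbf{X},\mathbf{F},\mathbf{G}\}$; binary temporal $\mathrm{Bin}_{tp}=\{\mathbf{U},\mathbf{R},\mathbf{W},\mathbf{M}\}$; binary logical $\mathrm{Bin}_{lg}$ consisting of $\vee,\wedge,\Rightarrow,\Leftarrow,\Leftrightarrow$ and their negated versions $\neg\vee,\neg\wedge,\neg\Rightarrow,\neg\Leftarrow,\neg\Leftrightarrow$, where $x\,(\neg * )\,y$ means $\neg(x*y)$. For a finite set of propositions $\mathsf{Prop}$, $\mathrm{LTL}(\mathsf{Prop},\mathsf{U}^\mathsf{t},\mathsf{B}^\mathsf{t},\mathsf{B}^\mathsf{l})$ is the set of formulas $\varphi::=p\mid \circ\varphi\mid\varphi*\varphi$ with $p\in\mathsf{Prop}$, $\circ\in\mathsf{U}^\mathsf{t}$, $*\in\mathsf{B}^\mathsf{t}\cup\mathsf{B}^\mathsf{l}$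 (negation is available exactly when $\neg\in\mathsf{U}^\mathsf{t}$). Semantics on infinite words $w\in(2^{\mathsf{Prop}})^\omega$ with positions $1,2,\dots$ and suffixes $w[i:]$: $w\models p$ iff $p\in w[1]$; Boolean operators as usual; $w\models\mathbf{X}\varphi$ iff $w[2:]\models\varphi$; $w\models\mathbf{F}\varphi$ iff $\exists i\ge1$, $w[i:]\models\varphi$; $w\models\mathbf{G}\varphi$ iff $\forall i\ge1$, $w[i:]\models\varphi$; $w\models\varphi_1\mathbf{U}\varphi_2$ iff $\exists i\ge1$ with $w[i:]\models\varphi_2$ and $w[j:]\models\varphi_1$ for all $1\le j<i$; $\varphi_1\mathbf{R}\varphi_2:=\neg(\neg\varphi_1\mathbf{U}\neg\varphi_2)$; $\varphi_1\mathbf{W}\varphi_2:=(\varphi_1\mathbf{U}\varphi_2)\vee\mathbf{G}\varphi_1$; $\varphi_1\mathbf{M}\varphi_2:=(\varphi_1\mathbf{R}\varphi_2)\wedge\mathbf{F}\varphi_1$. The size $|\varphi|$ is the number of distinct (syntactic) subformulas of $\varphi$; $|\varphi|_{\mathrm{Bin}}$ is the number of distinct subformulas whose outermost operator is binary. An ultimately periodic word $u\cdot v^\omega$ ($u\in(2^\mathsf{Prop})^*$, $v\in(2^\mathsf{Prop})^+$) has size $|u|+|v|$. For $n\in\mathbb{N}\cup\{\infty\}$, $\mathrm{LTL}_{\mathrm{Learn}}(\mathsf{U}^\mathsf{t},\mathsf{B}^\mathsf{t},\mathsf{B}^\mathsf{l},n)$ is the problem: input $(\mathsf{Prop},\mathcal{P},\mathcal{N},B)$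 with $\mathcal{P},\mathcal{N}$ finite sets of ultimately periodic words and $B\in\mathbb{N}$ written in unary (input size $|\mathsf{Prop}|$ + total size of words + $B$); answer yes iff there is $\varphi\in\mathrm{LTL}(\mathsf{Prop},\mathsf{U}^\mathsf{t},\mathsf{B}^\mathsf{t},\mathsf{B}^\mathsf{l})$ with $|\varphi|\le B$, $|\varphi|_{\mathrm{Bin}}\le n$, accepting every word of $\mathcal{P}$ and rejecting every word of $\mathcal{N}$. *)

theory Defs
  imports Complex_Main "HOL-Library.Omega_Words_Fun" "HOL-Library.Extended_Nat"
begin

section \<open>Linear temporal logic\<close>

datatype unop = Neg | Next | Finally | Globally

datatype binop =
    Until | Release | WeakUntil | StrongRelease
  | Or | And | Implies | ImpliedBy | Iff
  | NOr | NAnd | NImplies | NImpliedBy | NIff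

definition Unops :: "unop set" where
  "Unops = {Neg, Next, Finally, Globally}"

definition Bin_tp :: "binop set" where
  "Bin_tp = {Until, Release, WeakUntil, StrongRelease}"

definition Bin_lg :: "binop set" where
  "Bin_lg = {Or, And, Implies, ImpliedBy, Iff, NOr, NAnd, NImplies, NImpliedBy, NIff}"

datatype 'p ltl = Atom 'p | Unary unop "'p ltl" | Binary binop "'p ltl" "'p ltl"

inductive_set LTL :: "'p set \<Rightarrow> unop set \<Rightarrow> binop set \<Rightarrow> binop set \<Rightarrow> 'p ltl set"
  for Props Ut Bt Bl where
  atom: "p \<in> Props \<Longrightarrow> Atom p \<in> LTL Props Ut Bt Bl"
| unary: "\<lbrakk>f \<in> Ut; \<phi> \<in> LTL Props Ut Bt Bl\<rbrakk> \<Longrightarrow> Unary f \<phi> \<in> LTL Props Ut Bt Bl"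
| binary: "\<lbrakk>g \<in> Bt \<union> Bl; \<phi> \<in> LTL Props Ut Bt Bl; \<psi> \<in> LTL Props Ut Bt Bl\<rbrakk>
    \<Longrightarrow> Binary g \<phi> \<psi> \<in> LTL Props Ut Bt Bl"

text \<open>
  Temporal operators act on properties of infinite words. Words are indexed from \<open>0\<close>, so
  \<^term>\<open>suffix i w\<close> is the suffix that starts at the \<open>(i + 1)\<close>-st letter of \<open>w\<close>.
\<close>

definition sem_F :: "('a word \<Rightarrow> bool) \<Rightarrow> 'a word \<Rightarrow> bool" where
  "sem_F P w \<longleftrightarrow> (\<exists>i. P (suffix i w))"

definition sem_G :: "('a word \<Rightarrow> bool) \<Rightarrow> 'a word \<Rightarrow> bool" where
  "sem_G P w \<longleftrightarrow> (\<forall>i. P (suffix i w))"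

definition sem_U :: "('a word \<Rightarrow> bool) \<Rightarrow> ('a word \<Rightarrow> bool) \<Rightarrow> 'a word \<Rightarrow> bool" where
  "sem_U P Q w \<longleftrightarrow> (\<exists>i. Q (suffix i w) \<and> (\<forall>j<i. P (suffix j w)))"

definition sem_R :: "('a word \<Rightarrow> bool) \<Rightarrow> ('a word \<Rightarrow> bool) \<Rightarrow> 'a word \<Rightarrow> bool" where
  "sem_R P Q w \<longleftrightarrow> \<not> sem_U (\<lambda>v. \<not> P v) (\<lambda>v. \<not> Q v) w"

definition sem_W :: "('a word \<Rightarrow> bool) \<Rightarrow> ('a word \<Rightarrow> bool) \<Rightarrow> 'a word \<Rightarrow> bool" where
  "sem_W P Q w \<longleftrightarrow> sem_U P Q w \<or> sem_G P w"

definition sem_M :: "('a word \<Rightarrow> bool) \<Rightarrow> ('a word \<Rightarrow> bool) \<Rightarrow> 'a word \<Rightarrow> bool" where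
  "sem_M P Q w \<longleftrightarrow> sem_R P Q w \<and> sem_F P w"

fun sem_unop :: "unop \<Rightarrow> ('a word \<Rightarrow> bool) \<Rightarrow> 'a word \<Rightarrow> bool" where
  "sem_unop Neg P w \<longleftrightarrow> \<not> P w"
| "sem_unop Next P w \<longleftrightarrow> P (suffix 1 w)"
| "sem_unop Finally P w \<longleftrightarrow> sem_F P w"
| "sem_unop Globally P w \<longleftrightarrow> sem_G P w"

fun sem_binop :: "binop \<Rightarrow> ('a word \<Rightarrow> bool) \<Rightarrow> ('a word \<Rightarrow> bool) \<Rightarrow> 'a word \<Rightarrow> bool" where
  "sem_binop Until P Q w \<longleftrightarrow> sem_U P Q w"
| "sem_binop Release P Q w \<longleftrightarrow> sem_R P Q w"
| "sem_binop WeakUntil P Q w \<longleftrightarrow> sem_W P Q w"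
| "sem_binop StrongRelease P Q w \<longleftrightarrow> sem_M P Q w"
| "sem_binop Or P Q w \<longleftrightarrow> P w \<or> Q w"
| "sem_binop And P Q w \<longleftrightarrow> P w \<and> Q w"
| "sem_binop Implies P Q w \<longleftrightarrow> (P w \<longrightarrow> Q w)"
| "sem_binop ImpliedBy P Q w \<longleftrightarrow> (Q w \<longrightarrow> P w)"
| "sem_binop Iff P Q w \<longleftrightarrow> (P w \<longleftrightarrow> Q w)"
| "sem_binop NOr P Q w \<longleftrightarrow> \<not> (P w \<or> Q w)"
| "sem_binop NAnd P Q w \<longleftrightarrow> \<not> (P w \<and> Q w)"
| "sem_binop NImplies P Q w \<longleftrightarrow> \<not> (P w \<longrightarrow> Q w)"
| "sem_binop NImpliedBy P Q w \<longleftrightarrow> \<not> (Q w \<longrightarrow> P w)"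
| "sem_binop NIff P Q w \<longleftrightarrow> \<not> (P w \<longleftrightarrow> Q w)"

primrec sem :: "'p ltl \<Rightarrow> 'p set word \<Rightarrow> bool" where
  "sem (Atom p) = (\<lambda>w. p \<in> w 0)"
| "sem (Unary f \<phi>) = sem_unop f (sem \<phi>)"
| "sem (Binary g \<phi> \<psi>) = sem_binop g (sem \<phi>) (sem \<psi>)"

primrec subformulas :: "'p ltl \<Rightarrow> 'p ltl set" where
  "subformulas (Atom p) = {Atom p}"
| "subformulas (Unary f \<phi>) = insert (Unary f \<phi>) (subformulas \<phi>)"
| "subformulas (Binary g \<phi> \<psi>) = insert (Binary g \<phi> \<psi>) (subformulas \<phi> \<union> subformulas \<psi>)"

definition ltl_size :: "'p ltl \<Rightarrow> nat" where
  "ltl_size \<phi> = card (subformulas \<phi>)"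

definition ltl_bin_size :: "'p ltl \<Rightarrow> nat" where
  "ltl_bin_size \<phi> = card {\<psi> \<in> subformulas \<phi>. \<exists>g \<psi>\<^sub>1 \<psi>\<^sub>2. \<psi> = Binary g \<psi>\<^sub>1 \<psi>\<^sub>2}"

section \<open>The learning problem\<close>

text \<open>A pair \<open>(u, v)\<close> with \<open>v\<close> nonempty represents the ultimately periodic word \<open>u \<cdot> v\<^sup>\<omega>\<close>.\<close>

type_synonym 'p upword = "'p set list \<times> 'p set list"

definition upwords :: "'p set \<Rightarrow> 'p upword set" where
  "upwords Props = {(u, v). v \<noteq> [] \<and> set u \<subseteq> Pow Props \<and> set v \<subseteq> Pow Props}"

definition word_of :: "'p upword \<Rightarrow> 'p set word" where
  "word_of x = fst x \<frown> (snd x)\<^sup>\<omega>"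

definition learnable ::
  "unop set \<Rightarrow> binop set \<Rightarrow> binop set \<Rightarrow> enat \<Rightarrow>
    'p set \<Rightarrow> 'p upword set \<Rightarrow> 'p upword set \<Rightarrow> nat \<Rightarrow> bool" where
  "learnable Ut Bt Bl n Props P N B \<longleftrightarrow>
    (\<exists>\<phi> \<in> LTL Props Ut Bt Bl.
      ltl_size \<phi> \<le> B \<and> enat (ltl_bin_size \<phi>) \<le> n \<and>
      (\<forall>x \<in> P. sem \<phi> (word_of x)) \<and> (\<forall>x \<in> N. \<not> sem \<phi> (word_of x)))"

text \<open>
  Instances as bit strings. The propositions are \<open>0, \<dots>, k - 1\<close>; a letter is written as its
  characteristic vector of length \<open>k\<close>, numbers (\<open>k\<close> and the bound \<open>B\<close>) are in unary, and in
  a list each element is preceded by \<open>1\<close> and the end is marked by \<open>0\<close>. Hence the length of a code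
  is polynomially related to the sum of \<open>k\<close>, the sizes of the listed words and \<open>B\<close>.
\<close>

definition enc_nat :: "nat \<Rightarrow> bool list" where
  "enc_nat n = replicate n True @ [False]"

primrec enc_list :: "('a \<Rightarrow> bool list) \<Rightarrow> 'a list \<Rightarrow> bool list" where
  "enc_list e [] = [False]"
| "enc_list e (x # xs) = True # e x @ enc_list e xs"

definition enc_letter :: "nat \<Rightarrow> nat set \<Rightarrow> bool list" where
  "enc_letter k a = map (\<lambda>p. p \<in> a) [0..<k]"

definition enc_upword :: "nat \<Rightarrow> nat upword \<Rightarrow> bool list" where
  "enc_upword k x = enc_list (enc_letter k) (fst x) @ enc_list (enc_letter k) (snd x)"

definition enc_instance ::
  "nat \<Rightarrow> nat upword list \<Rightarrow> nat upword list \<Rightarrow> nat \<Rightarrow> bool list" where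
  "enc_instance k ps ns B =
    enc_nat k @ enc_list (enc_upword k) ps @ enc_list (enc_upword k) ns @ enc_nat B"

definition LTL_Learn :: "unop set \<Rightarrow> binop set \<Rightarrow> binop set \<Rightarrow> enat \<Rightarrow> bool list set" where
  "LTL_Learn Ut Bt Bl n =
    {enc_instance k ps ns B | k ps ns B.
      set ps \<subseteq> upwords {..<k} \<and> set ns \<subseteq> upwords {..<k} \<and>
      learnable Ut Bt Bl n {..<k} (set ps) (set ns) B}"

text \<open>The encoding is unambiguous.\<close>

lemma enc_nat_prefix:
  "enc_nat m @ r = enc_nat n @ s \<Longrightarrow> m = n \<and> r = s"
proof (induction m arbitrary: n)
  case 0
  then show ?case by (cases n) (auto simp: enc_nat_def)
next
  case (Suc m)
  then show ?case by (cases n) (auto simp: enc_nat_def)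
qed

lemma enc_list_prefix:
  assumes e: "\<And>x y r s. \<lbrakk>x \<in> A; y \<in> A; e x @ r = e y @ s\<rbrakk> \<Longrightarrow> x = y \<and> r = s"
  shows "\<lbrakk>set xs \<subseteq> A; set ys \<subseteq> A; enc_list e xs @ r = enc_list e ys @ s\<rbrakk> \<Longrightarrow> xs = ys \<and> r = s"
proof (induction xs arbitrary: ys)
  case Nil
  then show ?case by (cases ys) auto
next
  case (Cons x xs)
  then obtain y ys' where ys: "ys = y # ys'" by (cases ys) auto
  with Cons.prems have xy: "x \<in> A" "y \<in> A" and sub: "set xs \<subseteq> A" "set ys' \<subseteq> A"
    and eq: "e x @ (enc_list e xs @ r) = e y @ (enc_list e ys' @ s)" by simp_all
  note eq' = e[OF xy eq]
  from Cons.IH[OF sub eq'[THEN conjunct2]] eq'[THEN conjunct1] ys show ?case by simp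
qed

lemma enc_letter_prefix:
  assumes "a \<in> Pow {..<k}" "b \<in> Pow {..<k}" "enc_letter k a @ r = enc_letter k b @ s"
  shows "a = b \<and> r = s"
proof -
  have "enc_letter k a = enc_letter k b" and rs: "r = s"
    using assms(3) by (auto simp: enc_letter_def)
  then have "\<forall>p<k. p \<in> a \<longleftrightarrow> p \<in> b" by (auto simp: enc_letter_def)
  with assms(1,2) rs show ?thesis by blast
qed

lemma enc_upword_prefix:
  assumes "x \<in> upwords {..<k}" "y \<in> upwords {..<k}" "enc_upword k x @ r = enc_upword k y @ s"
  shows "x = y \<and> r = s"
proof -
  note pre = enc_list_prefix[where A = "Pow {..<k}" and e = "enc_letter k", OF enc_letter_prefix]
  have *: "set (fst x) \<subseteq> Pow {..<k}" "set (fst y) \<subseteq> Pow {..<k}"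
    "set (snd x) \<subseteq> Pow {..<k}" "set (snd y) \<subseteq> Pow {..<k}"
    using assms(1,2) by (auto simp: upwords_def)
  have "enc_list (enc_letter k) (fst x) @ (enc_list (enc_letter k) (snd x) @ r) =
      enc_list (enc_letter k) (fst y) @ (enc_list (enc_letter k) (snd y) @ s)"
    using assms(3) by (simp add: enc_upword_def)
  from pre[OF _ _ _ *(1,2) this] have 1: "fst x = fst y"
    and "enc_list (enc_letter k) (snd x) @ r = enc_list (enc_letter k) (snd y) @ s"
    by simp_all
  from pre[OF _ _ _ *(3,4) this(2)] 1 show ?thesis by (simp add: prod_eq_iff)
qed

lemma enc_instance_inject:
  assumes "set ps \<subseteq> upwords {..<k}" "set ns \<subseteq> upwords {..<k}"
    and "set ps' \<subseteq> upwords {..<k'}" "set ns' \<subseteq> upwords {..<k'}"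
    and eq: "enc_instance k ps ns B = enc_instance k' ps' ns' B'"
  shows "k = k' \<and> ps = ps' \<and> ns = ns' \<and> B = B'"
proof -
  note pre = enc_list_prefix[where A = "upwords {..<k}" and e = "enc_upword k", OF enc_upword_prefix]
  note eq' = enc_nat_prefix[OF eq[unfolded enc_instance_def]]
  then have k: "k' = k" by simp
  note eq1 = eq'[THEN conjunct2, unfolded k]
  note wf = assms(3,4)[unfolded k]
  note eq2 = pre[OF _ _ _ assms(1) wf(1) eq1, simplified]
  note eq3 = pre[OF _ _ _ assms(2) wf(2) eq2[THEN conjunct2], simplified]
  have "B = B'" using enc_nat_prefix[of B "[]" B' "[]"] eq3 by simp
  with k eq2 eq3 show ?thesis by simp
qed

section \<open>Nondeterministic polynomial time\<close>

datatype move = MoveLeft | Stay | MoveRight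

text \<open>
  Single-tape nondeterministic Turing machines with a finite transition table. States and tape
  symbols are natural numbers (only finitely many occur in the table); symbol \<open>0\<close> is the blank,
  \<open>1\<close> and \<open>2\<close> are the input bits. The tape is infinite in both directions.
\<close>

record ntm =
  ntm_start :: nat
  ntm_accept :: nat
  ntm_trans :: "(nat \<times> nat \<times> nat \<times> nat \<times> move) set"

type_synonym ntm_config = "nat \<times> (int \<Rightarrow> nat) \<times> int"

fun move_int :: "move \<Rightarrow> int \<Rightarrow> int" where
  "move_int MoveLeft h = h - 1"
| "move_int Stay h = h"
| "move_int MoveRight h = h + 1"

definition bit_symbol :: "bool \<Rightarrow> nat" where
  "bit_symbol b = (if b then 2 else 1)"

definition ntm_init :: "ntm \<Rightarrow> bool list \<Rightarrow> ntm_config" where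
  "ntm_init M x =
    (ntm_start M, \<lambda>i. if 0 \<le> i \<and> i < int (length x) then bit_symbol (x ! nat i) else 0, 0)"

inductive ntm_step :: "ntm \<Rightarrow> ntm_config \<Rightarrow> ntm_config \<Rightarrow> bool" for M where
  "(q, t h, q', s, d) \<in> ntm_trans M \<Longrightarrow> ntm_step M (q, t, h) (q', t(h := s), move_int d h)"

definition ntm_accepts :: "ntm \<Rightarrow> bool list \<Rightarrow> bool" where
  "ntm_accepts M x \<longleftrightarrow> (\<exists>c. (ntm_step M)\<^sup>*\<^sup>* (ntm_init M x) c \<and> fst c = ntm_accept M)"

text \<open>On every input, all computations halt within polynomially many steps.\<close>

definition ntm_poly_time :: "ntm \<Rightarrow> bool" where
  "ntm_poly_time M \<longleftrightarrow>
    (\<exists>a d. \<forall>x t c. (ntm_step M ^^ t) (ntm_init M x) c \<longrightarrow> t \<le> a * length x ^ d + a)"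

definition NP :: "bool list set set" where
  "NP = {A. \<exists>M. finite (ntm_trans M) \<and> ntm_poly_time M \<and> A = {x. ntm_accepts M x}}"

section \<open>Logarithmic-space reductions\<close>

text \<open>
  Deterministic transducers with a two-way read-only input tape, any fixed number of work tapes
  and a write-only output tape. States are the numbers below \<open>tr_states\<close> with start state \<open>0\<close>;
  work symbols are the numbers below \<open>tr_symbols\<close> with blank \<open>0\<close>; the machine halts where
  \<open>tr_delta\<close> returns \<^const>\<open>None\<close>. A transition depends on the state, the input symbol and the list of
  work symbols under the heads, and gives the new state, the move of the input head, for each
  work tape the symbol to write and the move, and optionally a bit that is appended to the output.
\<close>

datatype insym = LeftEnd | Bit bool | RightEnd

record transducer =
  tr_states :: nat
  tr_symbols :: nat
  tr_tapes :: nat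
  tr_delta :: "nat \<Rightarrow> insym \<Rightarrow> nat list \<Rightarrow>
    (nat \<times> move \<times> (nat \<times> move) list \<times> bool option) option"

definition tr_wf :: "transducer \<Rightarrow> bool" where
  "tr_wf M \<longleftrightarrow> 0 < tr_states M \<and> 0 < tr_symbols M \<and>
    (\<forall>q i ss q' d as b.
      q < tr_states M \<longrightarrow> length ss = tr_tapes M \<longrightarrow> (\<forall>s \<in> set ss. s < tr_symbols M) \<longrightarrow>
      tr_delta M q i ss = Some (q', d, as, b) \<longrightarrow>
      q' < tr_states M \<and> length as = tr_tapes M \<and> (\<forall>(s, m) \<in> set as. s < tr_symbols M))"

text \<open>
  A configuration consists of the state, the position of the input head, the work tapes (one-way
  infinite, each with its head position) and the output written so far. The input head ranges
  over the end markers \<open>0\<close> and \<open>length x + 1\<close> and the positions between them.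
\<close>

type_synonym tr_config = "nat \<times> nat \<times> ((nat \<Rightarrow> nat) \<times> nat) list \<times> bool list"

definition input_symbol :: "bool list \<Rightarrow> nat \<Rightarrow> insym" where
  "input_symbol x i =
    (if i = 0 then LeftEnd else if i \<le> length x then Bit (x ! (i - 1)) else RightEnd)"

fun move_nat :: "move \<Rightarrow> nat \<Rightarrow> nat" where
  "move_nat MoveLeft h = h - 1"
| "move_nat Stay h = h"
| "move_nat MoveRight h = h + 1"

definition tr_init :: "transducer \<Rightarrow> tr_config" where
  "tr_init M = (0, 0, replicate (tr_tapes M) (\<lambda>_. 0, 0), [])"

fun tr_step :: "transducer \<Rightarrow> bool list \<Rightarrow> tr_config \<Rightarrow> tr_config option" where
  "tr_step M x (q, i, ws, out) =
    (case tr_delta M q (input_symbol x i) (map (\<lambda>(t, h). t h) ws) of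
      None \<Rightarrow> None
    | Some (q', d, as, b) \<Rightarrow>
        Some (q', min (move_nat d i) (length x + 1),
          map2 (\<lambda>(t, h) (s, m). (t(h := s), move_nat m h)) ws as,
          out @ (case b of None \<Rightarrow> [] | Some y \<Rightarrow> [y])))"

definition tr_reaches :: "transducer \<Rightarrow> bool list \<Rightarrow> tr_config \<Rightarrow> bool" where
  "tr_reaches M x c \<longleftrightarrow> (\<lambda>c c'. tr_step M x c = Some c')\<^sup>*\<^sup>* (tr_init M) c"

definition tr_computes :: "transducer \<Rightarrow> (bool list \<Rightarrow> bool list) \<Rightarrow> bool" where
  "tr_computes M f \<longleftrightarrow>
    (\<forall>x. \<exists>q i ws. tr_reaches M x (q, i, ws, f x) \<and> tr_step M x (q, i, ws, f x) = None)"

definition tr_log_space :: "transducer \<Rightarrow> bool" where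
  "tr_log_space M \<longleftrightarrow>
    (\<exists>a::real. \<forall>x q i ws out. tr_reaches M x (q, i, ws, out) \<longrightarrow>
      (\<forall>(t, h) \<in> set ws. real h \<le> a * log 2 (real (length x) + 2)))"

definition logspace_computable :: "(bool list \<Rightarrow> bool list) \<Rightarrow> bool" where
  "logspace_computable f \<longleftrightarrow> (\<exists>M. tr_wf M \<and> tr_log_space M \<and> tr_computes M f)"

definition logspace_reducible :: "bool list set \<Rightarrow> bool list set \<Rightarrow> bool" where
  "logspace_reducible A L \<longleftrightarrow> (\<exists>f. logspace_computable f \<and> (\<forall>x. x \<in> A \<longleftrightarrow> f x \<in> L))"

definition NP_hard :: "bool list set \<Rightarrow> bool" where
  "NP_hard L \<longleftrightarrow> (\<forall>A \<in> NP. logspace_reducible A L)"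

end

theory Submission
  imports Defs
begin

text \<open>
  Fix an operator \<open>g\<close> of \<open>Bt \<union> Bl\<close>. A formula over any operators that contains many distinct propositions is
  large, since its syntax graph is connected and only binary operators branch; and it must contain
  a proposition on which two words differ if it separates them. So a separating formula of bounded
  size gives a small hitting set of the differences. Conversely, a small set that hits every
  difference \<^emph>\<open>exactly once\<close> gives a separating formula of that size which is a chain of the single
  operator \<open>g\<close>; exactness is what makes this work for \<open>Iff\<close> and its negation. Such exact hitting
  sets describe the tilings of a rectangle, and hence the computations of a nondeterministic Turing
  machine: whenever two adjacent tiles must agree on a colour, for each colour \<open>c\<close> one of
  "the first tile has \<open>c\<close>" and "the second tile does not have \<open>c\<close>" must hold, and then exactly one holds.

  The instance is written by a transducer that keeps finitely many binary counters, of polynomially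
  bounded value, on one work tape.
\<close>

section \<open>Propositions and formula size\<close>

text \<open>The size bound is 4 N + 1, with N the number of cells of the rectangle, and admits at
  most 2 N + 1 propositions. A fixed proposition p and N dummies are forced by words of their own,
  so N remain for the hitting set: one tile per cell. The dummies are due to joint denial. A single
  denial negates the rest of a chain, whereas h NOr (d NOr \<phi>) means \<not> h \<and> (d \<or>
  \<phi>), so each chosen proposition h gets a partner d. The other operators carry the dummies too,
  and one count serves all.

  The two directions are not symmetric: a separating formula gives a hitting set of at most N
  propositions, a computation gives an exact one. The gap is harmless. The cell constraints are
  disjoint, so N propositions that hit them are one per cell; and the disjunction "the first tile
  has c or the second lacks c", taken at the colour c of the second tile, already forces agreement.

  Only half of the binary operators need a formula of their own: complementing all letters and
  exchanging accepted with rejected words takes an operator to its dual.\<close>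

primrec atoms :: "'p ltl \<Rightarrow> 'p set" where
  "atoms (Atom p) = {p}"
| "atoms (Unary f \<phi>) = atoms \<phi>"
| "atoms (Binary g \<phi> \<psi>) = atoms \<phi> \<union> atoms \<psi>"

section \<open>Counting the propositions of a formula\<close>

lemma finite_subformulas [simp]: "finite (subformulas \<phi>)"
  by (induction \<phi>) auto

lemma finite_atoms [simp]: "finite (atoms \<phi>)"
  by (induction \<phi>) auto

lemma subformulas_self [simp]: "\<phi> \<in> subformulas \<phi>"
  by (cases \<phi>) auto

lemma size_subformula: "\<psi> \<in> subformulas \<phi> \<Longrightarrow> size \<psi> \<le> size \<phi>"
  by (induction \<phi>) fastforce+

lemma Atom_in_subformulas: "Atom p \<in> subformulas \<phi> \<longleftrightarrow> p \<in> atoms \<phi>"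
  by (induction \<phi>) auto

lemma subformulas_trans: "\<psi> \<in> subformulas \<phi> \<Longrightarrow> subformulas \<psi> \<subseteq> subformulas \<phi>"
  by (induction \<phi>) auto

abbreviation binary_subformulas :: "'p ltl \<Rightarrow> 'p ltl set" where
  "binary_subformulas \<phi> \<equiv> {\<psi> \<in> subformulas \<phi>. \<exists>g \<psi>\<^sub>1 \<psi>\<^sub>2. \<psi> = Binary g \<psi>\<^sub>1 \<psi>\<^sub>2}"

text \<open>
  Shared subformulas are counted once, so the induction is relative to a set \<open>S\<close> of subformulas
  that are already paid for: the right argument of a binary operator is charged only for what
  does not occur in the left one.
\<close>

lemma card_atoms_le_binary_aux:
  assumes "\<And>\<psi>. \<psi> \<in> S \<Longrightarrow> subformulas \<psi> \<subseteq> S"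
  shows "card (Atom ` atoms \<phi> - S) \<le> card (binary_subformulas \<phi> - S) + 1"
  using assms
proof (induction \<phi> arbitrary: S)
  case (Atom p)
  have "card (Atom ` atoms (Atom p) - S) \<le> card {Atom p}"
    by (rule card_mono) auto
  then show ?case by simp
next
  case (Unary f \<phi>)
  have "binary_subformulas (Unary f \<phi>) = binary_subformulas \<phi>" by auto
  with Unary show ?case by simp
next
  case (Binary g \<phi> \<psi>)
  let ?\<chi> = "Binary g \<phi> \<psi>"
  show ?case
  proof (cases "?\<chi> \<in> S")
    case True
    then have "Atom ` atoms ?\<chi> \<subseteq> S"
      using Binary.prems[OF True] Atom_in_subformulas[of _ ?\<chi>] by blast
    then have "Atom ` atoms ?\<chi> - S = {}" by blast
    then show ?thesis by (simp only: card.empty)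
  next
    case False
    let ?S = "S \<union> subformulas \<phi>"
    have "card (Atom ` atoms \<psi> - ?S) \<le> card (binary_subformulas \<psi> - ?S) + 1"
      using Binary.prems subformulas_trans by (intro Binary.IH(2)) blast
    moreover have "card (Atom ` atoms \<phi> - S) \<le> card (binary_subformulas \<phi> - S) + 1"
      using Binary.prems by (intro Binary.IH(1)) blast
    moreover have "card (Atom ` atoms ?\<chi> - S)
        \<le> card (Atom ` atoms \<phi> - S) + card (Atom ` atoms \<psi> - ?S)"
    proof -
      have "Atom ` atoms ?\<chi> - S \<subseteq> (Atom ` atoms \<phi> - S) \<union> (Atom ` atoms \<psi> - ?S)"
        using Atom_in_subformulas[of _ \<phi>] by auto
      then have "card (Atom ` atoms ?\<chi> - S) \<le> card ((Atom ` atoms \<phi> - S) \<union> (Atom ` atoms \<psi> - ?S))"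
        by (intro card_mono) auto
      then show ?thesis using card_Un_le order_trans by blast
    qed
    moreover have "card (binary_subformulas ?\<chi> - S)
        = 1 + (card (binary_subformulas \<phi> - S) + card (binary_subformulas \<psi> - ?S))"
    proof -
      have ni: "?\<chi> \<notin> subformulas \<phi>" "?\<chi> \<notin> subformulas \<psi>"
        using size_subformula[of ?\<chi>] by fastforce+
      have "binary_subformulas ?\<chi> - S
          = insert ?\<chi> ((binary_subformulas \<phi> - S) \<union> (binary_subformulas \<psi> - ?S))"
        using False by auto
      moreover have "?\<chi> \<notin> (binary_subformulas \<phi> - S) \<union> (binary_subformulas \<psi> - ?S)"
        using ni by blast
      moreover have "card ((binary_subformulas \<phi> - S) \<union> (binary_subformulas \<psi> - ?S))
          = card (binary_subformulas \<phi> - S) + card (binary_subformulas \<psi> - ?S)"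
        by (rule card_Un_disjoint) auto
      moreover have "finite ((binary_subformulas \<phi> - S) \<union> (binary_subformulas \<psi> - ?S))" by simp
      ultimately show ?thesis using card_insert_disjoint by simp
    qed
    ultimately show ?thesis by linarith
  qed
qed

text \<open>Propositions and binary subformulas are disjoint sets of subformulas, and the former
  outnumber the latter by at most one. Chains over distinct propositions attain the bound.\<close>

lemma card_atoms_le_size: "2 * card (atoms \<phi>) \<le> ltl_size \<phi> + 1"
proof -
  have a: "card (Atom ` atoms \<phi>) = card (atoms \<phi>)"
    by (rule card_image) (auto simp: inj_on_def)
  have "card (Atom ` atoms \<phi> \<union> binary_subformulas \<phi>)
      = card (Atom ` atoms \<phi>) + card (binary_subformulas \<phi>)"
    by (rule card_Un_disjoint) auto
  moreover have "card (Atom ` atoms \<phi> \<union> binary_subformulas \<phi>) \<le> card (subformulas \<phi>)"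
    by (rule card_mono) (auto simp: Atom_in_subformulas)
  ultimately show ?thesis
    using card_atoms_le_binary_aux[of "{}" \<phi>] a by (simp add: ltl_size_def)
qed

text \<open>The only semantic fact applied to an arbitrary learned formula; it makes the lower bound
  independent of \<open>Ut\<close>, \<open>Bt\<close> and \<open>Bl\<close>.\<close>

lemma sem_cong_atoms:
  assumes "\<And>i. w i \<inter> atoms \<phi> = w' i \<inter> atoms \<phi>"
  shows "sem \<phi> w = sem \<phi> w'"
  using assms
proof (induction \<phi> arbitrary: w w')
  case (Atom p)
  then show ?case by (auto simp: set_eq_iff)
next
  case (Unary f \<phi>)
  have "sem \<phi> (suffix i w) = sem \<phi> (suffix i w')" for i
    by (rule Unary.IH) (use Unary.prems in simp)
  moreover from this[of 0] have "sem \<phi> w = sem \<phi> w'" by simp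
  ultimately show ?case by (cases f) (simp_all add: sem_F_def sem_G_def)
next
  case (Binary g \<phi> \<psi>)
  from Binary.prems have eq: "w i \<inter> atoms \<phi> = w' i \<inter> atoms \<phi>" "w i \<inter> atoms \<psi> = w' i \<inter> atoms \<psi>" for i
    by (auto simp: set_eq_iff)
  have "sem \<phi> (suffix i w) = sem \<phi> (suffix i w')" for i
    by (rule Binary.IH(1)) (simp add: eq)
  moreover from this[of 0] have "sem \<phi> w = sem \<phi> w'" by simp
  moreover have "sem \<psi> (suffix i w) = sem \<psi> (suffix i w')" for i
    by (rule Binary.IH(2)) (simp add: eq)
  moreover from this[of 0] have "sem \<psi> w = sem \<psi> w'" by simp
  ultimately show ?case
    by (cases g) (simp_all add: sem_F_def sem_G_def sem_U_def sem_R_def sem_W_def sem_M_def)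
qed

section \<open>Monotonicity and duality\<close>

lemma LTL_mono:
  "\<phi> \<in> LTL Props Ut Bt Bl \<Longrightarrow> Ut \<subseteq> Ut' \<Longrightarrow> Bt \<union> Bl \<subseteq> Bt' \<union> Bl' \<Longrightarrow> \<phi> \<in> LTL Props Ut' Bt' Bl'"
  by (induction rule: LTL.induct) (auto intro: LTL.intros)

text \<open>Determined by the law that \<not> g(a, b) is the dual of g at (\<not> a, \<not> b).
  Contraposition reverses an implication, hence \<open>NImpliedBy\<close> and not
  \<open>NImplies\<close> for \<open>Implies\<close>.\<close>

fun dual_op :: "binop \<Rightarrow> binop" where
  "dual_op Until = Release"
| "dual_op Release = Until"
| "dual_op WeakUntil = StrongRelease"
| "dual_op StrongRelease = WeakUntil"
| "dual_op Or = And"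
| "dual_op And = Or"
| "dual_op Implies = NImpliedBy"
| "dual_op ImpliedBy = NImplies"
| "dual_op Iff = NIff"
| "dual_op NOr = NAnd"
| "dual_op NAnd = NOr"
| "dual_op NImplies = ImpliedBy"
| "dual_op NImpliedBy = Implies"
| "dual_op NIff = Iff"

text \<open>Semantically a dual only in the absence of unary operators, as F would have to become G;
  the separating formulas contain none.\<close>

primrec dual :: "'p ltl \<Rightarrow> 'p ltl" where
  "dual (Atom p) = Atom p"
| "dual (Unary f \<phi>) = Unary f (dual \<phi>)"
| "dual (Binary g \<phi> \<psi>) = Binary (dual_op g) (dual \<phi>) (dual \<psi>)"

text \<open>Complementing the letters negates every proposition of \<open>Props\<close>, and the law
  behind \<open>dual_op\<close> carries the negation through each operator.\<close>

lemma sem_dual: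
  assumes "\<phi> \<in> LTL Props {} Bt Bl"
  shows "sem (dual \<phi>) (\<lambda>i. Props - w i) \<longleftrightarrow> \<not> sem \<phi> w"
  using assms
proof (induction arbitrary: w rule: LTL.induct)
  case (binary g \<phi> \<psi>)
  have s: "suffix i (\<lambda>i. Props - w i) = (\<lambda>j. Props - suffix i w j)" for i by auto
  show ?case
    by (cases g) (auto simp: sem_F_def sem_G_def sem_U_def sem_R_def sem_W_def sem_M_def s
        binary.IH simp del: suffix_nth)
qed auto

lemma dual_LTL: "\<phi> \<in> LTL Props {} {g} {} \<Longrightarrow> dual \<phi> \<in> LTL Props {} {dual_op g} {}"
  by (induction rule: LTL.induct) (auto intro: LTL.intros)

lemma ltl_size_dual: "ltl_size (dual \<phi>) \<le> ltl_size \<phi>"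
proof -
  have "subformulas (dual \<phi>) = dual ` subformulas \<phi>"
    by (induction \<phi>) auto
  then show ?thesis by (simp add: ltl_size_def card_image_le)
qed

lemma ltl_size_Atom [simp]: "ltl_size (Atom p) = 1"
  by (simp add: ltl_size_def)

lemma ltl_size_Binary: "ltl_size (Binary g \<phi> \<psi>) \<le> ltl_size \<phi> + ltl_size \<psi> + 1"
  using card_Un_le[of "subformulas \<phi>" "subformulas \<psi>"]
  by (simp add: ltl_size_def card_insert_if)

lemma sem_U_now: "Q w \<Longrightarrow> sem_U P Q w"
  by (auto simp: sem_U_def intro!: exI[of _ 0])

text \<open>If Q holds at the second position, the until is settled there at the latest.\<close>

lemma sem_U_iff_now:
  assumes "Q (suffix 1 w)"
  shows "sem_U P Q w \<longleftrightarrow> Q w \<or> P w"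
proof
  assume "sem_U P Q w"
  then obtain i where i: "Q (suffix i w)" "\<forall>j<i. P (suffix j w)" by (auto simp: sem_U_def)
  then show "Q w \<or> P w" by (cases i) (auto dest: spec[of _ 0])
next
  assume "Q w \<or> P w"
  then show "sem_U P Q w"
  proof
    assume "Q w" then show ?thesis by (rule sem_U_now)
  next
    assume "P w" with assms show ?thesis by (auto simp: sem_U_def intro!: exI[of _ 1])
  qed
qed

section \<open>From hitting sets to learning\<close>

text \<open>
  Up to duality there are three ways in which a binary operator combines the chosen propositions
  with a fixed proposition \<open>p\<close>: as a disjunction (\<open>Disj\<close>), as a difference \<open>p \<and> \<not>h\<^sub>1 \<and> \<not>h\<^sub>2 \<dots>\<close>
  (\<open>Diff\<close>), or, for the joint denial, as alternating differences and disjunctions (\<open>Nor\<close>).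
\<close>

datatype kind = Disj | Diff | Nor

fun op_kind :: "binop \<Rightarrow> kind" where
  "op_kind Until = Disj" | "op_kind Release = Disj"
| "op_kind WeakUntil = Disj" | "op_kind StrongRelease = Disj"
| "op_kind Or = Disj" | "op_kind And = Disj"
| "op_kind NIff = Disj" | "op_kind Iff = Disj"
| "op_kind NImplies = Diff" | "op_kind NImpliedBy = Diff"
| "op_kind Implies = Diff" | "op_kind ImpliedBy = Diff"
| "op_kind NOr = Nor" | "op_kind NAnd = Nor"

text \<open>One operator of each dual pair, namely the one reached by complementing the
  letters.\<close>

definition op_dual :: "binop \<Rightarrow> bool" where
  "op_dual g \<longleftrightarrow> g \<in> {Release, StrongRelease, And, Iff, Implies, ImpliedBy, NAnd}"

definition flip :: "bool \<Rightarrow> 'p set \<Rightarrow> 'p set \<Rightarrow> 'p set" where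
  "flip \<delta> Props L = (if \<delta> then Props - L else L)"

text \<open>
  Only the first letter varies. The tail makes \<open>p\<close> true from the second position on, so that
  \<open>x U \<psi>\<close> and \<open>x W \<psi>\<close> amount to \<open>x \<or> \<psi>\<close> for the formulas used below.
\<close>

definition upw :: "bool \<Rightarrow> 'p set \<Rightarrow> 'p \<Rightarrow> 'p set \<Rightarrow> 'p upword" where
  "upw \<delta> Props p L = ([flip \<delta> Props L], [flip \<delta> Props {p}])"

text \<open>First letters to be accepted, those of \<open>neg_letters\<close> being rejected. The
  pair {p}, {} forces p into the formula; {d} against {}, or {p, d} against {p}, forces the dummy d;
  C against {}, or C with p against {p}, forces a hit of C. A difference is true only where p is, so
  its dummies and constraints come on top of p.\<close>

definition pos_letters :: "kind \<Rightarrow> 'p \<Rightarrow> 'p list \<Rightarrow> 'p set list \<Rightarrow> 'p set list" where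
  "pos_letters \<kappa> p ds Cs =
    {p} # (if \<kappa> = Diff then [] else map (\<lambda>d. {d}) ds) @ (if \<kappa> = Disj then Cs else [])"

definition neg_letters :: "kind \<Rightarrow> 'p \<Rightarrow> 'p list \<Rightarrow> 'p set list \<Rightarrow> 'p set list" where
  "neg_letters \<kappa> p ds Cs =
    {} # (if \<kappa> = Diff then map (\<lambda>d. {p, d}) ds else []) @ (if \<kappa> = Disj then [] else map (insert p) Cs)"

text \<open>First letters of the words to accept: with complemented letters the two roles are
  exchanged.\<close>

definition fst_letters :: "bool \<Rightarrow> kind \<Rightarrow> 'p \<Rightarrow> 'p list \<Rightarrow> 'p set list \<Rightarrow> 'p set list" where
  "fst_letters \<delta> = (if \<delta> then neg_letters else pos_letters)"

definition snd_letters :: "bool \<Rightarrow> kind \<Rightarrow> 'p \<Rightarrow> 'p list \<Rightarrow> 'p set list \<Rightarrow> 'p set list" where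
  "snd_letters \<delta> = (if \<delta> then pos_letters else neg_letters)"

section \<open>From separating formulas to hitting sets\<close>

lemma word_of_upw:
  "word_of (upw \<delta> Props p L) = (\<lambda>i. flip \<delta> Props (if i = 0 then L else {p}))"
  by (auto simp: word_of_def upw_def conc_def iter_def fun_eq_iff)

text \<open>The words agree after the first letter and differ there at most on L' - L, complemented
  or not.\<close>

lemma differ_imp_hit:
  assumes "sem \<phi> (word_of (upw \<delta> Props p L)) \<noteq> sem \<phi> (word_of (upw \<delta> Props p L'))"
    and "L \<subseteq> L'"
  shows "atoms \<phi> \<inter> (L' - L) \<noteq> {}"
proof (rule ccontr)
  assume "\<not> ?thesis"
  then have "sem \<phi> (word_of (upw \<delta> Props p L)) = sem \<phi> (word_of (upw \<delta> Props p L'))"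
    using \<open>L \<subseteq> L'\<close> by (intro sem_cong_atoms) (auto simp: word_of_upw flip_def)
  with assms show False by simp
qed

text \<open>Of at most 2 N + 1 propositions, N + 1 are spent on p and the dummies. The sets in
  \<open>Cs\<close> avoid these, so the other N must hit them.\<close>

lemma learnable_imp_hitting:
  assumes learn: "learnable Ut Bt Bl n Props
      (upw \<delta> Props p ` set (fst_letters \<delta> \<kappa> p ds Cs))
      (upw \<delta> Props p ` set (snd_letters \<delta> \<kappa> p ds Cs)) (4 * N + 1)"
    and ds: "distinct ds" "length ds = N" "p \<notin> set ds"
    and Cs: "\<And>C. C \<in> set Cs \<Longrightarrow> p \<notin> C \<and> C \<inter> set ds = {}"
  shows "\<exists>H. finite H \<and> card H \<le> N \<and> (\<forall>C \<in> set Cs. H \<inter> C \<noteq> {})"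
proof -
  obtain \<phi> where size: "ltl_size \<phi> \<le> 4 * N + 1"
    and P: "\<And>L. L \<in> set (fst_letters \<delta> \<kappa> p ds Cs) \<Longrightarrow> sem \<phi> (word_of (upw \<delta> Props p L))"
    and N: "\<And>L. L \<in> set (snd_letters \<delta> \<kappa> p ds Cs) \<Longrightarrow> \<not> sem \<phi> (word_of (upw \<delta> Props p L))"
    using learn unfolding learnable_def by (elim bexE conjE) (metis imageI)
  \<comment> \<open>\<open>acc\<close> undoes the exchange of accepted and rejected words, so that
    both values of \<delta> are treated at once.\<close>
  define acc where "acc L \<longleftrightarrow> sem \<phi> (word_of (upw \<delta> Props p L)) \<noteq> \<delta>" for L
  have pos: "acc L" if "L \<in> set (pos_letters \<kappa> p ds Cs)" for L
    using that P[of L] N[of L] by (cases \<delta>) (auto simp: acc_def fst_letters_def snd_letters_def)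
  have neg: "\<not> acc L" if "L \<in> set (neg_letters \<kappa> p ds Cs)" for L
    using that P[of L] N[of L] by (cases \<delta>) (auto simp: acc_def fst_letters_def snd_letters_def)
  have hit: "atoms \<phi> \<inter> (L' - L) \<noteq> {}" if "acc L \<noteq> acc L'" "L \<subseteq> L'" for L L'
    using differ_imp_hit[of \<phi> \<delta> Props p L L'] that by (auto simp: acc_def)
  have base: "\<not> acc {}" "acc {p}"
    using neg[of "{}"] pos[of "{p}"] by (auto simp: pos_letters_def neg_letters_def)
  have p: "p \<in> atoms \<phi>" using hit[of "{}" "{p}"] base by auto
  have d: "d \<in> atoms \<phi>" if "d \<in> set ds" for d
  proof (cases "\<kappa> = Diff")
    case True
    then have "\<not> acc {p, d}" using neg[of "{p, d}"] that by (auto simp: neg_letters_def)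
    then show ?thesis using hit[of "{p}" "{p, d}"] base by auto
  next
    case False
    then have "acc {d}" using pos[of "{d}"] that by (auto simp: pos_letters_def)
    then show ?thesis using hit[of "{}" "{d}"] base by auto
  qed
  have C: "atoms \<phi> \<inter> C \<noteq> {}" if "C \<in> set Cs" for C
  proof (cases "\<kappa> = Disj")
    case True
    then have "acc C" using pos[of C] that by (auto simp: pos_letters_def)
    then show ?thesis using hit[of "{}" C] base by auto
  next
    case False
    then have "\<not> acc (insert p C)" using neg[of "insert p C"] that by (auto simp: neg_letters_def)
    then show ?thesis using hit[of "{p}" "insert p C"] base by auto
  qed
  let ?D = "insert p (set ds)"
  have "card ?D = N + 1" using ds by (simp add: distinct_card)
  moreover have "?D \<subseteq> atoms \<phi>" using p d by auto
  ultimately have "card (atoms \<phi> - ?D) = card (atoms \<phi>) - (N + 1)"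
    by (subst card_Diff_subset) auto
  moreover have "card (atoms \<phi>) \<le> 2 * N + 1"
    using card_atoms_le_size[of \<phi>] size by simp
  ultimately have "card (atoms \<phi> - ?D) \<le> N" by simp
  moreover have "\<forall>X \<in> set Cs. (atoms \<phi> - ?D) \<inter> X \<noteq> {}" using C Cs by blast
  ultimately show ?thesis by (intro exI[of _ "atoms \<phi> - ?D"]) auto
qed

text \<open>\<open>NImplies\<close> is the exception because \<phi> \<and> \<not> x is the negation
  of \<phi> \<longrightarrow> x, with the chain on the left.\<close>

fun attach :: "binop \<Rightarrow> 'p \<Rightarrow> 'p ltl \<Rightarrow> 'p ltl" where
  "attach g x \<phi> = (if g = NImplies then Binary g \<phi> (Atom x) else Binary g (Atom x) \<phi>)"

definition chain :: "binop \<Rightarrow> 'p list \<Rightarrow> 'p \<Rightarrow> 'p ltl" where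
  "chain g xs p = foldr (attach g) xs (Atom p)"

lemma chain_simps [simp]:
  "chain g [] p = Atom p" "chain g (x # xs) p = attach g x (chain g xs p)"
  by (simp_all add: chain_def)

lemma chain_LTL: "set xs \<subseteq> Props \<Longrightarrow> p \<in> Props \<Longrightarrow> chain g xs p \<in> LTL Props {} {g} {}"
  by (induction xs) (auto intro!: LTL.intros)

lemma ltl_size_chain: "ltl_size (chain g xs p) \<le> 2 * length xs + 1"
proof (induction xs)
  case (Cons x xs)
  then show ?case
    using ltl_size_Binary[of g "Atom x" "chain g xs p"] ltl_size_Binary[of g "chain g xs p" "Atom x"]
    by (cases "g = NImplies") auto
qed simp

text \<open>The hypothesis on \<open>w 0\<close> makes exclusive disjunction agree with disjunction.\<close>

lemma sem_chain_Disj: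
  assumes "g \<in> {Until, WeakUntil, Or, NIff}" "distinct xs" "p \<notin> set xs"
    and "\<And>i. i > 0 \<Longrightarrow> w i = {p}" "w 0 \<inter> insert p (set xs) \<subseteq> {a}"
  shows "sem (chain g xs p) w \<longleftrightarrow> w 0 \<inter> insert p (set xs) \<noteq> {}"
proof -
  \<comment> \<open>From the second position on p is true and every x is false, so each chain is
    true there, also under exclusive disjunction.\<close>
  have later: "sem (chain g xs p) (suffix i w)" if "i > 0" "p \<notin> set xs" for i xs
    using that
  proof (induction xs)
    case Nil
    then show ?case using assms(4)[of i] by simp
  next
    case (Cons x xs)
    have "sem (chain g xs p) (suffix i w)" by (rule Cons.IH) (use Cons.prems in auto)
    moreover have "x \<notin> suffix i w 0" using assms(4)[of i] Cons.prems by auto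
    ultimately show ?case using assms(1) by (auto simp: sem_W_def intro: sem_U_now simp del: suffix_nth)
  qed
  show ?thesis using assms(2,3,5)
  proof (induction xs)
    case Nil
    then show ?case by auto
  next
    case (Cons x xs)
    then have IH: "sem (chain g xs p) w \<longleftrightarrow> w 0 \<inter> insert p (set xs) \<noteq> {}" by auto
    have now: "sem_U (sem (Atom x)) (sem (chain g xs p)) w \<longleftrightarrow> sem (chain g xs p) w \<or> x \<in> w 0"
      using later[of 1 xs] Cons.prems by (subst sem_U_iff_now) auto
    \<comment> \<open>The extra case of weak until makes x true now, which is covered by the
      disjunction.\<close>
    have G: "sem_G (sem (Atom x)) w \<Longrightarrow> x \<in> w 0"
      by (auto simp: sem_G_def dest: spec[of _ 0])
    have "x \<in> w 0 \<Longrightarrow> w 0 \<inter> insert p (set xs) = {}" using Cons.prems by auto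
    then show ?case using assms(1) IH now G by (auto simp: sem_W_def)
  qed
qed

lemma sem_chain_Diff:
  assumes "g \<in> {NImplies, NImpliedBy}"
  shows "sem (chain g xs p) w \<longleftrightarrow> p \<in> w 0 \<and> w 0 \<inter> set xs = {}"
  using assms by (induction xs) auto

text \<open>The denial with d restores the sign that the denial with h reverses: one pair turns
  \<phi> into \<not> h \<and> (d \<or> \<phi>).\<close>

fun nor_chain :: "('p \<times> 'p) list \<Rightarrow> 'p \<Rightarrow> 'p ltl" where
  "nor_chain [] p = Atom p"
| "nor_chain ((h, d) # xs) p = Binary NOr (Atom h) (Binary NOr (Atom d) (nor_chain xs p))"

lemma nor_chain_LTL:
  "set xs \<subseteq> Props \<times> Props \<Longrightarrow> p \<in> Props \<Longrightarrow> nor_chain xs p \<in> LTL Props {} {NOr} {}"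
  by (induction xs p rule: nor_chain.induct) (auto intro!: LTL.intros)

lemma ltl_size_nor_chain: "ltl_size (nor_chain xs p) \<le> 4 * length xs + 1"
proof (induction xs p rule: nor_chain.induct)
  case (2 h d xs p)
  then show ?case
    using ltl_size_Binary[of NOr "Atom h" "Binary NOr (Atom d) (nor_chain xs p)"]
      ltl_size_Binary[of NOr "Atom d" "nor_chain xs p"]
    by simp
qed simp

text \<open>Every letter of the instance avoids all dummies or all chosen propositions. On the
  former kind the alternating chain is a difference, on the latter, by the next lemma, a
  disjunction.\<close>

lemma sem_nor_chain_no_snd:
  "w 0 \<inter> snd ` set xs = {} \<Longrightarrow> sem (nor_chain xs p) w \<longleftrightarrow> p \<in> w 0 \<and> w 0 \<inter> fst ` set xs = {}"
  by (induction xs p rule: nor_chain.induct) auto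

lemma sem_nor_chain_no_fst:
  "w 0 \<inter> fst ` set xs = {} \<Longrightarrow> sem (nor_chain xs p) w \<longleftrightarrow> p \<in> w 0 \<or> w 0 \<inter> snd ` set xs \<noteq> {}"
  by (induction xs p rule: nor_chain.induct) auto

text \<open>Chosen propositions and dummies form a chain of 2 N links, or N double links for
  \<open>NOr\<close>; with p at its end this gives size at most 4 N + 1.\<close>

lemma separating_formula:
  assumes g: "\<not> op_dual g"
    and ds: "distinct ds" "length ds = N" "p \<notin> set ds" "set ds \<subseteq> Props" "p \<in> Props"
    and Cs: "\<And>C. C \<in> set Cs \<Longrightarrow> p \<notin> C \<and> C \<inter> set ds = {}"
    and hs: "distinct hs" "length hs = N" "set hs \<inter> insert p (set ds) = {}" "set hs \<subseteq> Props"
    and exact: "\<And>C. C \<in> set Cs \<Longrightarrow> \<exists>!h. h \<in> set hs \<inter> C"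
  shows "\<exists>\<phi> \<in> LTL Props {} {g} {}. ltl_size \<phi> \<le> 4 * N + 1 \<and>
      (\<forall>w. w 0 \<in> set (pos_letters (op_kind g) p ds Cs) \<longrightarrow> (\<forall>i>0. w i = {p}) \<longrightarrow> sem \<phi> w) \<and>
      (\<forall>w. w 0 \<in> set (neg_letters (op_kind g) p ds Cs) \<longrightarrow> (\<forall>i>0. w i = {p}) \<longrightarrow> \<not> sem \<phi> w)"
proof -
  let ?xs = "hs @ ds"
  have xs: "distinct ?xs" "p \<notin> set ?xs" "set ?xs \<subseteq> Props" "length ?xs = 2 * N" using ds hs by auto
  have C1: "\<exists>h. C \<inter> set hs = {h}" if "C \<in> set Cs" for C
    using exact[OF that] by blast
  consider "op_kind g = Disj" | "op_kind g = Diff" | "op_kind g = Nor" by (cases "op_kind g") auto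
  then show ?thesis
  proof cases
    case 1
    then have g': "g \<in> {Until, WeakUntil, Or, NIff}" using g by (cases g) (auto simp: op_dual_def)
    have sem: "sem (chain g ?xs p) w \<longleftrightarrow> w 0 \<inter> insert p (set ?xs) \<noteq> {}"
      if "\<forall>i>0. w i = {p}" "w 0 \<inter> insert p (set ?xs) \<subseteq> {a}" for w a
      using sem_chain_Disj[OF g' xs(1,2)] that by blast
    have "sem (chain g ?xs p) w"
      if w0: "w 0 \<in> set (pos_letters Disj p ds Cs)" and w: "\<forall>i>0. w i = {p}" for w
    proof -
      \<comment> \<open>An accepted letter contains exactly one proposition of the chain; for a
        constraint this is the exactness of the hitting set.\<close>
      have "\<exists>a. w 0 \<inter> insert p (set ?xs) = {a}"
      proof -
        consider "w 0 = {p}" | d where "d \<in> set ds" "w 0 = {d}" | "w 0 \<in> set Cs"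
          using w0 by (auto simp: pos_letters_def)
        then show ?thesis
        proof cases
          case 3
          then have "w 0 \<inter> insert p (set ?xs) = w 0 \<inter> set hs" using Cs by auto
          then show ?thesis using C1[OF 3] by auto
        qed auto
      qed
      then obtain a where a: "w 0 \<inter> insert p (set ?xs) = {a}" by blast
      show ?thesis using sem[OF w, of a] a by (metis insert_not_empty order_refl)
    qed
    \<comment> \<open>Only the empty letter is rejected here, so any value serves as the bound
      a.\<close>
    moreover have "\<not> sem (chain g ?xs p) w"
      if "w 0 \<in> set (neg_letters Disj p ds Cs)" "\<forall>i>0. w i = {p}" for w
      using sem[of w undefined] that by (auto simp: neg_letters_def)
    moreover have "ltl_size (chain g ?xs p) \<le> 4 * N + 1" using ltl_size_chain[of g ?xs p] xs(4) by linarith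
    moreover have "chain g ?xs p \<in> LTL Props {} {g} {}" by (rule chain_LTL[OF xs(3) ds(5)])
    ultimately show ?thesis unfolding 1 by (intro bexI[of _ "chain g ?xs p"]) simp_all
  next
    case 2
    then have g': "g \<in> {NImplies, NImpliedBy}" using g by (cases g) (auto simp: op_dual_def)
    note sem = sem_chain_Diff[OF g', of ?xs p]
    have "sem (chain g ?xs p) w" if "w 0 \<in> set (pos_letters Diff p ds Cs)" for w
      using that xs(2) unfolding sem by (auto simp: pos_letters_def)
    moreover have "\<not> sem (chain g ?xs p) w" if w0: "w 0 \<in> set (neg_letters Diff p ds Cs)" for w
    proof -
      consider "w 0 = {}" | d where "d \<in> set ds" "w 0 = {p, d}" | C where "C \<in> set Cs" "w 0 = insert p C"
        using w0 by (auto simp: neg_letters_def)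
      then show ?thesis
      proof cases
        case 3
        from C1[OF 3(1)] 3(2) show ?thesis unfolding sem by auto
      qed (auto simp: sem)
    qed
    moreover have "ltl_size (chain g ?xs p) \<le> 4 * N + 1" using ltl_size_chain[of g ?xs p] xs(4) by linarith
    moreover have "chain g ?xs p \<in> LTL Props {} {g} {}" by (rule chain_LTL[OF xs(3) ds(5)])
    ultimately show ?thesis unfolding 2 by (intro bexI[of _ "chain g ?xs p"]) simp_all
  next
    case 3
    then have g': "g = NOr" using g by (cases g) (auto simp: op_dual_def)
    let ?z = "zip hs ds"
    have fst: "fst ` set ?z = set hs" and snd: "snd ` set ?z = set ds"
      using ds(2) hs(2) by (metis list.set_map map_fst_zip, metis list.set_map map_snd_zip)
    have "sem (nor_chain ?z p) w" if w0: "w 0 \<in> set (pos_letters Nor p ds Cs)" for w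
    proof -
      have *: "w 0 \<inter> set hs = {}" "p \<in> w 0 \<or> w 0 \<inter> set ds \<noteq> {}" using w0 hs(3) by (auto simp: pos_letters_def)
      then show ?thesis using sem_nor_chain_no_fst[of w ?z p] fst snd by simp
    qed
    moreover have "\<not> sem (nor_chain ?z p) w" if w0: "w 0 \<in> set (neg_letters Nor p ds Cs)" for w
    proof -
      have "w 0 \<inter> set ds = {}" using w0 Cs ds(3) by (fastforce simp: neg_letters_def)
      moreover have "\<not> (p \<in> w 0 \<and> w 0 \<inter> set hs = {})"
      proof -
        consider "w 0 = {}" | C where "C \<in> set Cs" "w 0 = insert p C"
          using w0 by (auto simp: neg_letters_def)
        then show ?thesis
        proof cases
          case 2
          from C1[OF 2(1)] 2(2) show ?thesis by auto
        qed auto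
      qed
      ultimately show ?thesis using sem_nor_chain_no_snd[of w ?z p] fst snd by simp
    qed
    moreover have "ltl_size (nor_chain ?z p) \<le> 4 * N + 1"
      using ltl_size_nor_chain[of ?z p] ds(2) hs(2) by simp
    moreover have "nor_chain ?z p \<in> LTL Props {} {g} {}"
    proof -
      have "set ?z \<subseteq> Props \<times> Props" using hs(4) ds(4) by (auto dest: set_zip_leftD set_zip_rightD)
      then show ?thesis unfolding g' by (rule nor_chain_LTL[OF _ ds(5)])
    qed
    ultimately show ?thesis unfolding 3 by (intro bexI[of _ "nor_chain ?z p"]) simp_all
  qed
qed

lemma exact_hitting_imp_learnable:
  assumes g: "g \<in> Bt \<union> Bl"
    and ds: "distinct ds" "length ds = N" "p \<notin> set ds" "set ds \<subseteq> Props" "p \<in> Props"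
    and Cs: "\<And>C. C \<in> set Cs \<Longrightarrow> p \<notin> C \<and> C \<inter> set ds = {}"
    and hs: "distinct hs" "length hs = N" "set hs \<inter> insert p (set ds) = {}" "set hs \<subseteq> Props"
    and exact: "\<And>C. C \<in> set Cs \<Longrightarrow> \<exists>!h. h \<in> set hs \<inter> C"
  shows "learnable Ut Bt Bl \<infinity> Props
      (upw (op_dual g) Props p ` set (fst_letters (op_dual g) (op_kind g) p ds Cs))
      (upw (op_dual g) Props p ` set (snd_letters (op_dual g) (op_kind g) p ds Cs)) (4 * N + 1)"
proof -
  let ?w = "\<lambda>L i. if i = 0 then L else {p}"
  show ?thesis
  proof (cases "op_dual g")
    case False
    obtain \<phi> where \<phi>: "\<phi> \<in> LTL Props {} {g} {}" "ltl_size \<phi> \<le> 4 * N + 1"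
      and pos: "\<forall>L \<in> set (pos_letters (op_kind g) p ds Cs). sem \<phi> (?w L)"
      and neg: "\<forall>L \<in> set (neg_letters (op_kind g) p ds Cs). \<not> sem \<phi> (?w L)"
      using separating_formula[OF False ds Cs hs exact] by fastforce
    have "\<phi> \<in> LTL Props Ut Bt Bl" by (rule LTL_mono[OF \<phi>(1)]) (use g in auto)
    with False \<phi>(2) show ?thesis unfolding learnable_def
      by (intro bexI[of _ \<phi>]) (simp_all add: fst_letters_def snd_letters_def word_of_upw flip_def pos neg)
  next
    case True
    \<comment> \<open>The formula is built for the dual operator and then dualized, which exchanges
      the accepted and the rejected letters.\<close>
    let ?g = "dual_op g"
    have g': "\<not> op_dual ?g" "op_kind ?g = op_kind g" "dual_op ?g = g"
      using True by (cases g; simp add: op_dual_def)+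
    obtain \<phi> where \<phi>: "\<phi> \<in> LTL Props {} {?g} {}" "ltl_size \<phi> \<le> 4 * N + 1"
      and pos: "\<forall>L \<in> set (pos_letters (op_kind g) p ds Cs). sem \<phi> (?w L)"
      and neg: "\<forall>L \<in> set (neg_letters (op_kind g) p ds Cs). \<not> sem \<phi> (?w L)"
      using separating_formula[OF g'(1) ds Cs hs exact] unfolding g'(2) by fastforce
    have "dual \<phi> \<in> LTL Props Ut Bt Bl"
      by (rule LTL_mono[OF dual_LTL[OF \<phi>(1)]]) (use g g' in auto)
    moreover have "ltl_size (dual \<phi>) \<le> 4 * N + 1" using ltl_size_dual \<phi>(2) order_trans by blast
    moreover have "sem (dual \<phi>) (word_of (upw True Props p L))
        \<longleftrightarrow> \<not> sem \<phi> (\<lambda>i. if i = 0 then L else {p})" for L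
      using sem_dual[OF \<phi>(1)] by (simp add: word_of_upw flip_def)
    ultimately show ?thesis using True unfolding learnable_def
      by (intro bexI[of _ "dual \<phi>"]) (simp_all add: fst_letters_def snd_letters_def pos neg)
  qed
qed

section \<open>Transducers over arbitrary finite alphabets\<close>

type_synonym ('s, 'a) control =
  "'s \<Rightarrow> insym \<Rightarrow> 'a \<Rightarrow> ('s \<times> move \<times> 'a \<times> move \<times> bool option) option"

type_synonym ('s, 'a) config = "'s \<times> nat \<times> (nat \<Rightarrow> 'a) \<times> nat \<times> bool list"

fun step :: "('s, 'a) control \<Rightarrow> bool list \<Rightarrow> ('s, 'a) config \<Rightarrow> ('s, 'a) config option" where
  "step D x (s, i, t, h, out) =
    (case D s (input_symbol x i) (t h) of
      None \<Rightarrow> None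
    | Some (s', d, a, m, b) \<Rightarrow>
        Some (s', min (move_nat d i) (length x + 1), t(h := a), move_nat m h,
          out @ (case b of None \<Rightarrow> [] | Some y \<Rightarrow> [y])))"

fun work_head :: "('s, 'a) config \<Rightarrow> nat" where
  "work_head (s, i, t, h, out) = h"

text \<open>Carrying the space bound along the steps lets a single halting run establish both the
  output and the space; determinism then covers all reachable configurations.\<close>

definition bounded_step ::
  "('s, 'a) control \<Rightarrow> bool list \<Rightarrow> nat \<Rightarrow> ('s, 'a) config \<Rightarrow> ('s, 'a) config \<Rightarrow> bool" where
  "bounded_step D x H c c' \<longleftrightarrow> step D x c = Some c' \<and> work_head c \<le> H \<and> work_head c' \<le> H"

text \<open>A halting deterministic run passes through every configuration reachable from its start,
  so whatever R says about the steps of that run holds of every path.\<close>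

lemma deterministic_path:
  assumes "R\<^sup>*\<^sup>* a z" and R: "\<And>c c'. R c c' \<Longrightarrow> f c = Some c'" and z: "f z = None"
    and "(\<lambda>c c'. f c = Some c')\<^sup>*\<^sup>* a d"
  shows "R\<^sup>*\<^sup>* a d"
proof -
  have "R\<^sup>*\<^sup>* a d \<and> R\<^sup>*\<^sup>* d z"
    using assms(4)
  proof (induction rule: rtranclp_induct)
    case (step d d')
    from step.IH have "R\<^sup>*\<^sup>* d z" by simp
    then obtain y where y: "R d y" "R\<^sup>*\<^sup>* y z"
      using step.hyps(2) z by (cases rule: converse_rtranclpE) auto
    with R[OF y(1)] step.hyps(2) have "y = d'" by simp
    with y step.IH show ?case by (meson rtranclp.rtrancl_into_rtrancl)
  qed (use assms(1) in simp)
  then show ?thesis by simp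
qed

text \<open>\<open>tr_init\<close> prescribes 0 both as the start state and as the blank.\<close>

lemma finite_inj_nat_zero:
  assumes "finite S"
  shows "\<exists>e :: 'a \<Rightarrow> nat. inj_on e S \<and> e s0 = 0"
proof -
  obtain g :: "'a \<Rightarrow> nat" where "inj_on g S"
    using finite_imp_inj_to_nat_seg[OF assms] by blast
  then have "inj_on (\<lambda>s. if s = s0 then 0 else Suc (g s)) S"
    by (auto simp: inj_on_def)
  then show ?thesis by (intro exI[of _ "\<lambda>s. if s = s0 then 0 else Suc (g s)"]) simp
qed

text \<open>States and symbols may come from infinite types, such as lists of commands; only finite
  sets closed under the control are encoded as numbers.\<close>

theorem logspace_computableI:
  fixes D :: "('s, 'a) control"
  assumes fin: "finite S" "finite A" and start: "s0 \<in> S" "a0 \<in> A"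
    and closed: "\<And>s i a s' d a' m b. s \<in> S \<Longrightarrow> a \<in> A \<Longrightarrow> D s i a = Some (s', d, a', m, b)
      \<Longrightarrow> s' \<in> S \<and> a' \<in> A"
    and run: "\<And>x. \<exists>c. (bounded_step D x (H x))\<^sup>*\<^sup>* (s0, 0, \<lambda>_. a0, 0, []) c
      \<and> step D x c = None \<and> snd (snd (snd (snd c))) = f x"
    and H: "\<And>x. real (H x) \<le> a * log 2 (real (length x) + 2)"
  shows "logspace_computable f"
proof -
  obtain es :: "'s \<Rightarrow> nat" where es: "inj_on es S" "es s0 = 0"
    using finite_inj_nat_zero[OF fin(1)] by blast
  obtain ea :: "'a \<Rightarrow> nat" where ea: "inj_on ea A" "ea a0 = 0"
    using finite_inj_nat_zero[OF fin(2)] by blast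
  \<comment> \<open>Numbers that encode nothing make the machine halt, so \<open>tr_wf\<close> has
    to be checked on encoded arguments only.\<close>
  define delta where "delta q i ss =
    (case ss of [y] \<Rightarrow> if q \<in> es ` S \<and> y \<in> ea ` A then
        map_option (\<lambda>(s', d, a', m, b). (es s', d, [(ea a', m)], b))
          (D (inv_into S es q) i (inv_into A ea y)) else None
      | _ \<Rightarrow> None)" for q i ss
  define M where "M = \<lparr>tr_states = Suc (Max (es ` S)), tr_symbols = Suc (Max (ea ` A)),
    tr_tapes = 1, tr_delta = delta\<rparr>"
  have less: "es s < tr_states M" "ea b < tr_symbols M" if "s \<in> S" "b \<in> A" for s b
    using that fin by (simp_all add: M_def less_Suc_eq_le)
  have wf: "tr_wf M"
    unfolding tr_wf_def
  proof (intro conjI allI impI)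
    show "0 < tr_states M" "0 < tr_symbols M" by (simp_all add: M_def)
  next
    fix q i ss q' d as b
    assume "tr_delta M q i ss = Some (q', d, as, b)"
    then obtain s y s' a' m where *: "s \<in> S" "y \<in> A" "D s i y = Some (s', d, a', m, b)"
      "q' = es s'" "as = [(ea a', m)]"
      using es(1) ea(1)
      by (auto simp: M_def delta_def split: list.splits if_splits)
    from closed[OF *(1-3)] less * show "q' < tr_states M" "length as = tr_tapes M"
      "\<forall>(s, m) \<in> set as. s < tr_symbols M"
      by (auto simp: M_def)
  qed
  define enc :: "('s, 'a) config \<Rightarrow> tr_config"
    where "enc = (\<lambda>(s, i, t, h, out). (es s, i, [(ea \<circ> t, h)], out))"
  define inv :: "('s, 'a) config \<Rightarrow> bool"
    where "inv = (\<lambda>(s, i, t, h, out). s \<in> S \<and> (\<forall>j. t j \<in> A))"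
  have enc_step: "tr_step M x (enc c) = map_option enc (step D x c)" if "inv c" for x c
  proof -
    obtain s i t h out where c: "c = (s, i, t, h, out)" by (cases c)
    have mem: "s \<in> S" "t h \<in> A" using that by (simp_all add: c inv_def)
    then have "delta (es s) j [ea (t h)] = map_option (\<lambda>(s', d, a', m, b). (es s', d, [(ea a', m)], b))
        (D s j (t h))" for j
      using es(1) ea(1) by (simp add: delta_def)
    then show ?thesis
      by (auto simp: c enc_def M_def fun_upd_def fun_eq_iff split: option.splits prod.splits)
  qed
  have inv_step: "inv c'" if inv: "inv c" and st: "step D x c = Some c'" for x c c'
  proof -
    obtain s i t h out where c: "c = (s, i, t, h, out)" by (cases c)
    obtain s' d a' m b where D: "D s (input_symbol x i) (t h) = Some (s', d, a', m, b)"
      using st by (auto simp: c split: option.splits)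
    have "s' \<in> S \<and> a' \<in> A" by (rule closed[OF _ _ D]) (use inv in \<open>simp_all add: c inv_def\<close>)
    then show ?thesis using inv st D by (auto simp: c inv_def)
  qed
  have init: "tr_init M = enc (s0, 0, \<lambda>_. a0, 0, [])" "inv (s0, 0, \<lambda>_. a0, 0, [])"
    using es ea start by (auto simp: tr_init_def M_def enc_def inv_def)
  define R where "R x d d' \<longleftrightarrow> (\<exists>c c'. inv c \<and> d = enc c \<and> d' = enc c' \<and> bounded_step D x (H x) c c')"
    for x d d'
  have R: "tr_step M x d = Some d'" if "R x d d'" for x d d'
    using that enc_step by (auto simp: R_def bounded_step_def)
  have path: "\<exists>c. (R x)\<^sup>*\<^sup>* (tr_init M) (enc c) \<and> tr_step M x (enc c) = None
      \<and> snd (snd (snd (snd c))) = f x" for x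
  proof -
    obtain c where c: "(bounded_step D x (H x))\<^sup>*\<^sup>* (s0, 0, \<lambda>_. a0, 0, []) c"
      "step D x c = None" "snd (snd (snd (snd c))) = f x"
      using run by blast
    from c(1) have "(R x)\<^sup>*\<^sup>* (tr_init M) (enc c) \<and> inv c"
    proof (induction rule: rtranclp_induct)
      case base
      then show ?case using init by simp
    next
      case (step c c')
      have "inv c'" by (rule inv_step) (use step in \<open>auto simp: bounded_step_def\<close>)
      moreover have "R x (enc c) (enc c')" unfolding R_def using step by blast
      ultimately have "R x (enc c) (enc c')" "inv c'" by simp_all
      with step.IH show ?case by (meson rtranclp.rtrancl_into_rtrancl)
    qed
    with c enc_step[of c x] show ?thesis by (intro exI[of _ c]) simp
  qed
  have "tr_computes M f"
    unfolding tr_computes_def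
  proof
    fix x
    obtain c where c: "(R x)\<^sup>*\<^sup>* (tr_init M) (enc c)" "tr_step M x (enc c) = None"
      "snd (snd (snd (snd c))) = f x"
      using path by blast
    have "(\<lambda>c c'. tr_step M x c = Some c')\<^sup>*\<^sup>* (tr_init M) (enc c)"
      by (rule mono_rtranclp[rule_format, OF _ c(1)]) (rule R)
    with c show "\<exists>q i ws. tr_reaches M x (q, i, ws, f x) \<and> tr_step M x (q, i, ws, f x) = None"
      by (cases c) (force simp: tr_reaches_def enc_def)
  qed
  moreover have "tr_log_space M"
    unfolding tr_log_space_def
  proof (intro exI[of _ a] allI impI)
    fix x q i ws out
    assume "tr_reaches M x (q, i, ws, out)"
    then have "(R x)\<^sup>*\<^sup>* (tr_init M) (q, i, ws, out)"
      using path[of x] R unfolding tr_reaches_def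
      by (elim exE conjE) (rule deterministic_path[where f = "tr_step M x"])
    then have "\<forall>(t, h) \<in> set ws. h \<le> H x"
    proof (cases rule: rtranclp.cases)
      case rtrancl_refl
      then show ?thesis by (auto simp: tr_init_def)
    next
      case (rtrancl_into_rtrancl d)
      then obtain c' where "(q, i, ws, out) = enc c'" "work_head c' \<le> H x"
        by (auto simp: R_def bounded_step_def)
      then show ?thesis by (cases c') (auto simp: enc_def)
    qed
    with H[of x] show "\<forall>(t, h) \<in> set ws. real h \<le> a * log 2 (real (length x) + 2)"
      by (fastforce dest: of_nat_mono)
  qed
  ultimately show ?thesis using wf unfolding logspace_computable_def by blast
qed

section \<open>Register programs\<close>

text \<open>The equality test has the shape of an addition, so one kind of sweep over the tape
  performs both.\<close>

datatype test = TEq nat nat bool nat | TSym "insym \<Rightarrow> bool"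

datatype cmd = Skip | Put bool | Add nat nat bool nat | Move move
  | Seq cmd cmd | If test cmd cmd | Until test cmd

type_synonym store = "(nat \<Rightarrow> nat) \<times> nat"

fun holds :: "bool list \<Rightarrow> store \<Rightarrow> test \<Rightarrow> bool" where
  "holds x (\<sigma>, h) (TEq i j b k) \<longleftrightarrow> \<sigma> i + \<sigma> j + of_bool b = \<sigma> k"
| "holds x (\<sigma>, h) (TSym P) \<longleftrightarrow> P (input_symbol x h)"

text \<open>V bounds the values written by additions; the logarithm of V will bound the work
  tape.\<close>

inductive exec :: "bool list \<Rightarrow> nat \<Rightarrow> cmd \<Rightarrow> store \<Rightarrow> bool list \<Rightarrow> store \<Rightarrow> bool"
  for x :: "bool list" and V :: nat where
  Skip: "exec x V Skip s [] s"
| Put: "exec x V (Put b) s [b] s"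
| Add: "\<sigma> i + \<sigma> j + of_bool b \<le> V \<Longrightarrow>
    exec x V (Add i j b k) (\<sigma>, h) [] (\<sigma>(k := \<sigma> i + \<sigma> j + of_bool b), h)"
| Move: "exec x V (Move d) (\<sigma>, h) [] (\<sigma>, min (move_nat d h) (length x + 1))"
| Seq: "exec x V a s u s' \<Longrightarrow> exec x V b s' v s'' \<Longrightarrow> exec x V (Seq a b) s (u @ v) s''"
| If: "exec x V (if holds x s t then a else b) s u s' \<Longrightarrow> exec x V (If t a b) s u s'"
| UntilT: "holds x s t \<Longrightarrow> exec x V (Until t a) s [] s"
| UntilF: "\<not> holds x s t \<Longrightarrow> exec x V a s u s' \<Longrightarrow> exec x V (Until t a) s' v s''
    \<Longrightarrow> exec x V (Until t a) s (u @ v) s''"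

text \<open>
  The registers are stored in binary, least significant bit first: the cell at distance \<open>j + 1\<close>
  from the left end marker holds the set of registers whose bit \<open>j\<close> is \<open>1\<close>. Between commands the
  head is on the marker; an addition or a comparison is one sweep to the first blank and back.
\<close>

datatype cell = Blank | Mark | Col "nat set"

text \<open>
  \<open>Home K\<close> is about to execute the commands \<open>K\<close>. \<open>Scan w i j k K K' c e\<close> adds the registers \<open>i\<close>
  and \<open>j\<close> with carry \<open>c\<close>; it writes the sum to \<open>k\<close> if \<open>w\<close> holds, and \<open>e\<close> records whether the sum has
  agreed with \<open>k\<close> so far. \<open>K\<close> and \<open>K'\<close> are the continuations for success and failure of the comparison.
\<close>

datatype state = Start | Home "cmd list"
  | Scan bool nat nat nat "cmd list" "cmd list" bool bool | Back "cmd list"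

fun add_bit :: "bool \<Rightarrow> bool \<Rightarrow> bool \<Rightarrow> bool" where
  "add_bit x y c \<longleftrightarrow> ((x \<noteq> y) \<noteq> c)"

fun carry_bit :: "bool \<Rightarrow> bool \<Rightarrow> bool \<Rightarrow> bool" where
  "carry_bit x y c \<longleftrightarrow> (x \<and> y) \<or> (c \<and> (x \<or> y))"

fun put_bit :: "bool \<Rightarrow> nat \<Rightarrow> bool \<Rightarrow> nat set \<Rightarrow> nat set" where
  "put_bit w k b v = (if w then (if b then insert k v else v - {k}) else v)"

fun branch :: "test \<Rightarrow> cmd list \<Rightarrow> cmd list \<Rightarrow> insym \<Rightarrow> cell \<Rightarrow>
    (state \<times> move \<times> cell \<times> move \<times> bool option) option" where
  "branch (TSym P) K K' y a = Some (Home (if P y then K else K'), Stay, a, Stay, None)"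
| "branch (TEq i j b k) K K' y a = Some (Scan False i j k K K' b True, Stay, a, MoveRight, None)"

text \<open>A scan ends at the first blank. There a remaining carry of an addition becomes a new
  most significant column containing only k, and a remaining carry of a comparison means
  failure.\<close>

fun control :: "cmd \<Rightarrow> (state, cell) control" where
  "control p Start y a = Some (Home [p], Stay, Mark, Stay, None)"
| "control p (Home []) y a = None"
| "control p (Home (Skip # K)) y a = Some (Home K, Stay, a, Stay, None)"
| "control p (Home (Put b # K)) y a = Some (Home K, Stay, a, Stay, Some b)"
| "control p (Home (Move d # K)) y a = Some (Home K, d, a, Stay, None)"
| "control p (Home (Add i j b k # K)) y a = Some (Scan True i j k K K b True, Stay, a, MoveRight, None)"
| "control p (Home (Seq c d # K)) y a = Some (Home (c # d # K), Stay, a, Stay, None)"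
| "control p (Home (If t c d # K)) y a = branch t (c # K) (d # K) y a"
| "control p (Home (Until t c # K)) y a = branch t K (c # Until t c # K) y a"
| "control p (Scan w i j k K K' c e) y (Col v) =
    (let b = add_bit (i \<in> v) (j \<in> v) c in
      Some (Scan w i j k K K' (carry_bit (i \<in> v) (j \<in> v) c) (e \<and> (b \<longleftrightarrow> k \<in> v)), Stay,
        Col (put_bit w k b v), MoveRight, None))"
| "control p (Scan w i j k K K' c e) y a =
    Some (Back (if e \<and> \<not> c then K else K'), Stay, (if w \<and> c then Col {k} else a), MoveLeft, None)"
| "control p (Back K) y a =
    (if a = Mark then Some (Home K, Stay, a, Stay, None) else Some (Back K, Stay, a, MoveLeft, None))"

abbreviation run :: "cmd \<Rightarrow> bool list \<Rightarrow> nat \<Rightarrow> (state, cell) config \<Rightarrow> (state, cell) config \<Rightarrow> bool" where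
  "run p x H \<equiv> (bounded_step (control p) x H)\<^sup>*\<^sup>*"

section \<open>Binary arithmetic on columns\<close>

primrec val :: "nat set list \<Rightarrow> nat \<Rightarrow> nat" where
  "val [] r = 0"
| "val (v # vs) r = of_bool (r \<in> v) + 2 * val vs r"

lemma val_append: "val (us @ vs) r = val us r + 2 ^ length us * val vs r"
  by (induction us) auto

text \<open>The effect of a whole scan on the columns, which separates the arithmetic from the
  machine steps.\<close>

fun sweep :: "bool \<Rightarrow> nat \<Rightarrow> nat \<Rightarrow> nat \<Rightarrow> nat set list \<Rightarrow> bool \<Rightarrow> bool \<Rightarrow> nat set list \<times> bool \<times> bool" where
  "sweep w i j k [] c e = ([], c, e)"
| "sweep w i j k (v # vs) c e =
    (let b = add_bit (i \<in> v) (j \<in> v) c;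
         (vs', c', e') = sweep w i j k vs (carry_bit (i \<in> v) (j \<in> v) c) (e \<and> (b \<longleftrightarrow> k \<in> v))
     in (put_bit w k b v # vs', c', e'))"

text \<open>Ripple-carry addition. Each column is read before it is written, so k may coincide with
  i or j.\<close>

lemma sweep_write:
  assumes "sweep True i j k vs c e = (vs', c', e')"
  shows "length vs' = length vs" "r \<noteq> k \<Longrightarrow> val vs' r = val vs r"
    "val vs' k + 2 ^ length vs * of_bool c' = val vs i + val vs j + of_bool c"
  using assms
proof (induction vs arbitrary: c e vs')
  case (Cons v vs)
  {
    case 1
    then show ?case using Cons.IH(1) by (auto simp: Let_def split: prod.splits)
  next
    case 2
    then show ?case using Cons.IH(2) by (auto simp: Let_def split: prod.splits)
  next
    case 3
    then obtain vs'' where vs'': "sweep True i j k vs (carry_bit (i \<in> v) (j \<in> v) c)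
        (e \<and> (add_bit (i \<in> v) (j \<in> v) c \<longleftrightarrow> k \<in> v)) = (vs'', c', e')"
      "vs' = put_bit True k (add_bit (i \<in> v) (j \<in> v) c) v # vs''"
      by (auto simp: Let_def split: prod.splits)
    from Cons.IH(3)[OF vs''(1)] show ?case
      by (cases "i \<in> v"; cases "j \<in> v"; cases c) (simp_all add: vs''(2))
  }
qed auto

text \<open>Parity decides the lowest bit; halving leaves the same equation with the new
  carry.\<close>

lemma full_adder:
  fixes a b d :: nat
  shows "of_bool x + 2 * a + (of_bool y + 2 * b) + of_bool c = of_bool z + 2 * d \<longleftrightarrow>
    (add_bit x y c \<longleftrightarrow> z) \<and> a + b + of_bool (carry_bit x y c) = d"
  by (cases x; cases y; cases c; cases z; simp; presburger?)

text \<open>Both sides have at most as many bits as there are columns, so they are equal if and only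
  if all bits agree and no carry is left.\<close>

lemma sweep_read:
  assumes "sweep False i j k vs c e = (vs', c', e')"
  shows "vs' = vs" "e' \<and> \<not> c' \<longleftrightarrow> e \<and> val vs i + val vs j + of_bool c = val vs k"
  using assms
proof (induction vs arbitrary: c e vs')
  case (Cons v vs)
  {
    case 1
    then show ?case using Cons.IH(1) by (auto simp: Let_def split: prod.splits)
  next
    case 2
    then obtain vs'' where vs'': "sweep False i j k vs (carry_bit (i \<in> v) (j \<in> v) c)
        (e \<and> (add_bit (i \<in> v) (j \<in> v) c \<longleftrightarrow> k \<in> v)) = (vs'', c', e')"
      by (auto simp: Let_def split: prod.splits)
    from Cons.IH(2)[OF vs''] show ?case
      by (simp only: val.simps full_adder) blast
  }
qed auto

definition tape :: "nat set list \<Rightarrow> nat \<Rightarrow> cell" where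
  "tape vs i = (if i = 0 then Mark else if i \<le> length vs then Col (vs ! (i - 1)) else Blank)"

lemma tape_0 [simp]: "tape vs 0 = Mark"
  by (simp add: tape_def)

lemma tape_Suc: "tape vs (Suc i) = (if i < length vs then Col (vs ! i) else Blank)"
  by (simp add: tape_def)

lemma tape_upd: "i < length vs \<Longrightarrow> (tape vs)(Suc i := Col v) = tape (vs[i := v])"
  by (auto simp: tape_def fun_eq_iff nth_list_update)

lemma tape_snoc: "(tape vs)(Suc (length vs) := Col v) = tape (vs @ [v])"
  by (auto simp: tape_def fun_eq_iff nth_append)

section \<open>Runs of the control\<close>

lemma bounded_stepI:
  assumes "step D x c = Some c'" "work_head c \<le> H" "work_head c' \<le> H"
  shows "(bounded_step D x H)\<^sup>*\<^sup>* c c'"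
  using assms by (auto simp: bounded_step_def)

lemma scan_run:
  assumes "sweep w i j k vs c e = (vs', c', e')" "length us + length vs < H" "h \<le> length x + 1"
  shows "run p x H
      (Scan w i j k K K' c e, h, tape (us @ vs), Suc (length us), out)
      (Scan w i j k K K' c' e', h, tape (us @ vs'), Suc (length us + length vs), out)"
  using assms
proof (induction vs arbitrary: us c e vs')
  case (Cons v vs)
  let ?b = "add_bit (i \<in> v) (j \<in> v) c" and ?c = "carry_bit (i \<in> v) (j \<in> v) c"
  let ?v = "put_bit w k ?b v" and ?e = "e \<and> (add_bit (i \<in> v) (j \<in> v) c \<longleftrightarrow> k \<in> v)"
  obtain vs'' where vs'': "sweep w i j k vs ?c ?e = (vs'', c', e')" "vs' = ?v # vs''"
    using Cons.prems(1) by (auto simp: Let_def split: prod.splits)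
  have 1: "run p x H
      (Scan w i j k K K' c e, h, tape (us @ v # vs), Suc (length us), out)
      (Scan w i j k K K' ?c ?e, h, tape ((us @ [?v]) @ vs), Suc (length (us @ [?v])), out)"
    using Cons.prems(2,3)
    by (intro bounded_stepI)
      (auto simp: tape_Suc tape_upd list_update_append Let_def simp del: put_bit.simps add_bit.simps carry_bit.simps)
  have 2: "run p x H
      (Scan w i j k K K' ?c ?e, h, tape ((us @ [?v]) @ vs), Suc (length (us @ [?v])), out)
      (Scan w i j k K K' c' e', h, tape ((us @ [?v]) @ vs''), Suc (length (us @ [?v]) + length vs), out)"
    by (rule Cons.IH[OF vs''(1)]) (use Cons.prems(2,3) in simp_all)
  show ?case using rtranclp_trans[OF 1 2] by (simp add: vs''(2) del: put_bit.simps add_bit.simps carry_bit.simps)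
qed auto

lemma back_run:
  assumes "q \<le> length vs" "length vs \<le> H" "h \<le> length x + 1"
  shows "run p x H
      (Back K, h, tape vs, q, out) (Home K, h, tape vs, 0, out)"
  using assms
proof (induction q)
  case 0
  then show ?case by (intro bounded_stepI) (auto simp: fun_upd_idem)
next
  case (Suc q)
  have 1: "run p x H (Back K, h, tape vs, Suc q, out) (Back K, h, tape vs, q, out)"
    using Suc.prems by (intro bounded_stepI) (auto simp: tape_Suc fun_upd_idem)
  have 2: "run p x H (Back K, h, tape vs, q, out) (Home K, h, tape vs, 0, out)"
    using Suc by simp
  show ?case by (rule rtranclp_trans[OF 1 2])
qed

lemma sweep_run:
  assumes sw: "sweep w i j k vs c True = (vs', c', e')" and "length vs < H" "h \<le> length x + 1"
    and vs'': "vs'' = vs' @ (if w \<and> c' then [{k}] else [])" and "length vs' = length vs"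
    and start: "control p (Home L) (input_symbol x h) Mark = Some (Scan w i j k K K' c True, Stay, Mark, MoveRight, None)"
  shows "run p x H (Home L, h, tape vs, 0, out)
      (Home (if e' \<and> \<not> c' then K else K'), h, tape vs'', 0, out)"
proof -
  have 1: "run p x H (Home L, h, tape vs, 0, out)
      (Scan w i j k K K' c True, h, tape vs, Suc 0, out)"
    using assms by (intro bounded_stepI) (auto simp: fun_upd_idem)
  have 2: "run p x H
      (Scan w i j k K K' c True, h, tape vs, Suc 0, out)
      (Scan w i j k K K' c' e', h, tape vs', Suc (length vs), out)"
    using scan_run[OF sw, of "[]"] assms by simp
  have 3: "run p x H
      (Scan w i j k K K' c' e', h, tape vs', Suc (length vs), out)
      (Back (if e' \<and> \<not> c' then K else K'), h, tape vs'', length vs, out)"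
    using assms(2,3,5) tape_snoc[of vs' "{k}"]
    by (intro bounded_stepI) (auto simp: vs'' tape_Suc fun_upd_idem)
  have 4: "run p x H
      (Back (if e' \<and> \<not> c' then K else K'), h, tape vs'', length vs, out)
      (Home (if e' \<and> \<not> c' then K else K'), h, tape vs'', 0, out)"
    using assms by (intro back_run) (auto simp: vs'')
  show ?thesis by (rule rtranclp_trans[OF 1 rtranclp_trans[OF 2 rtranclp_trans[OF 3 4]]])
qed

lemma branch_run:
  assumes "control p (Home L) = branch t K K'" "length vs < H" "h \<le> length x + 1"
  shows "run p x H (Home L, h, tape vs, 0, out)
      (Home (if holds x (val vs, h) t then K else K'), h, tape vs, 0, out)"
proof (cases t)
  case (TSym P)
  then show ?thesis using assms by (intro bounded_stepI) (auto simp: fun_upd_idem)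
next
  case (TEq i j b k)
  obtain vs' c' e' where sw: "sweep False i j k vs b True = (vs', c', e')" by (cases "sweep False i j k vs b True")
  note r = sweep_read[OF sw]
  have "(e' \<and> \<not> c') = holds x (val vs, h) t" using r(2) TEq by simp
  moreover have "run p x H (Home L, h, tape vs, 0, out)
      (Home (if e' \<and> \<not> c' then K else K'), h, tape vs, 0, out)"
    by (rule sweep_run[OF sw]) (use assms r TEq in auto)
  ultimately show ?thesis by simp
qed

lemma exec_head: "exec x V c s u s' \<Longrightarrow> snd s \<le> length x + 1 \<Longrightarrow> snd s' \<le> length x + 1"
  by (induction rule: exec.induct) auto

text \<open>The invariant 2 ^ \<open>length vs\<close> \<le> 2 V survives because a column is
  appended only when a sum overflows; then 2 ^ \<open>length vs\<close> is at most that sum, hence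
  at most V, and one column more costs a factor of two.\<close>

lemma exec_run:
  assumes "exec x V c s u s'"
    and "val vs = fst s" "2 ^ length vs \<le> 2 * V" "snd s \<le> length x + 1"
    and H: "\<And>L. 2 ^ L \<le> 2 * V \<Longrightarrow> L < H"
  shows "\<exists>vs'. val vs' = fst s' \<and> 2 ^ length vs' \<le> 2 * V \<and>
    run p x H (Home (c # K), snd s, tape vs, 0, out)
      (Home K, snd s', tape vs', 0, out @ u)"
  using assms(1-4)
proof (induction arbitrary: vs K out rule: exec.induct)
  case (Skip s)
  then show ?case
    by (intro exI[of _ vs] conjI bounded_stepI) (auto simp: fun_upd_idem)
next
  case (Put b s)
  then show ?case
    by (intro exI[of _ vs] conjI bounded_stepI) (auto simp: fun_upd_idem)
next
  case (Move d \<sigma> h)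
  then show ?case
    by (intro exI[of _ vs] conjI bounded_stepI) (auto simp: fun_upd_idem)
next
  case (Add \<sigma> i j b k h)
  obtain vs' c' e' where sw: "sweep True i j k vs b True = (vs', c', e')" by (cases "sweep True i j k vs b True")
  note w = sweep_write[OF sw]
  define vs'' where "vs'' = vs' @ (if c' then [{k}] else [])"
  have "val vs'' r = (\<sigma>(k := \<sigma> i + \<sigma> j + of_bool b)) r" for r
    using w(1,3) w(2)[of r] Add.prems(1) by (auto simp: vs''_def val_append)
  moreover have "2 ^ length vs'' \<le> 2 * V"
  proof (cases c')
    case True
    then have "2 ^ length vs \<le> V" using w(3) Add by auto
    then show ?thesis using True w(1) by (simp add: vs''_def)
  qed (use w(1) Add.prems in \<open>simp add: vs''_def\<close>)
  moreover have "run p x H (Home (Add i j b k # K), h, tape vs, 0, out)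
      (Home (if e' \<and> \<not> c' then K else K), h, tape vs'', 0, out)"
    by (rule sweep_run[OF sw]) (use Add.prems H w in \<open>auto simp: vs''_def\<close>)
  ultimately show ?case by (intro exI[of _ vs'']) auto
next
  case (Seq a s u s' b v s'')
  have st: "run p x H (Home (Seq a b # K), snd s, tape vs, 0, out)
      (Home (a # b # K), snd s, tape vs, 0, out)"
    using Seq.prems by (intro bounded_stepI) (auto simp: fun_upd_idem)
  obtain vs' where vs': "val vs' = fst s'" "2 ^ length vs' \<le> 2 * V"
    "run p x H (Home (a # b # K), snd s, tape vs, 0, out)
      (Home (b # K), snd s', tape vs', 0, out @ u)"
    using Seq.IH(1)[OF Seq.prems] by blast
  obtain vs'' where vs'': "val vs'' = fst s''" "2 ^ length vs'' \<le> 2 * V"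
    "run p x H (Home (b # K), snd s', tape vs', 0, out @ u)
      (Home K, snd s'', tape vs'', 0, (out @ u) @ v)"
    using Seq.IH(2)[OF vs'(1,2) exec_head[OF Seq.hyps(1) Seq.prems(3)]] by blast
  from rtranclp_trans[OF st rtranclp_trans[OF vs'(3) vs''(3)]] vs''(1,2)
  show ?case by (intro exI[of _ vs'']) simp
next
  case (If s t a b u s')
  have "run p x H (Home (If t a b # K), snd s, tape vs, 0, out)
      (Home (if holds x (val vs, snd s) t then a # K else b # K), snd s, tape vs, 0, out)"
    using If.prems H by (intro branch_run) (auto simp: fun_eq_iff)
  also have "(if holds x (val vs, snd s) t then a # K else b # K) = (if holds x s t then a else b) # K"
    using If.prems(1) by (cases s) auto
  finally show ?case using If.IH[OF If.prems] by (meson rtranclp_trans)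
next
  case (UntilT s t a)
  have "run p x H (Home (Until t a # K), snd s, tape vs, 0, out)
      (Home (if holds x (val vs, snd s) t then K else a # Until t a # K), snd s, tape vs, 0, out)"
    using UntilT.prems H by (intro branch_run) (auto simp: fun_eq_iff)
  with UntilT show ?case by (cases s) auto
next
  case (UntilF s t a u s' v s'')
  have "run p x H (Home (Until t a # K), snd s, tape vs, 0, out)
      (Home (if holds x (val vs, snd s) t then K else a # Until t a # K), snd s, tape vs, 0, out)"
    using UntilF.prems H by (intro branch_run) (auto simp: fun_eq_iff)
  moreover have "\<not> holds x (val vs, snd s) t" using UntilF.hyps(1) UntilF.prems(1) by (cases s) auto
  ultimately have st: "run p x H (Home (Until t a # K), snd s, tape vs, 0, out)
      (Home (a # Until t a # K), snd s, tape vs, 0, out)" by simp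
  obtain vs' where vs': "val vs' = fst s'" "2 ^ length vs' \<le> 2 * V"
    "run p x H (Home (a # Until t a # K), snd s, tape vs, 0, out)
      (Home (Until t a # K), snd s', tape vs', 0, out @ u)"
    using UntilF.IH(1)[OF UntilF.prems] by blast
  obtain vs'' where vs'': "val vs'' = fst s''" "2 ^ length vs'' \<le> 2 * V"
    "run p x H (Home (Until t a # K), snd s', tape vs', 0, out @ u)
      (Home K, snd s'', tape vs'', 0, (out @ u) @ v)"
    using UntilF.IH(2)[OF vs'(1,2) exec_head[OF UntilF.hyps(2) UntilF.prems(3)]] by blast
  from rtranclp_trans[OF st rtranclp_trans[OF vs'(3) vs''(3)]] vs''(1,2)
  show ?case by (intro exI[of _ vs'']) simp
qed

section \<open>Finiteness of the control\<close>

primrec conts :: "cmd \<Rightarrow> cmd list \<Rightarrow> cmd list set" where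
  "conts Skip K = {Skip # K}"
| "conts (Put b) K = {Put b # K}"
| "conts (Add i j b k) K = {Add i j b k # K}"
| "conts (Move d) K = {Move d # K}"
| "conts (Seq a b) K = insert (Seq a b # K) (conts a (b # K) \<union> conts b K)"
| "conts (If t a b) K = insert (If t a b # K) (conts a K \<union> conts b K)"
| "conts (Until t a) K = insert (Until t a # K) (conts a (Until t a # K))"

fun succs :: "cmd list \<Rightarrow> cmd list set" where
  "succs [] = {}"
| "succs (Seq a b # K) = {a # b # K}"
| "succs (If t a b # K) = {a # K, b # K}"
| "succs (Until t a # K) = {K, a # Until t a # K}"
| "succs (c # K) = {K}"

fun test_regs :: "test \<Rightarrow> nat set" where
  "test_regs (TEq i j b k) = {i, j, k}"
| "test_regs (TSym P) = {}"

primrec regs :: "cmd \<Rightarrow> nat set" where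
  "regs Skip = {}"
| "regs (Put b) = {}"
| "regs (Add i j b k) = {i, j, k}"
| "regs (Move d) = {}"
| "regs (Seq a b) = regs a \<union> regs b"
| "regs (If t a b) = test_regs t \<union> regs a \<union> regs b"
| "regs (Until t a) = test_regs t \<union> regs a"

lemma finite_conts [simp]: "finite (conts c K)"
  by (induction c arbitrary: K) auto

lemma finite_regs [simp]: "finite (regs c)"
proof -
  have "finite (test_regs t)" for t by (cases t) auto
  then show ?thesis by (induction c) auto
qed

lemma Cons_in_conts [simp]: "c # K \<in> conts c K"
  by (cases c) auto

text \<open>A loop puts the same command back on the list instead of nesting, so finitely many lists
  are closed under execution.\<close>

lemma succs_conts: "L \<in> conts c K \<Longrightarrow> succs L \<subseteq> insert K (conts c K)"
proof (induction c arbitrary: K L)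
  case (Seq a b)
  then consider "L = Seq a b # K" | "L \<in> conts a (b # K)" | "L \<in> conts b K" by auto
  then show ?case
  proof cases
    case 2
    from Seq.IH(1)[OF this] show ?thesis by auto
  next
    case 3
    from Seq.IH(2)[OF this] show ?thesis by auto
  qed auto
next
  case (If t a b)
  then consider "L = If t a b # K" | "L \<in> conts a K" | "L \<in> conts b K" by auto
  then show ?case
  proof cases
    case 2
    from If.IH(1)[OF this] show ?thesis by auto
  next
    case 3
    from If.IH(2)[OF this] show ?thesis by auto
  qed auto
next
  case (Until t a)
  then consider "L = Until t a # K" | "L \<in> conts a (Until t a # K)" by auto
  then show ?case
  proof cases
    case 2
    from Until.IH[OF this] show ?thesis by auto
  qed auto
qed auto

lemma regs_conts:
  "L \<in> conts c K \<Longrightarrow> regs c \<subseteq> I \<Longrightarrow> \<Union> (regs ` set K) \<subseteq> I \<Longrightarrow> \<Union> (regs ` set L) \<subseteq> I"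
proof (induction c arbitrary: K L)
  case (Seq a b)
  then consider "L = Seq a b # K" | "L \<in> conts a (b # K)" | "L \<in> conts b K" by auto
  then show ?case
  proof cases
    case 2
    from Seq.IH(1)[OF this] Seq.prems show ?thesis by auto
  next
    case 3
    from Seq.IH(2)[OF this] Seq.prems show ?thesis by auto
  qed (use Seq.prems in auto)
next
  case (If t a b)
  then consider "L = If t a b # K" | "L \<in> conts a K" | "L \<in> conts b K" by auto
  then show ?case
  proof cases
    case 2
    from If.IH(1)[OF this] If.prems show ?thesis by auto
  next
    case 3
    from If.IH(2)[OF this] If.prems show ?thesis by auto
  qed (use If.prems in auto)
next
  case (Until t a)
  then consider "L = Until t a # K" | "L \<in> conts a (Until t a # K)" by auto
  then show ?case
  proof cases
    case 2
    from Until.IH[OF this] Until.prems show ?thesis by auto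
  qed (use Until.prems in auto)
qed auto

fun state_ok :: "cmd \<Rightarrow> state \<Rightarrow> bool" where
  "state_ok p Start \<longleftrightarrow> True"
| "state_ok p (Home K) \<longleftrightarrow> K \<in> insert [] (conts p [])"
| "state_ok p (Back K) \<longleftrightarrow> K \<in> insert [] (conts p [])"
| "state_ok p (Scan w i j k K K' c e) \<longleftrightarrow> {i, j, k} \<subseteq> regs p \<and> {K, K'} \<subseteq> insert [] (conts p [])"

definition cells :: "cmd \<Rightarrow> cell set" where
  "cells p = insert Blank (insert Mark (Col ` Pow (regs p)))"

lemma finite_states: "finite {s. state_ok p s}"
proof (rule finite_subset)
  let ?C = "insert [] (conts p [])"
  let ?f = "\<lambda>(w, i, j, k, K, K', c, e). Scan w i j k K K' c e"
  let ?X = "UNIV \<times> regs p \<times> regs p \<times> regs p \<times> ?C \<times> ?C \<times> UNIV \<times> UNIV"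
  show "finite (insert Start (Home ` ?C \<union> Back ` ?C \<union> ?f ` ?X))" by simp
  show "{s. state_ok p s} \<subseteq> insert Start (Home ` ?C \<union> Back ` ?C \<union> ?f ` ?X)"
  proof
    fix s assume "s \<in> {s. state_ok p s}"
    then have ok: "state_ok p s" by simp
    show "s \<in> insert Start (Home ` ?C \<union> Back ` ?C \<union> ?f ` ?X)"
    proof (cases s)
      case (Scan w i j k K K' c e)
      with ok have "s = ?f (w, i, j, k, K, K', c, e)" "(w, i, j, k, K, K', c, e) \<in> ?X" by auto
      then show ?thesis by blast
    qed (use ok in auto)
  qed
qed

lemma finite_cells: "finite (cells p)"
  by (simp add: cells_def)

lemma control_Back:
  "control p (Back K) y a = Some (s', d, a', m, b) \<Longrightarrow> s' = (if a = Mark then Home K else Back K) \<and> a' = a"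
  by (simp split: if_split_asm)

lemma control_closed:
  assumes "state_ok p s" "a \<in> cells p" "control p s y a = Some (s', d, a', m, b)"
  shows "state_ok p s' \<and> a' \<in> cells p"
proof (cases s)
  case Start
  with assms show ?thesis by (auto simp: cells_def)
next
  case (Home L)
  have L: "L = [] \<or> L \<in> conts p []" using assms(1) Home by simp
  show ?thesis
  proof (cases L)
    case Nil
    with assms(3) Home show ?thesis by simp
  next
    case (Cons c K)
    then have mem: "c # K \<in> conts p []" using L by auto
    have s: "succs (c # K) \<subseteq> insert [] (conts p [])" by (rule succs_conts[OF mem])
    have r: "regs c \<subseteq> regs p" using regs_conts[OF mem, of "regs p"] by auto
    have br: ?thesis if "branch t K1 K2 y a = Some (s', d, a', m, b)" "test_regs t \<subseteq> regs p"
      "K1 \<in> insert [] (conts p [])" "K2 \<in> insert [] (conts p [])" for t K1 K2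
      using that assms(2) by (cases t) auto
    show ?thesis
    proof (cases c)
      case (If t c1 c2)
      show ?thesis by (rule br[of t "c1 # K" "c2 # K"]) (use assms(3) Home Cons If s r in auto)
    next
      case (Until t c1)
      show ?thesis by (rule br[of t K "c1 # Until t c1 # K"]) (use assms(3) Home Cons Until s r in auto)
    qed (use assms Home Cons s r in auto)
  qed
next
  case (Scan w i j k K K' c e)
  have ok: "i \<in> regs p" "j \<in> regs p" "k \<in> regs p" "K \<in> insert [] (conts p [])" "K' \<in> insert [] (conts p [])"
    using assms(1) by (simp_all add: Scan)
  show ?thesis
  proof (cases "\<exists>v. a = Col v")
    case True
    then obtain v where a: "a = Col v" by blast
    let ?b = "add_bit (i \<in> v) (j \<in> v) c"
    have "v \<subseteq> regs p" using assms(2) by (auto simp: a cells_def)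
    then have "Col (put_bit w k ?b v) \<in> cells p" using ok(3) by (auto simp: cells_def)
    moreover have "s' = Scan w i j k K K' (carry_bit (i \<in> v) (j \<in> v) c) (e \<and> (?b \<longleftrightarrow> k \<in> v))"
      "a' = Col (put_bit w k ?b v)"
      using assms(3) unfolding Scan a control.simps Let_def by simp_all
    moreover have "state_ok p (Scan w i j k K K' c' e')" for c' e' using ok by simp
    ultimately show ?thesis by blast
  next
    case False
    then consider "a = Blank" | "a = Mark" by (cases a) auto
    then have "s' = Back (if e \<and> \<not> c then K else K') \<and> (a' = Col {k} \<or> a' = a)"
      using assms(3) unfolding Scan by cases (simp_all split: if_split_asm)
    moreover have "Col {k} \<in> cells p" using ok(3) by (simp add: cells_def)
    moreover have "state_ok p (Back (if e \<and> \<not> c then K else K'))" using ok(4,5) by simp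
    ultimately show ?thesis using assms(2) by blast
  qed
next
  case (Back K)
  have K: "K \<in> insert [] (conts p [])" using assms(1) by (simp add: Back)
  have "s' = (if a = Mark then Home K else Back K) \<and> a' = a"
    using assms(3) unfolding Back by (rule control_Back)
  with assms(2) K show ?thesis by auto
qed

theorem exec_logspace:
  assumes exec: "\<And>x. \<exists>s'. exec x (V x) p (\<lambda>_. 0, 0) (f x) s'"
    and V: "\<And>x. 0 < V x" "\<And>x. V x \<le> (length x + 2) ^ E"
  shows "logspace_computable f"
proof -
  \<comment> \<open>L columns satisfy 2 ^ L \<le> 2 V, and the head also visits the blank behind
    them.\<close>
  define H where "H x = nat \<lfloor>log 2 (2 * real (V x))\<rfloor> + 1" for x
  show ?thesis
  proof (rule logspace_computableI[where D = "control p" and S = "{s. state_ok p s}"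
        and A = "cells p" and ?s0.0 = Start and ?a0.0 = Blank and H = H and a = "real E + 2",
        OF finite_states finite_cells])
    show "Start \<in> {s. state_ok p s}" "Blank \<in> cells p" by (auto simp: cells_def)
    show "s' \<in> {s. state_ok p s} \<and> a' \<in> cells p"
      if "s \<in> {s. state_ok p s}" "a \<in> cells p" "control p s y a = Some (s', d, a', m, b)" for s y a s' d a' m b
      using control_closed that by blast
    show "\<exists>c. run p x (H x) (Start, 0, \<lambda>_. Blank, 0, []) c
        \<and> step (control p) x c = None \<and> snd (snd (snd (snd c))) = f x" for x
    proof -
      obtain s' where s': "exec x (V x) p (\<lambda>_. 0, 0) (f x) s'" using exec by blast
      have "L < H x" if "2 ^ L \<le> 2 * V x" for L
      proof -
        have "2 ^ L \<le> 2 * real (V x)" using that by (metis of_nat_le_iff of_nat_mult of_nat_numeral of_nat_power)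
        then have "real L \<le> log 2 (2 * real (V x))" by (metis V(1) le_log_of_power one_less_numeral_iff semiring_norm(76))
        then have "int L \<le> \<lfloor>log 2 (2 * real (V x))\<rfloor>" by (simp add: le_floor_iff)
        then show ?thesis by (simp add: H_def)
      qed
      then obtain vs' where vs': "run p x (H x) (Home [p], 0, tape [], 0, [])
          (Home [], snd s', tape vs', 0, f x)"
        using exec_run[OF s', of "[]" "H x" p "[]" "[]"] V(1)[of x] by (auto simp: fun_eq_iff)
      have "run p x (H x) (Start, 0, \<lambda>_. Blank, 0, []) (Home [p], 0, tape [], 0, [])"
        by (intro bounded_stepI) (auto simp: tape_def fun_eq_iff)
      with vs' have "run p x (H x) (Start, 0, \<lambda>_. Blank, 0, [])
          (Home [], snd s', tape vs', 0, f x)" by simp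
      then show ?thesis by (intro exI[of _ "(Home [], snd s', tape vs', 0, f x)"]) simp
    qed
    show "real (H x) \<le> (real E + 2) * log 2 (real (length x) + 2)" for x
    proof -
      \<comment> \<open>Two additive ones, from the factor 2 and from the blank cell, are absorbed
        because the logarithm is at least 1; hence the coefficient E + 2.\<close>
      have 1: "1 \<le> log 2 (real (length x) + 2)" by simp
      have "real (V x) \<le> (real (length x) + 2) ^ E"
        using V(2)[of x] by (metis of_nat_le_iff of_nat_add of_nat_numeral of_nat_power)
      then have "log 2 (real (V x)) \<le> log 2 ((real (length x) + 2) ^ E)" using V(1)[of x] by simp
      also have "\<dots> = E * log 2 (real (length x) + 2)" by (simp add: log_nat_power)
      finally have "log 2 (2 * real (V x)) \<le> E * log 2 (real (length x) + 2) + 1"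
        using V(1)[of x] by (simp add: log_mult)
      moreover have "real (H x) \<le> log 2 (2 * real (V x)) + 1"
        using V(1)[of x] by (simp add: H_def)
      ultimately show ?thesis using 1 unfolding distrib_right by linarith
    qed
  qed
qed

section \<open>Generators\<close>

text \<open>
  A \<open>gen\<close> at depth \<open>k\<close> sees the registers below \<open>k\<close>, and each binder stores its value in
  register \<open>k\<close>. Register \<open>0\<close> is the constant zero. \<open>GBit\<close> tests the input bit of the
  enclosing \<open>GInput\<close> loop.
\<close>

datatype gen = GNil | GPut bool | GSeq gen gen | GFor nat gen | GLen gen
  | GAdd nat nat bool gen | GMul nat nat gen | GInput gen
  | GEq nat nat bool nat gen gen | GBit gen gen

primrec produce :: "bool list \<Rightarrow> gen \<Rightarrow> nat \<Rightarrow> nat \<Rightarrow> (nat \<Rightarrow> nat) \<Rightarrow> bool list" where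
  "produce x GNil k p \<sigma> = []"
| "produce x (GPut b) k p \<sigma> = [b]"
| "produce x (GSeq g g') k p \<sigma> = produce x g k p \<sigma> @ produce x g' k p \<sigma>"
| "produce x (GFor s g) k p \<sigma> = concat (map (\<lambda>i. produce x g (Suc k) p (\<sigma>(k := i))) [0..<\<sigma> s])"
| "produce x (GLen g) k p \<sigma> = produce x g (Suc k) p (\<sigma>(k := length x))"
| "produce x (GAdd i j b g) k p \<sigma> = produce x g (Suc k) p (\<sigma>(k := \<sigma> i + \<sigma> j + of_bool b))"
| "produce x (GMul i j g) k p \<sigma> = produce x g (Suc k) p (\<sigma>(k := \<sigma> i * \<sigma> j))"
| "produce x (GInput g) k p \<sigma> = concat (map (\<lambda>i. produce x g (Suc k) i (\<sigma>(k := i))) [0..<length x])"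
| "produce x (GEq i j b l g g') k p \<sigma> =
    (if \<sigma> i + \<sigma> j + of_bool b = \<sigma> l then produce x g k p \<sigma> else produce x g' k p \<sigma>)"
| "produce x (GBit g g') k p \<sigma> = (if x ! p then produce x g k p \<sigma> else produce x g' k p \<sigma>)"

text \<open>The flag r marks the inside of an input loop. There the head must rest on the current
  bit, which excludes \<open>GLen\<close> and a nested \<open>GInput\<close>.\<close>

primrec gen_wf :: "gen \<Rightarrow> nat \<Rightarrow> bool \<Rightarrow> bool" where
  "gen_wf GNil k r \<longleftrightarrow> True"
| "gen_wf (GPut b) k r \<longleftrightarrow> True"
| "gen_wf (GSeq g g') k r \<longleftrightarrow> gen_wf g k r \<and> gen_wf g' k r"
| "gen_wf (GFor s g) k r \<longleftrightarrow> s < k \<and> gen_wf g (Suc k) r"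
| "gen_wf (GLen g) k r \<longleftrightarrow> \<not> r \<and> gen_wf g (Suc k) r"
| "gen_wf (GAdd i j b g) k r \<longleftrightarrow> i < k \<and> j < k \<and> gen_wf g (Suc k) r"
| "gen_wf (GMul i j g) k r \<longleftrightarrow> i < k \<and> j < k \<and> gen_wf g (Suc k) r"
| "gen_wf (GInput g) k r \<longleftrightarrow> \<not> r \<and> gen_wf g (Suc k) True"
| "gen_wf (GEq i j b l g g') k r \<longleftrightarrow> i < k \<and> j < k \<and> l < k \<and> gen_wf g k r \<and> gen_wf g' k r"
| "gen_wf (GBit g g') k r \<longleftrightarrow> r \<and> gen_wf g k r \<and> gen_wf g' k r"

text \<open>Only sums and products are compared with V, since loop counters stay below an older
  register or the input length.\<close>

primrec fits :: "nat \<Rightarrow> bool list \<Rightarrow> gen \<Rightarrow> nat \<Rightarrow> (nat \<Rightarrow> nat) \<Rightarrow> bool" where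
  "fits V x GNil k \<sigma> \<longleftrightarrow> True"
| "fits V x (GPut b) k \<sigma> \<longleftrightarrow> True"
| "fits V x (GSeq g g') k \<sigma> \<longleftrightarrow> fits V x g k \<sigma> \<and> fits V x g' k \<sigma>"
| "fits V x (GFor s g) k \<sigma> \<longleftrightarrow> (\<forall>i<\<sigma> s. fits V x g (Suc k) (\<sigma>(k := i)))"
| "fits V x (GLen g) k \<sigma> \<longleftrightarrow> fits V x g (Suc k) (\<sigma>(k := length x))"
| "fits V x (GAdd i j b g) k \<sigma> \<longleftrightarrow> \<sigma> i + \<sigma> j + of_bool b \<le> V \<and>
    fits V x g (Suc k) (\<sigma>(k := \<sigma> i + \<sigma> j + of_bool b))"
| "fits V x (GMul i j g) k \<sigma> \<longleftrightarrow> \<sigma> i * \<sigma> j \<le> V \<and> fits V x g (Suc k) (\<sigma>(k := \<sigma> i * \<sigma> j))"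
| "fits V x (GInput g) k \<sigma> \<longleftrightarrow> (\<forall>i<length x. fits V x g (Suc k) (\<sigma>(k := i)))"
| "fits V x (GEq i j b l g g') k \<sigma> \<longleftrightarrow> fits V x g k \<sigma> \<and> fits V x g' k \<sigma>"
| "fits V x (GBit g g') k \<sigma> \<longleftrightarrow> fits V x g k \<sigma> \<and> fits V x g' k \<sigma>"

definition rewind :: cmd where
  "rewind = Seq (Until (TSym (\<lambda>y. y = LeftEnd)) (Move MoveLeft)) (Move MoveRight)"

text \<open>Register 0 supplies the zero for clearing and incrementing. A product is formed by
  repeated addition with \<open>Suc k\<close> as counter, a register that the body may then
  reuse.\<close>

primrec compile :: "gen \<Rightarrow> nat \<Rightarrow> cmd" where
  "compile GNil k = Skip"
| "compile (GPut b) k = Put b"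
| "compile (GSeq g g') k = Seq (compile g k) (compile g' k)"
| "compile (GFor s g) k = Seq (Add 0 0 False k)
    (Until (TEq k 0 False s) (Seq (compile g (Suc k)) (Add k 0 True k)))"
| "compile (GLen g) k = Seq (Add 0 0 False k) (Seq rewind (Seq
    (Until (TSym (\<lambda>y. y = RightEnd)) (Seq (Add k 0 True k) (Move MoveRight)))
    (compile g (Suc k))))"
| "compile (GAdd i j b g) k = Seq (Add i j b k) (compile g (Suc k))"
| "compile (GMul i j g) k = Seq (Add 0 0 False k) (Seq (Add 0 0 False (Suc k)) (Seq
    (Until (TEq (Suc k) 0 False j) (Seq (Add k i False k) (Add (Suc k) 0 True (Suc k))))
    (compile g (Suc k))))"
| "compile (GInput g) k = Seq (Add 0 0 False k) (Seq rewind
    (Until (TSym (\<lambda>y. y = RightEnd))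
      (Seq (compile g (Suc k)) (Seq (Add k 0 True k) (Move MoveRight)))))"
| "compile (GEq i j b l g g') k = If (TEq i j b l) (compile g k) (compile g' k)"
| "compile (GBit g g') k = If (TSym (\<lambda>y. y = Bit True)) (compile g k) (compile g' k)"

section \<open>Correctness of the compiler\<close>

lemma concat_map_Nil [simp]: "concat (map (\<lambda>_. []) xs) = []"
  by (induction xs) auto

text \<open>The count is an index of the invariant I rather than part of the store, because some
  loops count by a register alone and others by a register together with the input head.\<close>

lemma exec_Until_count:
  assumes body: "\<And>i s. i < N \<Longrightarrow> I i s \<Longrightarrow> \<exists>s'. exec x V c s (u i) s' \<and> I (Suc i) s'"
    and test: "\<And>i s. i \<le> N \<Longrightarrow> I i s \<Longrightarrow> holds x s t \<longleftrightarrow> i = N"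
    and init: "I 0 s"
  shows "\<exists>s'. exec x V (Until t c) s (concat (map u [0..<N])) s' \<and> I N s'"
proof -
  have "i \<le> N \<Longrightarrow> I i s \<Longrightarrow> \<exists>s'. exec x V (Until t c) s (concat (map u [i..<N])) s' \<and> I N s'" for i s
  proof (induction "N - i" arbitrary: i s)
    case 0
    then have "i = N" by simp
    then show ?case using test[of N s] 0 by (intro exI[of _ s]) (auto intro: exec.UntilT)
  next
    case (Suc m)
    then have i: "i < N" by simp
    then obtain s' where s': "exec x V c s (u i) s'" "I (Suc i) s'" using body Suc by blast
    then obtain s'' where s'': "exec x V (Until t c) s' (concat (map u [Suc i..<N])) s''" "I N s''"
      using Suc.hyps(1)[of "Suc i" s'] Suc.hyps(2) i by fastforce
    have "\<not> holds x s t" using test[of i s] i Suc.prems by simp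
    from exec.UntilF[OF this s'(1) s''(1)] s''(2) i show ?case
      by (intro exI[of _ s'']) (simp add: upt_conv_Cons)
  qed
  from this[of 0 s] init show ?thesis by simp
qed

lemma exec_rewind: "exec x V rewind (\<sigma>, h) [] (\<sigma>, 1)"
proof -
  have "exec x V (Until (TSym (\<lambda>y. y = LeftEnd)) (Move MoveLeft)) (\<sigma>, h) [] (\<sigma>, 0)"
  proof (induction h rule: less_induct)
    case (less h)
    show ?case
    proof (cases "h = 0")
      case True
      then show ?thesis by (auto intro!: exec.UntilT simp: input_symbol_def)
    next
      case False
      let ?h = "min (move_nat MoveLeft h) (length x + 1)"
      have "exec x V (Move MoveLeft) (\<sigma>, h) [] (\<sigma>, ?h)" by (rule exec.Move)
      moreover have "?h < h" using False by simp
      note less[OF this]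
      moreover have "\<not> holds x (\<sigma>, h) (TSym (\<lambda>y. y = LeftEnd))"
        using False by (simp add: input_symbol_def)
      ultimately show ?thesis using exec.UntilF[of x "(\<sigma>, h)" _ V _ "[]" _ "[]"] by auto
    qed
  qed
  from exec.Seq[OF this exec.Move[of x V MoveRight \<sigma> 0]] show ?thesis by (simp add: rewind_def)
qed

lemma exec_If_cases:
  assumes c: "holds x s t \<longleftrightarrow> c"
    and a: "\<exists>\<tau> h. exec x V a s u (\<tau>, h) \<and> Q \<tau> h" and b: "\<exists>\<tau> h. exec x V b s v (\<tau>, h) \<and> Q \<tau> h"
  shows "\<exists>\<tau> h. exec x V (If t a b) s (if c then u else v) (\<tau>, h) \<and> Q \<tau> h"
proof -
  have "\<exists>\<tau> h. exec x V (if holds x s t then a else b) s (if c then u else v) (\<tau>, h) \<and> Q \<tau> h"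
    using a b unfolding c by (cases c) simp_all
  then show ?thesis by (blast intro: exec.If)
qed

lemma exec_clear: "\<sigma> 0 = 0 \<Longrightarrow> exec x V (Add 0 0 False k) (\<sigma>, h) [] (\<sigma>(k := 0), h)"
  using exec.Add[of \<sigma> 0 0 False V x k h] by simp

text \<open>Registers from k on are scratch space.\<close>

definition agree :: "nat \<Rightarrow> (nat \<Rightarrow> nat) \<Rightarrow> (nat \<Rightarrow> nat) \<Rightarrow> bool" where
  "agree k \<sigma> \<tau> \<longleftrightarrow> (\<forall>r<k. \<tau> r = \<sigma> r)"

lemma agree_Suc: "agree (Suc k) (\<sigma>(k := v)) \<tau> \<longleftrightarrow> agree k \<sigma> \<tau> \<and> \<tau> k = v"
  by (auto simp: agree_def less_Suc_eq)

lemma agree_upd: "agree k \<sigma> (\<tau>(j := v)) \<longleftrightarrow> agree k \<sigma> \<tau>" if "k \<le> j"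
  using that by (auto simp: agree_def)

definition admissible :: "nat \<Rightarrow> bool list \<Rightarrow> nat \<Rightarrow> (nat \<Rightarrow> nat) \<Rightarrow> bool" where
  "admissible V x k \<sigma> \<longleftrightarrow> 0 < k \<and> \<sigma> 0 = 0 \<and> (\<forall>r<k. \<sigma> r \<le> V) \<and> length x \<le> V"

lemma admissible_upd: "admissible V x k \<sigma> \<Longrightarrow> v \<le> V \<Longrightarrow> admissible V x (Suc k) (\<sigma>(k := v))"
  by (simp add: admissible_def less_Suc_eq)

text \<open>The environment \<sigma> of the generator and the store \<tau> of the program agree only
  below the depth, as consecutive generators overwrite the registers above it. Inside an input loop
  the head must also return to its bit.\<close>

lemma exec_compile:
  assumes "gen_wf g k r" "fits V x g k \<sigma>" "admissible V x k \<sigma>"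
    and "r \<Longrightarrow> h = Suc p \<and> p < length x" "agree k \<sigma> \<tau>"
  shows "\<exists>\<tau>' h'. exec x V (compile g k) (\<tau>, h) (produce x g k p \<sigma>) (\<tau>', h') \<and> agree k \<sigma> \<tau>' \<and> (r \<longrightarrow> h' = h)"
  using assms
proof (induction g arbitrary: k r \<sigma> h p \<tau>)
  case GNil
  then show ?case by (auto intro!: exec.Skip)
next
  case (GPut b)
  then show ?case by (auto intro!: exec.Put)
next
  case (GSeq g g')
  obtain \<tau>1 h1 where 1: "exec x V (compile g k) (\<tau>, h) (produce x g k p \<sigma>) (\<tau>1, h1)"
    "agree k \<sigma> \<tau>1" "r \<longrightarrow> h1 = h"
    using GSeq.IH(1)[of k r \<sigma> h p \<tau>, OF _ _ GSeq.prems(3-5)] GSeq.prems(1,2) by auto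
  have "r \<Longrightarrow> h1 = Suc p \<and> p < length x" using 1 GSeq.prems(4) by simp
  then obtain \<tau>2 h2 where 2: "exec x V (compile g' k) (\<tau>1, h1) (produce x g' k p \<sigma>) (\<tau>2, h2)"
    "agree k \<sigma> \<tau>2" "r \<longrightarrow> h2 = h1"
    using GSeq.IH(2)[of k r \<sigma> h1 p \<tau>1, OF _ _ GSeq.prems(3) _ 1(2)] GSeq.prems(1,2) by auto
  show ?case using exec.Seq[OF 1(1) 2(1)] 1 2 by auto
next
  case (GFor s g)
  have adm: "0 < k" "\<sigma> 0 = 0" "\<And>r. r < k \<Longrightarrow> \<sigma> r \<le> V" "length x \<le> V"
    using GFor.prems(3) by (simp_all add: admissible_def)
  let ?I = "\<lambda>i st. agree (Suc k) (\<sigma>(k := i)) (fst st) \<and> (r \<longrightarrow> snd st = h)"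
  let ?u = "\<lambda>i. produce x g (Suc k) p (\<sigma>(k := i))"
  have s: "s < k" "\<sigma> s \<le> V" using GFor.prems(1) adm(3) by simp_all
  have z: "\<tau>' 0 = 0" "\<tau>' s = \<sigma> s" if "agree k \<sigma> \<tau>'" for \<tau>'
    using that adm s by (simp_all add: agree_def)
  have "\<exists>st'. exec x V (Until (TEq k 0 False s) (Seq (compile g (Suc k)) (Add k 0 True k))) (\<tau>(k := 0), h)
      (concat (map ?u [0..<\<sigma> s])) st' \<and> ?I (\<sigma> s) st'"
  proof (rule exec_Until_count[where I = ?I])
    fix i st assume i: "i < \<sigma> s" and I: "?I i st"
    obtain \<tau>1 h1 where st: "st = (\<tau>1, h1)" by (cases st)
    obtain \<tau>2 h2 where 2: "exec x V (compile g (Suc k)) (\<tau>1, h1) (?u i) (\<tau>2, h2)"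
      "agree (Suc k) (\<sigma>(k := i)) \<tau>2" "r \<longrightarrow> h2 = h1"
    proof -
      have adm': "admissible V x (Suc k) (\<sigma>(k := i))"
        using i s by (intro admissible_upd[OF GFor.prems(3)]) simp
      show ?thesis
        using GFor.IH[OF _ _ adm', of r h1 p \<tau>1] GFor.prems(1,2,4) I st i that by fastforce
    qed
    have \<tau>2: "\<tau>2 k = i" "\<tau>2 0 = 0" using 2(2) z by (auto simp: agree_Suc)
    then have "exec x V (Add k 0 True k) (\<tau>2, h2) [] (\<tau>2(k := \<tau>2 k + \<tau>2 0 + of_bool True), h2)"
      using i s by (intro exec.Add) auto
    from exec.Seq[OF 2(1) this] 2 \<tau>2 I st
    show "\<exists>st'. exec x V (Seq (compile g (Suc k)) (Add k 0 True k)) st (?u i) st' \<and> ?I (Suc i) st'"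
      by (intro exI[of _ "(\<tau>2(k := Suc i), h2)"]) (simp add: agree_Suc agree_upd)
  next
    fix i st assume "i \<le> \<sigma> s" and I: "?I i st"
    have ag: "agree k \<sigma> (fst st)" "fst st k = i" using I by (simp_all add: agree_Suc)
    show "holds x st (TEq k 0 False s) \<longleftrightarrow> i = \<sigma> s"
      using z[OF ag(1)] ag(2) by (cases st) simp
  qed (use GFor.prems(5) in \<open>simp add: agree_Suc agree_upd\<close>)
  then obtain \<tau>' h' where loop: "exec x V (Until (TEq k 0 False s) (Seq (compile g (Suc k)) (Add k 0 True k)))
      (\<tau>(k := 0), h) (concat (map ?u [0..<\<sigma> s])) (\<tau>', h')" "?I (\<sigma> s) (\<tau>', h')"
    by force
  from exec.Seq[OF exec_clear[of \<tau>, OF z(1)[OF GFor.prems(5)]] loop(1)] loop(2) show ?case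
    by (intro exI[of _ \<tau>'] exI[of _ h']) (simp add: agree_Suc)
next
  case (GLen g)
  have adm: "0 < k" "\<sigma> 0 = 0" "\<And>r. r < k \<Longrightarrow> \<sigma> r \<le> V" "length x \<le> V"
    using GLen.prems(3) by (simp_all add: admissible_def)
  let ?I = "\<lambda>i st. agree (Suc k) (\<sigma>(k := i)) (fst st) \<and> snd st = Suc i"
  have z: "\<tau>' 0 = 0" if "agree k \<sigma> \<tau>'" for \<tau>'
    using that adm by (simp add: agree_def)
  have "\<exists>st'. exec x V (Until (TSym (\<lambda>y. y = RightEnd)) (Seq (Add k 0 True k) (Move MoveRight)))
      (\<tau>(k := 0), 1) (concat (map (\<lambda>_. []) [0..<length x])) st' \<and> ?I (length x) st'"
  proof (rule exec_Until_count[where I = ?I])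
    fix i st assume i: "i < length x" and I: "?I i st"
    then obtain \<tau>1 where st: "st = (\<tau>1, Suc i)" by (cases st) auto
    have \<tau>1: "\<tau>1 k = i" "\<tau>1 0 = 0" using I st z by (auto simp: agree_Suc)
    then have "exec x V (Add k 0 True k) st [] (\<tau>1(k := \<tau>1 k + \<tau>1 0 + of_bool True), Suc i)"
      unfolding st using i adm(4) by (intro exec.Add) auto
    from exec.Seq[OF this exec.Move[of x V MoveRight]] \<tau>1 I st i
    show "\<exists>st'. exec x V (Seq (Add k 0 True k) (Move MoveRight)) st [] st' \<and> ?I (Suc i) st'"
      by (intro exI[of _ "(\<tau>1(k := Suc i), Suc (Suc i))"]) (simp add: agree_Suc agree_upd)
  next
    fix i st assume "i \<le> length x" and "?I i st"
    then show "holds x st (TSym (\<lambda>y. y = RightEnd)) \<longleftrightarrow> i = length x"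
      by (cases st) (auto simp: input_symbol_def)
  qed (use GLen.prems(5) in \<open>simp add: agree_Suc agree_upd\<close>)
  then obtain \<tau>1 h1 where loop: "exec x V (Until (TSym (\<lambda>y. y = RightEnd)) (Seq (Add k 0 True k) (Move MoveRight)))
      (\<tau>(k := 0), 1) [] (\<tau>1, h1)" "?I (length x) (\<tau>1, h1)"
    by force
  obtain \<tau>2 h2 where 2: "exec x V (compile g (Suc k)) (\<tau>1, h1) (produce x g (Suc k) p (\<sigma>(k := length x))) (\<tau>2, h2)"
    "agree (Suc k) (\<sigma>(k := length x)) \<tau>2"
    using GLen.IH[OF _ _ admissible_upd[OF GLen.prems(3) adm(4)], of r h1 p \<tau>1] GLen.prems(1,2) loop
    by fastforce
  from exec.Seq[OF exec_clear[of \<tau>, OF z[OF GLen.prems(5)]] exec.Seq[OF exec_rewind exec.Seq[OF loop(1) 2(1)]]] 2(2) GLen.prems(1)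
  show ?case by (intro exI[of _ \<tau>2] exI[of _ h2]) (simp add: agree_Suc)
next
  case (GAdd i j b g)
  have adm: "0 < k" "\<sigma> 0 = 0" "\<And>r. r < k \<Longrightarrow> \<sigma> r \<le> V" "length x \<le> V"
    using GAdd.prems(3) by (simp_all add: admissible_def)
  let ?v = "\<sigma> i + \<sigma> j + of_bool b"
  have ij: "\<tau> i = \<sigma> i" "\<tau> j = \<sigma> j" using GAdd.prems by (auto simp: agree_def)
  have "exec x V (Add i j b k) (\<tau>, h) [] (\<tau>(k := \<tau> i + \<tau> j + of_bool b), h)"
    using GAdd.prems ij by (intro exec.Add) auto
  moreover obtain \<tau>2 h2 where 2: "exec x V (compile g (Suc k)) (\<tau>(k := ?v), h) (produce x g (Suc k) p (\<sigma>(k := ?v))) (\<tau>2, h2)"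
    "agree (Suc k) (\<sigma>(k := ?v)) \<tau>2" "r \<longrightarrow> h2 = h"
  proof -
    have "admissible V x (Suc k) (\<sigma>(k := ?v))" "agree (Suc k) (\<sigma>(k := ?v)) (\<tau>(k := ?v))"
      using GAdd.prems(2,5) by (auto intro: admissible_upd[OF GAdd.prems(3)] simp: agree_Suc agree_upd)
    from GAdd.IH[OF _ _ this(1) GAdd.prems(4) this(2), of r] GAdd.prems(1,2) that show ?thesis
      by fastforce
  qed
  ultimately have "exec x V (compile (GAdd i j b g) k) (\<tau>, h) ([] @ produce x g (Suc k) p (\<sigma>(k := ?v))) (\<tau>2, h2)"
    unfolding compile.simps ij by (intro exec.Seq)
  with 2 show ?case by (intro exI[of _ \<tau>2] exI[of _ h2]) (simp add: agree_Suc)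
next
  case (GMul i j g)
  have adm: "0 < k" "\<sigma> 0 = 0" "\<And>r. r < k \<Longrightarrow> \<sigma> r \<le> V" "length x \<le> V"
    using GMul.prems(3) by (simp_all add: admissible_def)
  let ?v = "\<sigma> i * \<sigma> j"
  let ?I = "\<lambda>n st. agree (Suc k) (\<sigma>(k := \<sigma> i * n)) (fst st) \<and> fst st (Suc k) = n \<and> snd st = h"
  let ?c = "Seq (Add k i False k) (Add (Suc k) 0 True (Suc k))"
  have ij: "\<tau>' 0 = 0" "\<tau>' i = \<sigma> i" "\<tau>' j = \<sigma> j" if "agree k \<sigma> \<tau>'" for \<tau>'
    using that adm GMul.prems(1) by (auto simp: agree_def)
  have "\<exists>st'. exec x V (Until (TEq (Suc k) 0 False j) ?c) (\<tau>(k := 0, Suc k := 0), h)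
      (concat (map (\<lambda>_. []) [0..<\<sigma> j])) st' \<and> ?I (\<sigma> j) st'"
  proof (rule exec_Until_count[where I = ?I])
    fix n st assume n: "n < \<sigma> j" and I: "?I n st"
    obtain \<tau>1 where st: "st = (\<tau>1, h)" using I by (cases st) auto
    have \<tau>1: "\<tau>1 k = \<sigma> i * n" "\<tau>1 (Suc k) = n" "\<tau>1 i = \<sigma> i" "\<tau>1 0 = 0" "agree k \<sigma> \<tau>1"
      using I st ij by (auto simp: agree_Suc)
    let ?\<tau>2 = "\<tau>1(k := \<tau>1 k + \<tau>1 i + of_bool False)"
    \<comment> \<open>Partial products are bounded by the full product, the only one that
      \<open>fits\<close> restricts.\<close>
    have "\<sigma> i * Suc n \<le> \<sigma> i * \<sigma> j" using n by (intro mult_le_mono2) auto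
    then have v: "\<sigma> i * n + \<sigma> i \<le> V" using GMul.prems(2) by simp
    have e1: "exec x V (Add k i False k) st [] (?\<tau>2, h)"
      unfolding st using v \<tau>1 by (intro exec.Add) (auto simp: algebra_simps)
    have "j < k" using GMul.prems(1) by simp
    then have "\<sigma> j \<le> V" using adm(3) by blast
    then have e2: "exec x V (Add (Suc k) 0 True (Suc k)) (?\<tau>2, h) []
        (?\<tau>2(Suc k := ?\<tau>2 (Suc k) + ?\<tau>2 0 + of_bool True), h)"
      using \<tau>1 n adm(1) by (intro exec.Add) auto
    have k: "k \<noteq> 0" using adm(1) by simp
    have "?I (Suc n) (?\<tau>2(Suc k := ?\<tau>2 (Suc k) + ?\<tau>2 0 + of_bool True), h)"
      using \<tau>1 k by (simp add: agree_Suc agree_upd)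
    with exec.Seq[OF e1 e2] show "\<exists>st'. exec x V ?c st [] st' \<and> ?I (Suc n) st'"
      by (metis append_Nil)
  next
    fix n st assume "n \<le> \<sigma> j" and I: "?I n st"
    have ag: "agree k \<sigma> (fst st)" "fst st (Suc k) = n" using I by (simp_all add: agree_Suc)
    show "holds x st (TEq (Suc k) 0 False j) \<longleftrightarrow> n = \<sigma> j"
      using ij[OF ag(1)] ag(2) by (cases st) simp
  qed (use GMul.prems(5) in \<open>simp add: agree_Suc agree_upd\<close>)
  then obtain \<tau>1 where loop: "exec x V (Until (TEq (Suc k) 0 False j) ?c) (\<tau>(k := 0, Suc k := 0), h) [] (\<tau>1, h)"
      "agree (Suc k) (\<sigma>(k := ?v)) \<tau>1"
    by force
  have \<tau>0: "\<tau> 0 = 0" "(\<tau>(k := 0)) 0 = 0" using ij[OF GMul.prems(5)] by simp_all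
  obtain \<tau>2 h2 where 2: "exec x V (compile g (Suc k)) (\<tau>1, h) (produce x g (Suc k) p (\<sigma>(k := ?v))) (\<tau>2, h2)"
    "agree (Suc k) (\<sigma>(k := ?v)) \<tau>2" "r \<longrightarrow> h2 = h"
  proof -
    have "admissible V x (Suc k) (\<sigma>(k := ?v))"
      using GMul.prems(2) by (intro admissible_upd[OF GMul.prems(3)]) simp
    from GMul.IH[OF _ _ this GMul.prems(4) loop(2), of r] GMul.prems(1,2) that show ?thesis
      by fastforce
  qed
  from exec.Seq[OF exec_clear[of \<tau>, OF \<tau>0(1)] exec.Seq[OF exec_clear[of "\<tau>(k := 0)", OF \<tau>0(2)] exec.Seq[OF loop(1) 2(1)]]] 2
  show ?case by (intro exI[of _ \<tau>2] exI[of _ h2]) (simp add: agree_Suc)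
next
  case (GInput g)
  have adm: "0 < k" "\<sigma> 0 = 0" "\<And>r. r < k \<Longrightarrow> \<sigma> r \<le> V" "length x \<le> V"
    using GInput.prems(3) by (simp_all add: admissible_def)
  let ?I = "\<lambda>i st. agree (Suc k) (\<sigma>(k := i)) (fst st) \<and> snd st = Suc i"
  let ?u = "\<lambda>i. produce x g (Suc k) i (\<sigma>(k := i))"
  let ?c = "Seq (compile g (Suc k)) (Seq (Add k 0 True k) (Move MoveRight))"
  have z: "\<tau>' 0 = 0" if "agree k \<sigma> \<tau>'" for \<tau>'
    using that adm by (simp add: agree_def)
  have "\<exists>st'. exec x V (Until (TSym (\<lambda>y. y = RightEnd)) ?c)
      (\<tau>(k := 0), 1) (concat (map ?u [0..<length x])) st' \<and> ?I (length x) st'"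
  proof (rule exec_Until_count[where I = ?I])
    fix i st assume i: "i < length x" and I: "?I i st"
    then obtain \<tau>1 where st: "st = (\<tau>1, Suc i)" by (cases st) auto
    obtain \<tau>2 where 2: "exec x V (compile g (Suc k)) (\<tau>1, Suc i) (?u i) (\<tau>2, Suc i)"
      "agree (Suc k) (\<sigma>(k := i)) \<tau>2"
    proof -
      have adm': "admissible V x (Suc k) (\<sigma>(k := i))"
        using i adm(4) by (intro admissible_upd[OF GInput.prems(3)]) simp
      show ?thesis
        using GInput.IH[OF _ _ adm', of True "Suc i" i \<tau>1] GInput.prems(1,2) I st i that by fastforce
    qed
    have \<tau>2: "\<tau>2 k = i" "\<tau>2 0 = 0" using 2(2) z by (auto simp: agree_Suc)
    then have "exec x V (Add k 0 True k) (\<tau>2, Suc i) [] (\<tau>2(k := \<tau>2 k + \<tau>2 0 + of_bool True), Suc i)"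
      using i adm(4) by (intro exec.Add) auto
    from exec.Seq[OF 2(1) exec.Seq[OF this exec.Move[of x V MoveRight]]] 2 \<tau>2 st i
    show "\<exists>st'. exec x V ?c st (?u i) st' \<and> ?I (Suc i) st'"
      by (intro exI[of _ "(\<tau>2(k := Suc i), Suc (Suc i))"]) (simp add: agree_Suc agree_upd)
  next
    fix i st assume "i \<le> length x" and "?I i st"
    then show "holds x st (TSym (\<lambda>y. y = RightEnd)) \<longleftrightarrow> i = length x"
      by (cases st) (auto simp: input_symbol_def)
  qed (use GInput.prems(5) in \<open>simp add: agree_Suc agree_upd\<close>)
  then obtain \<tau>1 h1 where loop: "exec x V (Until (TSym (\<lambda>y. y = RightEnd)) ?c)
      (\<tau>(k := 0), 1) (concat (map ?u [0..<length x])) (\<tau>1, h1)" "?I (length x) (\<tau>1, h1)"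
    by force
  from exec.Seq[OF exec_clear[of \<tau>, OF z[OF GInput.prems(5)]] exec.Seq[OF exec_rewind loop(1)]] loop(2) GInput.prems(1)
  show ?case by (intro exI[of _ \<tau>1] exI[of _ h1]) (simp add: agree_Suc)
next
  case (GEq i j b l g g')
  have adm: "0 < k" "\<sigma> 0 = 0" "\<And>r. r < k \<Longrightarrow> \<sigma> r \<le> V" "length x \<le> V"
    using GEq.prems(3) by (simp_all add: admissible_def)
  have "holds x (\<tau>, h) (TEq i j b l) \<longleftrightarrow> \<sigma> i + \<sigma> j + of_bool b = \<sigma> l"
    using GEq.prems(1,5) by (auto simp: agree_def)
  moreover have "\<exists>\<tau>' h'. exec x V (compile g k) (\<tau>, h) (produce x g k p \<sigma>) (\<tau>', h') \<and> agree k \<sigma> \<tau>' \<and> (r \<longrightarrow> h' = h)"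
    using GEq.IH(1)[of k r \<sigma> h p \<tau>, OF _ _ GEq.prems(3-5)] GEq.prems(1,2) by simp
  moreover have "\<exists>\<tau>' h'. exec x V (compile g' k) (\<tau>, h) (produce x g' k p \<sigma>) (\<tau>', h') \<and> agree k \<sigma> \<tau>' \<and> (r \<longrightarrow> h' = h)"
    using GEq.IH(2)[of k r \<sigma> h p \<tau>, OF _ _ GEq.prems(3-5)] GEq.prems(1,2) by simp
  ultimately show ?case unfolding compile.simps produce.simps by (rule exec_If_cases)
next
  case (GBit g g')
  have "holds x (\<tau>, h) (TSym (\<lambda>y. y = Bit True)) \<longleftrightarrow> x ! p"
    using GBit.prems(1,4) by (auto simp: input_symbol_def)
  moreover have "\<exists>\<tau>' h'. exec x V (compile g k) (\<tau>, h) (produce x g k p \<sigma>) (\<tau>', h') \<and> agree k \<sigma> \<tau>' \<and> (r \<longrightarrow> h' = h)"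
    using GBit.IH(1)[of k r \<sigma> h p \<tau>, OF _ _ GBit.prems(3-5)] GBit.prems(1,2) by auto
  moreover have "\<exists>\<tau>' h'. exec x V (compile g' k) (\<tau>, h) (produce x g' k p \<sigma>) (\<tau>', h') \<and> agree k \<sigma> \<tau>' \<and> (r \<longrightarrow> h' = h)"
    using GBit.IH(2)[of k r \<sigma> h p \<tau>, OF _ _ GBit.prems(3-5)] GBit.prems(1,2) by auto
  ultimately show ?case unfolding compile.simps produce.simps by (rule exec_If_cases)
qed

theorem produce_logspace:
  assumes wf: "gen_wf g 1 False" and fits: "\<And>x. fits (V x) x g 1 (\<lambda>_. 0)"
    and V: "\<And>x. length x < V x" "\<And>x. V x \<le> (length x + 2) ^ E"
  shows "logspace_computable (\<lambda>x. produce x g 1 0 (\<lambda>_. 0))"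
proof (rule exec_logspace)
  show "\<exists>s'. exec x (V x) (compile g 1) (\<lambda>_. 0, 0) (produce x g 1 0 (\<lambda>_. 0)) s'" for x
    using exec_compile[OF wf fits[of x], of 0 0 "\<lambda>_. 0"] V(1)[of x]
    by (auto simp: agree_def admissible_def)
  show "0 < V x" for x using V(1)[of x] by simp
  show "V x \<le> (length x + 2) ^ E" for x by (rule V(2))
qed

section \<open>Computations as tilings\<close>

text \<open>
  A vertical colour is a tape symbol (\<open>None\<close> marks the border of the window) together with the
  state of the machine if the head is at this cell. A horizontal colour carries the state
  when the head moves; its Boolean is \<open>True\<close> for a move to the right.
\<close>

type_synonym vcol = "nat option \<times> nat option"

type_synonym hcol = "(bool \<times> nat) option"

datatype tile = Tile (lower: vcol) (upper: vcol) (lft: hcol) (rgt: hcol)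

definition ntm_states :: "ntm \<Rightarrow> nat set" where
  "ntm_states M = {ntm_start M, ntm_accept M} \<union> (\<Union>(q, s, q', s', d) \<in> ntm_trans M. {q, q'})"

definition ntm_symbols :: "ntm \<Rightarrow> nat set" where
  "ntm_symbols M = {0, 1, 2} \<union> (\<Union>(q, s, q', s', d) \<in> ntm_trans M. {s, s'})"

text \<open>A tile is one cell during one time step. \<open>idle\<close> repeats a configuration, so
  that short computations can be padded. A moving head leaves through a side of its tile and is
  received by \<open>from_left\<close> or \<open>from_right\<close>; border cells have no symbol and
  cannot receive it.\<close>

inductive_set tiles :: "ntm \<Rightarrow> tile set" for M where
  plain: "s \<in> insert None (Some ` ntm_symbols M) \<Longrightarrow> Tile (s, None) (s, None) None None \<in> tiles M"
| idle: "s \<in> ntm_symbols M \<Longrightarrow> q \<in> ntm_states M \<Longrightarrow>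
    Tile (Some s, Some q) (Some s, Some q) None None \<in> tiles M"
| stay: "(q, s, q', s', Stay) \<in> ntm_trans M \<Longrightarrow>
    Tile (Some s, Some q) (Some s', Some q') None None \<in> tiles M"
| right: "(q, s, q', s', MoveRight) \<in> ntm_trans M \<Longrightarrow>
    Tile (Some s, Some q) (Some s', None) None (Some (True, q')) \<in> tiles M"
| left: "(q, s, q', s', MoveLeft) \<in> ntm_trans M \<Longrightarrow>
    Tile (Some s, Some q) (Some s', None) (Some (False, q')) None \<in> tiles M"
| from_left: "s \<in> ntm_symbols M \<Longrightarrow> q \<in> ntm_states M \<Longrightarrow>
    Tile (Some s, None) (Some s, Some q) (Some (True, q)) None \<in> tiles M"
| from_right: "s \<in> ntm_symbols M \<Longrightarrow> q \<in> ntm_states M \<Longrightarrow>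
    Tile (Some s, None) (Some s, Some q) None (Some (False, q)) \<in> tiles M"

definition vcols :: "ntm \<Rightarrow> vcol set" where
  "vcols M = insert None (Some ` ntm_symbols M) \<times> insert None (Some ` ntm_states M)"

definition hcols :: "ntm \<Rightarrow> hcol set" where
  "hcols M = insert None (Some ` (UNIV \<times> ntm_states M))"

lemma trans_mem:
  assumes "(q, s, q', s', d) \<in> ntm_trans M"
  shows "q \<in> ntm_states M" "q' \<in> ntm_states M" "s \<in> ntm_symbols M" "s' \<in> ntm_symbols M"
  using assms by (force simp: ntm_states_def ntm_symbols_def)+

lemma tile_colours:
  assumes "\<tau> \<in> tiles M"
  shows "lower \<tau> \<in> vcols M" "upper \<tau> \<in> vcols M" "lft \<tau> \<in> hcols M" "rgt \<tau> \<in> hcols M"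
  using assms trans_mem by (induction) (auto simp: vcols_def hcols_def)

lemma finite_colours:
  assumes "finite (ntm_trans M)"
  shows "finite (vcols M)" "finite (hcols M)"
proof -
  have "finite (ntm_states M)" "finite (ntm_symbols M)"
    using assms by (auto simp: ntm_states_def ntm_symbols_def)
  then show "finite (vcols M)" "finite (hcols M)" by (simp_all add: vcols_def hcols_def)
qed

lemma finite_tiles:
  assumes "finite (ntm_trans M)"
  shows "finite (tiles M)"
proof (rule finite_subset)
  let ?X = "vcols M \<times> vcols M \<times> hcols M \<times> hcols M"
  show "finite ((\<lambda>(a, b, c, d). Tile a b c d) ` ?X)"
    using finite_colours[OF assms] by simp
  show "tiles M \<subseteq> (\<lambda>(a, b, c, d). Tile a b c d) ` ?X"
  proof
    fix \<tau> assume "\<tau> \<in> tiles M"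
    then have "(lower \<tau>, upper \<tau>, lft \<tau>, rgt \<tau>) \<in> ?X" using tile_colours by blast
    moreover have "\<tau> = (\<lambda>(a, b, c, d). Tile a b c d) (lower \<tau>, upper \<tau>, lft \<tau>, rgt \<tau>)" by simp
    ultimately show "\<tau> \<in> (\<lambda>(a, b, c, d). Tile a b c d) ` ?X" by (rule rev_image_eqI)
  qed
qed

text \<open>Column \<open>j\<close> of the window, whose columns are \<open>0, \<dots>, E\<close>, shows the tape cell \<open>j - A\<close>.\<close>

fun row :: "nat \<Rightarrow> nat \<Rightarrow> ntm_config \<Rightarrow> nat \<Rightarrow> vcol" where
  "row A E (q, t, h) j =
    (if j = 0 \<or> j = E then None else Some (t (int j - int A)), if int j - int A = h then Some q else None)"

fun inside :: "nat \<Rightarrow> nat \<Rightarrow> ntm_config \<Rightarrow> bool" where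
  "inside A E (q, t, h) \<longleftrightarrow> 0 < int A + h \<and> int A + h < int E"

text \<open>Signals do not arise from nothing: the tile that emits one has the head below.\<close>

lemma signal_tile:
  assumes "\<tau> \<in> tiles M"
  shows "rgt \<tau> = Some (True, q) \<Longrightarrow> snd (lower \<tau>) \<noteq> None"
    "lft \<tau> = Some (False, q) \<Longrightarrow> snd (lower \<tau>) \<noteq> None"
  using assms by (induction) auto

lemma headless_tile:
  assumes "\<tau> \<in> tiles M" "snd (lower \<tau>) = None"
  obtains "upper \<tau> = lower \<tau>" "lft \<tau> = None" "rgt \<tau> = None"
  | q where "fst (lower \<tau>) \<noteq> None" "upper \<tau> = (fst (lower \<tau>), Some q)" "lft \<tau> = Some (True, q)" "rgt \<tau> = None"
  | q where "fst (lower \<tau>) \<noteq> None" "upper \<tau> = (fst (lower \<tau>), Some q)" "lft \<tau> = None" "rgt \<tau> = Some (False, q)"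
  using assms by (cases) auto

text \<open>The tile in the only column with a head determines the transition, and matching edges
  force the neighbouring tile to receive a moving head.\<close>

lemma tiling_step:
  assumes tile: "\<And>j. j \<le> E \<Longrightarrow> g j \<in> tiles M"
    and adj: "\<And>j. j < E \<Longrightarrow> rgt (g j) = lft (g (Suc j))"
    and bots: "\<And>j. j \<le> E \<Longrightarrow> lower (g j) = row A E c j"
    and ins: "inside A E c"
  shows "\<exists>c'. (c' = c \<or> ntm_step M c c') \<and> inside A E c' \<and> (\<forall>j \<le> E. upper (g j) = row A E c' j)"
proof -
  obtain q t h where c: "c = (q, t, h)" by (cases c)
  define J where "J = nat (int A + h)"
  have J: "0 < J" "J < E" "h = int J - int A" using ins by (auto simp: c J_def)
  have botJ: "lower (g J) = (Some (t h), Some q)" using bots[of J] J by (simp add: c)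
  have lower: "lower (g j) = (if j = 0 \<or> j = E then None else Some (t (int j - int A)), None)"
    if "j \<le> E" "j \<noteq> J" for j
    using bots[OF that(1)] that(2) by (auto simp: c J(3))
  \<comment> \<open>Away from J, a tile either copies its cell or receives a signal, and the emitter
    of a signal can only be column J.\<close>
  have others: "upper (g j) = lower (g j) \<and> lft (g j) = None \<and> rgt (g j) = None
      \<or> (\<exists>q'. j = Suc J \<and> j < E \<and> rgt (g J) = Some (True, q') \<and> upper (g j) = (fst (lower (g j)), Some q'))
      \<or> (\<exists>q'. Suc j = J \<and> 0 < j \<and> lft (g J) = Some (False, q') \<and> upper (g j) = (fst (lower (g j)), Some q'))"
    if j: "j \<le> E" "j \<noteq> J" for j
  proof -
    have "snd (lower (g j)) = None" using lower[OF j] by simp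
    with tile[OF j(1)] show ?thesis
    proof (cases rule: headless_tile)
      case (2 q')
      have "j \<noteq> 0" "j \<noteq> E" using 2(1) lower[OF j] by (auto split: if_split_asm)
      then obtain i where i: "j = Suc i" "j < E" using j(1) by (cases j) auto
      then have r: "rgt (g i) = Some (True, q')" using adj[of i] 2(3) by simp
      then have "snd (lower (g i)) \<noteq> None" using signal_tile(1)[OF tile] i by simp
      then have "i = J" using lower[of i] i by (cases "i = J") auto
      with 2 i r show ?thesis by blast
    next
      case (3 q')
      have "j \<noteq> 0" "j \<noteq> E" using 3(1) lower[OF j] by (auto split: if_split_asm)
      then have i: "0 < j" "j < E" using j(1) by auto
      then have r: "lft (g (Suc j)) = Some (False, q')" using adj[of j] 3(4) by simp
      then have "snd (lower (g (Suc j))) \<noteq> None" using signal_tile(2)[OF tile] i by simp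
      then have "Suc j = J" using lower[of "Suc j"] i by (cases "Suc j = J") auto
      with 3 i r show ?thesis by auto
    qed blast
  qed
  note unfold = c J(3)
  from tile[of J] J(2) have "g J \<in> tiles M" by simp
  then show ?thesis
  proof cases
    case (idle s q0)
    then have "upper (g j) = row A E c j" if "j \<le> E" for j
      using others[of j] lower[of j] botJ J that by (cases "j = J") (auto simp: c)
    with ins show ?thesis by blast
  next
    case (stay q0 s q' s')
    let ?c = "(q', t(h := s'), h)"
    have "(q, t h, q', s', Stay) \<in> ntm_trans M" using stay botJ by simp
    then have "ntm_step M c ?c" unfolding c using ntm_step.intros[of q t h q' s' Stay M] by simp
    moreover have "upper (g j) = row A E ?c j" if "j \<le> E" for j
      using others[of j] lower[of j] stay J that by (cases "j = J") auto
    moreover have "inside A E ?c" using ins by (simp add: c)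
    ultimately show ?thesis by blast
  next
    case (right q0 s q' s')
    let ?c = "(q', t(h := s'), h + 1)"
    have "(q, t h, q', s', MoveRight) \<in> ntm_trans M" using right botJ by simp
    then have "ntm_step M c ?c" unfolding c using ntm_step.intros[of q t h q' s' MoveRight M] by simp
    moreover have SJ: "Suc J < E \<and> upper (g (Suc J)) = (fst (lower (g (Suc J))), Some q')"
      using others[of "Suc J"] adj[of J] right J by auto
    moreover have "upper (g j) = row A E ?c j" if "j \<le> E" for j
      using others[of j] lower[of j] right J that SJ
      by (cases "j = J"; cases "j = Suc J") auto
    moreover have "inside A E ?c" using ins SJ J by (simp add: c)
    ultimately show ?thesis by blast
  next
    case (left q0 s q' s')
    let ?c = "(q', t(h := s'), h - 1)"
    have "(q, t h, q', s', MoveLeft) \<in> ntm_trans M" using left botJ by simp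
    then have "ntm_step M c ?c" unfolding c using ntm_step.intros[of q t h q' s' MoveLeft M] by simp
    moreover obtain I where I: "J = Suc I" using J by (cases J) auto
    moreover have SJ: "0 < I \<and> upper (g I) = (fst (lower (g I)), Some q')"
      using others[of I] adj[of I] left J I by auto
    moreover have "upper (g j) = row A E ?c j" if "j \<le> E" for j
      using others[of j] lower[of j] left J that SJ I
      by (cases "j = J"; cases "j = I") auto
    moreover have "inside A E ?c" using ins SJ J I by (simp add: c)
    ultimately show ?thesis by blast
  qed (use botJ in simp_all)
qed

text \<open>Cells are numbered through all rows, so the horizontal condition also joins the end of a
  row to the start of the next. Tilings that come from computations meet it because no signal
  crosses the outer edges.\<close>

definition tiling :: "ntm \<Rightarrow> bool list \<Rightarrow> nat \<Rightarrow> nat \<Rightarrow> nat \<Rightarrow> (nat \<Rightarrow> tile) \<Rightarrow> bool" where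
  "tiling M x A E T f \<longleftrightarrow>
    (\<forall>m < Suc E * Suc T. f m \<in> tiles M) \<and>
    (\<forall>m. Suc m < Suc E * Suc T \<longrightarrow> rgt (f m) = lft (f (Suc m))) \<and>
    (\<forall>m < Suc E * T. upper (f m) = lower (f (m + Suc E))) \<and>
    (\<forall>m < Suc E. lower (f m) = row A E (ntm_init M x) m)"

definition final_head :: "ntm \<Rightarrow> nat \<Rightarrow> nat \<Rightarrow> (nat \<Rightarrow> tile) \<Rightarrow> nat \<Rightarrow> bool" where
  "final_head M E T f j \<longleftrightarrow> j < Suc E \<and> snd (upper (f (Suc E * T + j))) = Some (ntm_accept M)"

lemma inside_init: "0 < A \<Longrightarrow> A < E \<Longrightarrow> inside A E (ntm_init M x)"
  by (simp add: ntm_init_def)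

theorem tiling_sound:
  assumes tl: "tiling M x A E T f" and fin: "final_head M E T f j" and A: "0 < A" "A < E"
  shows "ntm_accepts M x"
proof -
  let ?W = "Suc E" and ?R = "(ntm_step M)\<^sup>*\<^sup>*"
  have tile: "f m \<in> tiles M" if "m < ?W * Suc T" for m
    using tl that by (simp add: tiling_def)
  have adj: "rgt (f m) = lft (f (Suc m))" if "Suc m < ?W * Suc T" for m
    using tl that by (simp add: tiling_def)
  have vert: "upper (f m) = lower (f (m + ?W))" if "m < ?W * T" for m
    using tl that by (simp add: tiling_def)
  have bound: "?W * r + i < ?W * Suc T" if "r \<le> T" "i \<le> E" for r i
  proof -
    have "?W * r + i < ?W * Suc r" using that(2) by simp
    also have "\<dots> \<le> ?W * Suc T" using that(1) by (intro mult_le_mono2) simp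
    finally show ?thesis .
  qed
  \<comment> \<open>Upper colours get their own statement because acceptance is read off the top of
    the last row, above which there is no other.\<close>
  have tops: "\<exists>c. ?R (ntm_init M x) c \<and> inside A E c \<and> (\<forall>i \<le> E. upper (f (?W * r + i)) = row A E c i)"
    if rT: "r \<le> T" and ex: "\<exists>c. ?R (ntm_init M x) c \<and> inside A E c \<and> (\<forall>i \<le> E. lower (f (?W * r + i)) = row A E c i)"
    for r
  proof -
    obtain c where c: "?R (ntm_init M x) c" "inside A E c" "\<forall>i \<le> E. lower (f (?W * r + i)) = row A E c i"
      using ex by blast
    have "\<exists>c'. (c' = c \<or> ntm_step M c c') \<and> inside A E c' \<and> (\<forall>i \<le> E. upper (f (?W * r + i)) = row A E c' i)"
    proof (rule tiling_step[OF _ _ _ c(2)])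
      show "f (?W * r + i) \<in> tiles M" if "i \<le> E" for i
        using tile bound rT that by blast
      show "rgt (f (?W * r + i)) = lft (f (?W * r + Suc i))" if "i < E" for i
        using adj[of "?W * r + i"] bound[OF rT, of "Suc i"] that by simp
    qed (use c(3) in blast)
    with c(1) show ?thesis by (meson rtranclp.rtrancl_into_rtrancl)
  qed
  have bots: "\<exists>c. ?R (ntm_init M x) c \<and> inside A E c \<and> (\<forall>i \<le> E. lower (f (?W * r + i)) = row A E c i)"
    if "r \<le> T" for r
    using that
  proof (induction r)
    case 0
    have "\<forall>i \<le> E. lower (f (?W * 0 + i)) = row A E (ntm_init M x) i"
      using tl by (simp add: tiling_def less_Suc_eq_le)
    with inside_init[OF A] show ?case by blast
  next
    case (Suc r)
    have "upper (f (?W * r + i)) = lower (f (?W * Suc r + i))" if "i \<le> E" for i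
    proof -
      have "?W * r + i < ?W * Suc r" using that by simp
      also have "\<dots> \<le> ?W * T" using Suc.prems by (intro mult_le_mono2)
      finally show ?thesis using vert[of "?W * r + i"] by (simp add: algebra_simps)
    qed
    with tops[of r] Suc show ?case by auto
  qed
  from tops[OF order_refl bots[OF order_refl]] obtain c where
    c: "?R (ntm_init M x) c" "\<forall>i \<le> E. upper (f (?W * T + i)) = row A E c i" by blast
  have "snd (row A E c j) = Some (ntm_accept M)" using c(2) fin unfolding final_head_def less_Suc_eq_le by metis
  then have "fst c = ntm_accept M" by (cases c) (simp split: if_split_asm)
  with c(1) show ?thesis unfolding ntm_accepts_def by blast
qed

text \<open>The colour of the edge between the tape cells z and z + 1 when c is followed by
  c'.\<close>

fun signal :: "ntm_config \<Rightarrow> ntm_config \<Rightarrow> int \<Rightarrow> hcol" where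
  "signal (q, t, h) (q', t', h') z =
    (if h = z \<and> h' = z + 1 then Some (True, q')
     else if h = z + 1 \<and> h' = z then Some (False, q') else None)"

definition tile_of :: "nat \<Rightarrow> nat \<Rightarrow> ntm_config \<Rightarrow> ntm_config \<Rightarrow> nat \<Rightarrow> tile" where
  "tile_of A E c c' j = Tile (row A E c j) (row A E c' j)
    (signal c c' (int j - int A - 1)) (signal c c' (int j - int A))"

text \<open>A step distinguishes the cell of the old head, the cell of the new head if it is another
  one, and the remaining cells, which are \<open>plain\<close>.\<close>

lemma tile_of_in_tiles:
  assumes st: "c' = c \<or> ntm_step M c c'" and ins: "inside A E c" "inside A E c'"
    and mem: "fst c \<in> ntm_states M" "\<And>z. fst (snd c) z \<in> ntm_symbols M"
  shows "tile_of A E c c' j \<in> tiles M"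
proof -
  obtain q t h where c: "c = (q, t, h)" by (cases c)
  from st show ?thesis
  proof
    assume "c' = c"
    then show ?thesis using ins mem
      by (auto simp: tile_of_def c intro!: plain idle)
  next
    assume "ntm_step M c c'"
    then obtain q' s' d where tr: "(q, t h, q', s', d) \<in> ntm_trans M"
      and c': "c' = (q', t(h := s'), move_int d h)"
      unfolding c by cases auto
    note q' = trans_mem[OF tr]
    let ?z = "int j - int A"
    show ?thesis
    proof (cases "?z = h")
      case True
      then have "j \<noteq> 0" "j \<noteq> E" using ins by (auto simp: c)
      then show ?thesis using True tr
        by (cases d) (auto simp: tile_of_def c c' intro: stay left right)
    next
      case False
      show ?thesis
      proof (cases "?z = move_int d h")
        case True
        then have "j \<noteq> 0" "j \<noteq> E" using ins by (auto simp: c c')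
        then show ?thesis using True False mem q'
          by (cases d) (auto simp: tile_of_def c c' intro!: from_left from_right)
      next
        case False2: False
        have "signal c c' ?z = None" "signal c c' (?z - 1) = None"
          using False False2 by (auto simp: c c')
        then show ?thesis using False False2 mem
          by (auto simp: tile_of_def c c' intro!: plain)
      qed
    qed
  qed
qed

theorem tiling_complete:
  assumes acc: "ntm_accepts M x"
    and bound: "\<And>t c. (ntm_step M ^^ t) (ntm_init M x) c \<Longrightarrow> t \<le> T"
    and A: "T < A" "A + T < E"
  shows "\<exists>f. tiling M x A E T f \<and> (\<exists>!j. final_head M E T f j)"
proof -
  let ?W = "Suc E"
  obtain c where "(ntm_step M)\<^sup>*\<^sup>* (ntm_init M x) c" "fst c = ntm_accept M"
    using acc unfolding ntm_accepts_def by blast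
  then obtain n where n: "(ntm_step M ^^ n) (ntm_init M x) c" by (auto simp: rtranclp_power)
  then obtain p where p: "p 0 = ntm_init M x" "p n = c" "\<And>i. i < n \<Longrightarrow> ntm_step M (p i) (p (Suc i))"
    unfolding relpowp_fun_conv by blast
  have nT: "n \<le> T" by (rule bound[OF n])
  \<comment> \<open>The accepting configuration is repeated until the window is full.\<close>
  define C where "C i = p (min i n)" for i
  have C: "C 0 = ntm_init M x" "fst (C (Suc T)) = ntm_accept M"
    "\<And>i. C (Suc i) = C i \<or> ntm_step M (C i) (C (Suc i))"
  proof -
    show "C 0 = ntm_init M x" "fst (C (Suc T)) = ntm_accept M"
      using p nT \<open>fst c = ntm_accept M\<close> by (simp_all add: C_def min_def)
    show "C (Suc i) = C i \<or> ntm_step M (C i) (C (Suc i))" for i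
      using p(3)[of i] by (cases "i < n") (auto simp: C_def min_def)
  qed
  \<comment> \<open>The head moves by at most one cell per step; with the margins of the window this
    keeps it off the borders.\<close>
  have head: "\<bar>snd (snd (p i))\<bar> \<le> int i" if "i \<le> n" for i
    using that
  proof (induction i)
    case 0
    then show ?case by (simp add: p(1) ntm_init_def)
  next
    case (Suc i)
    have "\<bar>snd (snd c')\<bar> \<le> \<bar>snd (snd c)\<bar> + 1" if "ntm_step M c c'" for c c'
      using that
    proof cases
      case (1 q t h q' s d)
      then show ?thesis by (cases d) auto
    qed
    from this[OF p(3)[of i]] Suc show ?case by simp
  qed
  have ins: "inside A E (C i)" for i
  proof -
    have "\<bar>snd (snd (C i))\<bar> \<le> int T" using head[of "min i n"] nT by (simp add: C_def)
    then show ?thesis using A by (cases "C i") auto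
  qed
  have mem: "fst (C i) \<in> ntm_states M \<and> (\<forall>z. fst (snd (C i)) z \<in> ntm_symbols M)" for i
  proof (induction i)
    case 0
    then show ?case by (auto simp: C(1) ntm_init_def ntm_states_def ntm_symbols_def bit_symbol_def)
  next
    case (Suc i)
    from C(3)[of i] show ?case
    proof
      assume "ntm_step M (C i) (C (Suc i))"
      then show ?thesis
      proof cases
        case (1 q t h q' s d)
        with Suc trans_mem[OF 1(3)] show ?thesis by auto
      qed
    qed (use Suc in simp)
  qed
  define f where "f m = tile_of A E (C (m div ?W)) (C (Suc (m div ?W))) (m mod ?W)" for m
  have tile: "f m \<in> tiles M" for m
    unfolding f_def by (rule tile_of_in_tiles) (use C(3) ins mem in auto)
  \<comment> \<open>No head lies on or beyond a border, so the two outer edges carry no signal; this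
    settles the edge between consecutive rows.\<close>
  have border: "signal (C i) (C (Suc i)) (int E - int A) = None" "signal (C i) (C (Suc i)) (- int A - 1) = None" for i
    using ins[of i] ins[of "Suc i"] by (cases "C i"; cases "C (Suc i)"; auto)+
  have adj: "rgt (f m) = lft (f (Suc m))" for m
  proof (cases "Suc (m mod ?W) = ?W")
    case True
    then have "m mod ?W = E" "Suc m mod ?W = 0" by (simp_all add: mod_Suc)
    then show ?thesis unfolding f_def tile_of_def using border by simp
  next
    case False
    then have "Suc m mod ?W = Suc (m mod ?W)" "Suc m div ?W = m div ?W"
      by (simp_all add: mod_Suc div_Suc)
    then show ?thesis unfolding f_def tile_of_def by simp
  qed
  have vert: "upper (f m) = lower (f (m + ?W))" for m
  proof -
    have "(m + ?W) div ?W = Suc (m div ?W)" "(m + ?W) mod ?W = m mod ?W"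
      by (simp_all only: div_add_self2 mod_add_self2 Suc_eq_plus1)
    then show ?thesis by (simp only: f_def tile_of_def tile.sel)
  qed
  have "tiling M x A E T f"
    unfolding tiling_def using tile adj vert C(1) by (auto simp: f_def tile_of_def)
  moreover have last: "upper (f (?W * T + j)) = row A E (C (Suc T)) j" if "j < ?W" for j
  proof -
    have "(?W * T + j) div ?W = T" "(?W * T + j) mod ?W = j"
      using that by (simp_all only: div_mult_self4 mod_mult_self4 div_less mod_less)
    then show ?thesis by (simp only: f_def tile_of_def tile.sel)
  qed
  have "\<exists>!j. final_head M E T f j"
  proof -
    obtain q t h where CT: "C (Suc T) = (q, t, h)" by (cases "C (Suc T)")
    have q: "q = ntm_accept M" using C(2) CT by simp
    have h: "0 < int A + h" "int A + h < int E" using ins[of "Suc T"] CT by simp_all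
    have "final_head M E T f j \<longleftrightarrow> j = nat (int A + h)" for j
    proof
      assume *: "final_head M E T f j"
      then have "snd (row A E (C (Suc T)) j) = Some (ntm_accept M)"
        using last unfolding final_head_def by metis
      then show "j = nat (int A + h)" unfolding CT by (simp split: if_split_asm)
    next
      assume j: "j = nat (int A + h)"
      then have "j < ?W" using h by simp
      then show "final_head M E T f j" unfolding final_head_def last[OF \<open>j < ?W\<close>] CT
        using j h q by simp
    qed
    then show ?thesis by simp
  qed
  ultimately show ?thesis by blast
qed

section \<open>Tilings as hitting sets\<close>

text \<open>The bottom row is the border cell 0, 2 T blanks, the input, 2 T blanks and the border
  cell \<open>border n T\<close>. For positive T, a head that starts on the first input cell reaches
  neither border within T steps.\<close>

definition offset :: "nat \<Rightarrow> nat" where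
  "offset T = Suc (T + T)"

definition border :: "nat \<Rightarrow> nat \<Rightarrow> nat" where
  "border n T = offset T + (n + (T + T))"

definition ncells :: "nat \<Rightarrow> nat \<Rightarrow> nat" where
  "ncells n T = Suc (border n T) * T + Suc (border n T)"

lemma ncells_eq: "ncells n T = Suc (border n T) * Suc T"
  by (simp only: ncells_def mult_Suc_right add.commute)

lemma window_bounds:
  "0 < offset T" "offset T + n + (T + T) = border n T" "m \<le> border n T \<Longrightarrow> m < ncells n T"
  "Suc (border n T) * T + border n T < ncells n T" "Suc (border n T) * T \<le> ncells n T"
  by (simp_all add: offset_def border_def ncells_def)

text \<open>
  A constraint is a predicate on pairs of a cell and a tile. It must be satisfied by exactly one cell
  together with its tile.
\<close>

type_synonym constr = "nat \<Rightarrow> tile \<Rightarrow> bool"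

text \<open>Nested conditionals are the form in which \<open>pair_gen\<close> tests the two places
  one after the other. A single place is a degenerate pair, so one generator writes both
  sorts.\<close>

definition two :: "nat \<Rightarrow> (tile \<Rightarrow> bool) \<Rightarrow> nat \<Rightarrow> (tile \<Rightarrow> bool) \<Rightarrow> constr" where
  "two i P j Q m \<tau> \<longleftrightarrow> (if i = m then P \<tau> else if j = m then Q \<tau> else False)"

abbreviation one :: "nat \<Rightarrow> (tile \<Rightarrow> bool) \<Rightarrow> constr" where
  "one i P \<equiv> two i P i P"

definition has_symbol :: "nat option \<Rightarrow> tile \<Rightarrow> bool" where
  "has_symbol s \<tau> \<longleftrightarrow> fst (lower \<tau>) = s"

definition has_head :: "nat option \<Rightarrow> tile \<Rightarrow> bool" where
  "has_head q \<tau> \<longleftrightarrow> snd (lower \<tau>) = q"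

text \<open>
  Two adjacent tiles have colours \<open>a\<close> and \<open>b\<close> in common position, and exactly one of \<open>a = c\<close> and
  \<open>b \<noteq> c\<close> holds for every colour \<open>c\<close> if and only if \<open>a = b\<close>.
\<close>

definition match_constrs :: "hcol list \<Rightarrow> vcol list \<Rightarrow> nat \<Rightarrow> nat \<Rightarrow> constr list list" where
  "match_constrs hs vs n T =
    [map (\<lambda>m. one m (\<lambda>_. True)) [0..<ncells n T],
     concat (map (\<lambda>m. map (\<lambda>c. two m (\<lambda>\<tau>. rgt \<tau> = c) (Suc m) (\<lambda>\<tau>. lft \<tau> \<noteq> c)) hs)
       [0..<Suc (border n T) * T + border n T]),
     concat (map (\<lambda>m. map (\<lambda>c. two m (\<lambda>\<tau>. upper \<tau> = c) (m + Suc (border n T)) (\<lambda>\<tau>. lower \<tau> \<noteq> c)) vs)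
       [0..<Suc (border n T) * T])]"

text \<open>Symbols and heads are prescribed separately and in runs, so that each list is written by
  one entry of \<open>constr_gens\<close>.\<close>

definition init_constrs :: "nat \<Rightarrow> bool list \<Rightarrow> nat \<Rightarrow> constr list list" where
  "init_constrs q0 x T =
    [[one 0 (has_symbol None)],
     map (\<lambda>j. one (Suc j) (has_symbol (Some 0))) [0..<T + T],
     map (\<lambda>i. one (offset T + i) (has_symbol (Some (bit_symbol (x ! i))))) [0..<length x],
     map (\<lambda>j. one (offset T + length x + j) (has_symbol (Some 0))) [0..<T + T],
     [one (border (length x) T) (has_symbol None)],
     [one (offset T) (has_head (Some q0))],
     map (\<lambda>j. one j (has_head None)) [0..<offset T],
     map (\<lambda>j. one (Suc (offset T + j)) (has_head None)) [0..<length x + (T + T)]]"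

text \<open>Exactness is possible for a whole row because a configuration has only one head.\<close>

definition final_constr :: "nat \<Rightarrow> nat \<Rightarrow> nat \<Rightarrow> constr" where
  "final_constr qa n T m \<tau> \<longleftrightarrow> Suc (border n T) * T \<le> m \<and> snd (upper \<tau>) = Some qa"

definition constrs :: "ntm \<Rightarrow> hcol list \<Rightarrow> vcol list \<Rightarrow> bool list \<Rightarrow> nat \<Rightarrow> constr list" where
  "constrs M hs vs x T = concat (match_constrs hs vs (length x) T) @
    concat (init_constrs (ntm_start M) x T) @ [final_constr (ntm_accept M) (length x) T]"

section \<open>Constraints characterize tilings\<close>

lemma in_constrsI:
  "F \<in> set (match_constrs hs vs (length x) T ! i) \<Longrightarrow> i < 3 \<Longrightarrow> F \<in> set (constrs M hs vs x T)"
  "F \<in> set (init_constrs (ntm_start M) x T ! j) \<Longrightarrow> j < 8 \<Longrightarrow> F \<in> set (constrs M hs vs x T)"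
proof -
  assume "F \<in> set (match_constrs hs vs (length x) T ! i)" "i < 3"
  moreover from this(2) have "match_constrs hs vs (length x) T ! i \<in> set (match_constrs hs vs (length x) T)"
    by (intro nth_mem) (simp add: match_constrs_def)
  ultimately show "F \<in> set (constrs M hs vs x T)"
    unfolding constrs_def set_append set_concat by blast
next
  assume "F \<in> set (init_constrs (ntm_start M) x T ! j)" "j < 8"
  moreover from this(2) have "init_constrs (ntm_start M) x T ! j \<in> set (init_constrs (ntm_start M) x T)"
    by (intro nth_mem) (simp add: init_constrs_def)
  ultimately show "F \<in> set (constrs M hs vs x T)"
    unfolding constrs_def set_append set_concat by blast
qed

lemma ex_two: "i < N \<Longrightarrow> j < N \<Longrightarrow> i \<noteq> j \<Longrightarrow> (\<exists>m<N. two i P j Q m (f m)) \<longleftrightarrow> P (f i) \<or> Q (f j)"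
  by (auto simp: two_def)

lemma ex_one: "i < N \<Longrightarrow> (\<exists>m<N. one i P m (f m)) \<longleftrightarrow> P (f i)"
  by (auto simp: two_def)

lemma ex1_two:
  "i < N \<Longrightarrow> j < N \<Longrightarrow> i \<noteq> j \<Longrightarrow> P (f i) \<noteq> Q (f j) \<Longrightarrow> \<exists>!m. m < N \<and> two i P j Q m (f m)"
  by (auto simp: two_def)

lemma ex1_one: "i < N \<Longrightarrow> P (f i) \<Longrightarrow> \<exists>!m. m < N \<and> one i P m (f m)"
  by (auto simp: two_def)

definition init_symbol :: "bool list \<Rightarrow> nat \<Rightarrow> nat \<Rightarrow> nat option" where
  "init_symbol x T m =
    (if m = 0 \<or> m = border (length x) T then None
     else if offset T \<le> m \<and> m < offset T + length x then Some (bit_symbol (x ! (m - offset T))) else Some 0)"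

lemma row_init:
  fixes x :: "bool list" and T :: nat
  defines "n \<equiv> length x"
  assumes "0 < T" "m \<le> border n T"
  shows "fst (row (offset T) (border n T) (ntm_init M x) m) = init_symbol x T m"
    "snd (row (offset T) (border n T) (ntm_init M x) m) = (if m = offset T then Some (ntm_start M) else None)"
proof -
  have "nat (int m - int (offset T)) = m - offset T" by simp
  then show "fst (row (offset T) (border n T) (ntm_init M x) m) = init_symbol x T m"
    unfolding ntm_init_def row.simps n_def init_symbol_def by auto
  show "snd (row (offset T) (border n T) (ntm_init M x) m) = (if m = offset T then Some (ntm_start M) else None)"
    using window_bounds(1)[of T] unfolding ntm_init_def row.simps by auto
qed

lemma window_cases:
  assumes "m \<le> border n T"
  obtains "m = 0" | j where "j < T + T" "m = Suc j" | i where "i < n" "m = offset T + i"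
  | j where "j < T + T" "m = offset T + n + j" | "m = border n T"
proof -
  consider "m = 0" | "0 < m" "m < offset T" | "offset T \<le> m" "m < offset T + n"
    | "offset T + n \<le> m" "m < border n T" | "m = border n T"
    using assms by linarith
  then show ?thesis
  proof cases
    case 2
    then show ?thesis using that(2)[of "m - 1"] by (simp add: offset_def)
  next
    case 3
    then show ?thesis using that(3)[of "m - offset T"] by simp
  next
    case 4
    then show ?thesis using that(4)[of "m - (offset T + n)"] by (simp add: border_def)
  qed (use that in blast)+
qed

lemma window_head_cases:
  assumes "m \<le> border n T"
  obtains "m = offset T" | "m < offset T" | j where "j < n + (T + T)" "m = Suc (offset T + j)"
proof -
  consider "m = offset T" | "m < offset T" | "offset T < m" by linarith
  then show ?thesis
  proof cases
    case 3
    then show ?thesis using that(3)[of "m - Suc (offset T)"] assms by (simp add: border_def)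
  qed (use that in blast)+
qed

lemma set_match_constrs:
  "F \<in> set (concat (match_constrs hs vs n T)) \<longleftrightarrow>
    (\<exists>m. m < ncells n T \<and> F = one m (\<lambda>_. True)) \<or>
    (\<exists>m c. m < Suc (border n T) * T + border n T \<and> c \<in> set hs \<and>
      F = two m (\<lambda>\<tau>. rgt \<tau> = c) (Suc m) (\<lambda>\<tau>. lft \<tau> \<noteq> c)) \<or>
    (\<exists>m c. m < Suc (border n T) * T \<and> c \<in> set vs \<and>
      F = two m (\<lambda>\<tau>. upper \<tau> = c) (m + Suc (border n T)) (\<lambda>\<tau>. lower \<tau> \<noteq> c))"
proof -
  have *: "F \<in> set (concat (map (\<lambda>m. map (g m) cs) [0..<k])) \<longleftrightarrow> (\<exists>m c. m < k \<and> c \<in> set cs \<and> F = g m c)"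
    for F :: constr and g :: "nat \<Rightarrow> 'b \<Rightarrow> constr" and cs k
    by auto
  have **: "F \<in> set (map g [0..<k]) \<longleftrightarrow> (\<exists>m. m < k \<and> F = g m)" for F :: constr and g k
    by auto
  show ?thesis
    unfolding match_constrs_def concat.simps set_append Un_iff * ** by simp
qed

lemma set_init_constrs:
  "F \<in> set (concat (init_constrs q0 x T)) \<longleftrightarrow>
    F = one 0 (has_symbol None) \<or>
    (\<exists>j. j < T + T \<and> F = one (Suc j) (has_symbol (Some 0))) \<or>
    (\<exists>i. i < length x \<and> F = one (offset T + i) (has_symbol (Some (bit_symbol (x ! i))))) \<or>
    (\<exists>j. j < T + T \<and> F = one (offset T + length x + j) (has_symbol (Some 0))) \<or>
    F = one (border (length x) T) (has_symbol None) \<or>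
    F = one (offset T) (has_head (Some q0)) \<or>
    (\<exists>j. j < offset T \<and> F = one j (has_head None)) \<or>
    (\<exists>j. j < length x + (T + T) \<and> F = one (Suc (offset T + j)) (has_head None))"
proof -
  have *: "F \<in> set (map g [0..<k]) \<longleftrightarrow> (\<exists>m. m < k \<and> F = g m)" for F :: constr and g k
    by auto
  have **: "F \<in> set [G] \<longleftrightarrow> F = G" for F G :: constr by simp
  show ?thesis
    unfolding init_constrs_def concat.simps set_append Un_iff * ** by simp
qed

lemma constrs_mem:
  fixes x :: "bool list" and T :: nat
  defines "n \<equiv> length x"
  shows "m < ncells n T \<Longrightarrow> one m (\<lambda>_. True) \<in> set (constrs M hs vs x T)"
    "m < Suc (border n T) * T + border n T \<Longrightarrow> c \<in> set hs \<Longrightarrow>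
      two m (\<lambda>\<tau>. rgt \<tau> = c) (Suc m) (\<lambda>\<tau>. lft \<tau> \<noteq> c) \<in> set (constrs M hs vs x T)"
    "m < Suc (border n T) * T \<Longrightarrow> c' \<in> set vs \<Longrightarrow>
      two m (\<lambda>\<tau>. upper \<tau> = c') (m + Suc (border n T)) (\<lambda>\<tau>. lower \<tau> \<noteq> c') \<in> set (constrs M hs vs x T)"
    "one 0 (has_symbol None) \<in> set (constrs M hs vs x T)"
    "j < T + T \<Longrightarrow> one (Suc j) (has_symbol (Some 0)) \<in> set (constrs M hs vs x T)"
    "i < n \<Longrightarrow> one (offset T + i) (has_symbol (Some (bit_symbol (x ! i)))) \<in> set (constrs M hs vs x T)"
    "j < T + T \<Longrightarrow> one (offset T + n + j) (has_symbol (Some 0)) \<in> set (constrs M hs vs x T)"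
    "one (border n T) (has_symbol None) \<in> set (constrs M hs vs x T)"
    "one (offset T) (has_head (Some (ntm_start M))) \<in> set (constrs M hs vs x T)"
    "j < offset T \<Longrightarrow> one j (has_head None) \<in> set (constrs M hs vs x T)"
    "j < n + (T + T) \<Longrightarrow> one (Suc (offset T + j)) (has_head None) \<in> set (constrs M hs vs x T)"
    "final_constr (ntm_accept M) n T \<in> set (constrs M hs vs x T)"
proof -
  show "one m (\<lambda>_. True) \<in> set (constrs M hs vs x T)" if "m < ncells n T"
    by (rule in_constrsI(1)[where i = 0]) (use that in \<open>auto simp: match_constrs_def n_def numeral_2_eq_2\<close>)
  show "two m (\<lambda>\<tau>. rgt \<tau> = c) (Suc m) (\<lambda>\<tau>. lft \<tau> \<noteq> c) \<in> set (constrs M hs vs x T)" if "m < Suc (border n T) * T + border n T" "c \<in> set hs"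
    by (rule in_constrsI(1)[where i = 1]) (use that in \<open>auto simp: match_constrs_def n_def numeral_2_eq_2\<close>)
  show "two m (\<lambda>\<tau>. upper \<tau> = c') (m + Suc (border n T)) (\<lambda>\<tau>. lower \<tau> \<noteq> c') \<in> set (constrs M hs vs x T)" if "m < Suc (border n T) * T" "c' \<in> set vs"
    by (rule in_constrsI(1)[where i = 2]) (use that in \<open>auto simp: match_constrs_def n_def numeral_2_eq_2\<close>)
  show "one 0 (has_symbol None) \<in> set (constrs M hs vs x T)"
    by (rule in_constrsI(2)[where j = 0]) (simp_all add: init_constrs_def n_def eval_nat_numeral)
  show "one (Suc j) (has_symbol (Some 0)) \<in> set (constrs M hs vs x T)" if "j < T + T"
    by (rule in_constrsI(2)[where j = 1]) (use that in \<open>auto simp: init_constrs_def n_def eval_nat_numeral\<close>)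
  show "one (offset T + i) (has_symbol (Some (bit_symbol (x ! i)))) \<in> set (constrs M hs vs x T)" if "i < n"
    by (rule in_constrsI(2)[where j = 2]) (use that in \<open>auto simp: init_constrs_def n_def eval_nat_numeral\<close>)
  show "one (offset T + n + j) (has_symbol (Some 0)) \<in> set (constrs M hs vs x T)" if "j < T + T"
    by (rule in_constrsI(2)[where j = 3]) (use that in \<open>auto simp: init_constrs_def n_def eval_nat_numeral\<close>)
  show "one (border n T) (has_symbol None) \<in> set (constrs M hs vs x T)"
    by (rule in_constrsI(2)[where j = 4]) (simp_all add: init_constrs_def n_def eval_nat_numeral)
  show "one (offset T) (has_head (Some (ntm_start M))) \<in> set (constrs M hs vs x T)"
    by (rule in_constrsI(2)[where j = 5]) (simp_all add: init_constrs_def n_def eval_nat_numeral)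
  show "one j (has_head None) \<in> set (constrs M hs vs x T)" if "j < offset T"
    by (rule in_constrsI(2)[where j = 6]) (use that in \<open>auto simp: init_constrs_def n_def eval_nat_numeral\<close>)
  show "one (Suc (offset T + j)) (has_head None) \<in> set (constrs M hs vs x T)" if "j < n + (T + T)"
    by (rule in_constrsI(2)[where j = 7]) (use that in \<open>auto simp: init_constrs_def n_def eval_nat_numeral\<close>)
  show "final_constr (ntm_accept M) n T \<in> set (constrs M hs vs x T)"
    by (simp add: constrs_def n_def)
qed

text \<open>Every constraint is assumed to be satisfied somewhere, not exactly once: this is what
  the hitting set of an arbitrary learned formula provides.\<close>

lemma constrs_imp_tiling:
  fixes x :: "bool list" and T :: nat
  defines "n \<equiv> length x"
  assumes T: "0 < T" and cols: "set hs = hcols M" "set vs = vcols M"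
    and tile: "\<And>m. m < ncells n T \<Longrightarrow> f m \<in> tiles M"
    and sat: "\<And>F. F \<in> set (constrs M hs vs x T) \<Longrightarrow> \<exists>m < ncells n T. F m (f m)"
  shows "tiling M x (offset T) (border n T) T f" "\<exists>j. final_head M (border n T) T f j"
proof -
  have sat1: "P (f i)" if "one i P \<in> set (constrs M hs vs x T)" "i < ncells n T" for i P
    using sat[OF that(1)] ex_one[OF that(2)] by blast
  have sat2: "P (f i) \<or> Q (f j)"
    if "two i P j Q \<in> set (constrs M hs vs x T)" "i < ncells n T" "j < ncells n T" "i \<noteq> j" for i j P Q
    using sat[OF that(1)] ex_two[OF that(2-4)] by blast
  have "rgt (f m) = lft (f (Suc m))" if m: "Suc m < ncells n T" for m
  proof -
    \<comment> \<open>At this colour the second disjunct fails, so the first gives the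
      equality.\<close>
    let ?c = "lft (f (Suc m))"
    have "?c \<in> set hs" using tile_colours(3)[OF tile[OF m]] cols by simp
    then have "two m (\<lambda>\<tau>. rgt \<tau> = ?c) (Suc m) (\<lambda>\<tau>. lft \<tau> \<noteq> ?c) \<in> set (constrs M hs vs x T)"
      using m unfolding n_def by (intro constrs_mem(2)) (simp_all add: ncells_def)
    from sat2[OF this] m show ?thesis by simp
  qed
  moreover have "upper (f m) = lower (f (m + Suc (border n T)))" if m: "m < Suc (border n T) * T" for m
  proof -
    let ?j = "m + Suc (border n T)"
    let ?c = "lower (f ?j)"
    have j: "?j < ncells n T" using m by (simp add: ncells_def)
    have "?c \<in> set vs" using tile_colours(1)[OF tile[OF j]] cols by simp
    then have "two m (\<lambda>\<tau>. upper \<tau> = ?c) ?j (\<lambda>\<tau>. lower \<tau> \<noteq> ?c) \<in> set (constrs M hs vs x T)"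
      using m unfolding n_def by (intro constrs_mem(3)) simp_all
    from sat2[OF this] m j show ?thesis by simp
  qed
  moreover have "lower (f m) = row (offset T) (border n T) (ntm_init M x) m" if m: "m \<le> border n T" for m
  proof (rule prod_eqI)
    note bN = window_bounds(3)[of _ n T]
    have sym: "fst (lower (f i)) = s" if "one i (has_symbol s) \<in> set (constrs M hs vs x T)" "i \<le> border n T" for i s
      using sat1[OF that(1) bN[OF that(2)]] by (simp add: has_symbol_def)
    have hd: "snd (lower (f i)) = q" if "one i (has_head q) \<in> set (constrs M hs vs x T)" "i \<le> border n T" for i q
      using sat1[OF that(1) bN[OF that(2)]] by (simp add: has_head_def)
    note r = row_init[OF T m[unfolded n_def], of M, folded n_def]
    show "fst (lower (f m)) = fst (row (offset T) (border n T) (ntm_init M x) m)"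
      unfolding r using m
    proof (cases rule: window_cases)
      case 1
      then show "fst (lower (f m)) = init_symbol x T m"
        using sym[OF constrs_mem(4)] by (simp add: init_symbol_def n_def)
    next
      case (2 j)
      then show "fst (lower (f m)) = init_symbol x T m"
        using sym[OF constrs_mem(5)[OF 2(1)]] m by (simp add: init_symbol_def n_def offset_def border_def)
    next
      case (3 i)
      then show "fst (lower (f m)) = init_symbol x T m"
        using sym[OF constrs_mem(6)[OF 3(1)[unfolded n_def]]] T m by (simp add: init_symbol_def n_def offset_def border_def)
    next
      case (4 j)
      then show "fst (lower (f m)) = init_symbol x T m"
        using sym[OF constrs_mem(7)[OF 4(1)], folded n_def] m by (simp add: init_symbol_def n_def offset_def border_def)
    next
      case 5
      then show "fst (lower (f m)) = init_symbol x T m"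
        using sym[OF constrs_mem(8), folded n_def] by (simp add: init_symbol_def n_def)
    qed
    show "snd (lower (f m)) = snd (row (offset T) (border n T) (ntm_init M x) m)"
      unfolding r using m
    proof (cases rule: window_head_cases)
      case 1
      then show "snd (lower (f m)) = (if m = offset T then Some (ntm_start M) else None)"
        using hd[OF constrs_mem(9)] m by simp
    next
      case 2
      then show "snd (lower (f m)) = (if m = offset T then Some (ntm_start M) else None)"
        using hd[OF constrs_mem(10)[OF 2]] m by simp
    next
      case (3 j)
      then show "snd (lower (f m)) = (if m = offset T then Some (ntm_start M) else None)"
        using hd[OF constrs_mem(11)[OF 3(1)[unfolded n_def]]] m by simp
    qed
  qed
  ultimately show "tiling M x (offset T) (border n T) T f"
    unfolding tiling_def less_Suc_eq_le ncells_eq using tile[unfolded ncells_eq] by blast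
  obtain m where m: "m < ncells n T" "final_constr (ntm_accept M) n T m (f m)"
    using sat[OF constrs_mem(12)] unfolding n_def by blast
  then obtain j where "m = Suc (border n T) * T + j"
    unfolding final_constr_def using le_Suc_ex by blast
  with m show "\<exists>j. final_head M (border n T) T f j"
    unfolding final_head_def final_constr_def by (auto simp: ncells_def)
qed

lemma tiling_imp_constrs:
  fixes x :: "bool list" and T :: nat
  defines "n \<equiv> length x"
  assumes T: "0 < T" and tl: "tiling M x (offset T) (border n T) T f"
    and fin: "\<exists>!j. final_head M (border n T) T f j"
    and F: "F \<in> set (constrs M hs vs x T)"
  shows "\<exists>!m. m < ncells n T \<and> F m (f m)"
proof -
  let ?W = "Suc (border n T)"
  note N = ncells_eq[of n T]
  have adj: "rgt (f m) = lft (f (Suc m))" if "Suc m < ncells n T" for m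
    using tl that unfolding tiling_def N by blast
  have vert: "upper (f m) = lower (f (m + ?W))" if "m < ?W * T" for m
    using tl that unfolding tiling_def by blast
  have low: "lower (f m) = row (offset T) (border n T) (ntm_init M x) m" if "m \<le> border n T" for m
    using tl that unfolding tiling_def less_Suc_eq_le by blast
  note bN = window_bounds(3)[of _ n T]
  have fst_low: "has_symbol (init_symbol x T m) (f m)"
    if "m \<le> border n T" for m
    unfolding has_symbol_def low[OF that] n_def by (rule row_init(1)[OF T that[unfolded n_def]])
  have snd_low: "has_head (if m = offset T then Some (ntm_start M) else None) (f m)" if "m \<le> border n T" for m
    unfolding has_head_def low[OF that] n_def by (rule row_init(2)[OF T that[unfolded n_def]])
  consider "F \<in> set (concat (match_constrs hs vs n T))" | "F \<in> set (concat (init_constrs (ntm_start M) x T))"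
    | "F = final_constr (ntm_accept M) n T"
    using F unfolding constrs_def n_def set_append by auto
  then show ?thesis
  proof cases
    case 1
    consider m where "m < ncells n T" "F = one m (\<lambda>_. True)"
      | m c where "m < ?W * T + border n T" "F = two m (\<lambda>\<tau>. rgt \<tau> = c) (Suc m) (\<lambda>\<tau>. lft \<tau> \<noteq> c)"
      | m c where "m < ?W * T" "F = two m (\<lambda>\<tau>. upper \<tau> = c) (m + ?W) (\<lambda>\<tau>. lower \<tau> \<noteq> c)"
      using 1 unfolding set_match_constrs by blast
    then show ?thesis
    proof cases
      case 1
      then show ?thesis using ex1_one[of m "ncells n T" "\<lambda>_. True" f] by blast
    next
      \<comment> \<open>The two colours are equal, so rgt = c and lft \<noteq> c are complementary
        and exactly one of them holds.\<close>
      case (2 m c)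
      then have "Suc m < ncells n T" "m < ncells n T" by (simp_all add: ncells_def)
      then show ?thesis unfolding 2(2) using adj[of m] by (intro ex1_two) auto
    next
      case (3 m c)
      then have m: "m < ncells n T" "m + ?W < ncells n T" by (simp_all add: ncells_def)
      show ?thesis unfolding 3(2) by (rule ex1_two[OF m]) (use vert[OF 3(1)] in auto)
    qed
  next
    case 2
    consider "F = one 0 (has_symbol None)" | j where "j < T + T" "F = one (Suc j) (has_symbol (Some 0))"
      | i where "i < n" "F = one (offset T + i) (has_symbol (Some (bit_symbol (x ! i))))"
      | j where "j < T + T" "F = one (offset T + n + j) (has_symbol (Some 0))"
      | "F = one (border n T) (has_symbol None)" | "F = one (offset T) (has_head (Some (ntm_start M)))"
      | j where "j < offset T" "F = one j (has_head None)"
      | j where "j < n + (T + T)" "F = one (Suc (offset T + j)) (has_head None)"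
      using 2 unfolding set_init_constrs n_def by blast
    then show ?thesis
    proof cases
      case 1
      show ?thesis unfolding 1 by (rule ex1_one[OF bN]) (use fst_low[of 0] in \<open>simp_all add: init_symbol_def n_def offset_def border_def\<close>)
    next
      case (2 j)
      show ?thesis unfolding 2(2) by (rule ex1_one[OF bN]) (use fst_low[of "Suc j"] 2(1) in \<open>simp_all add: init_symbol_def n_def offset_def border_def\<close>)
    next
      case (3 i)
      show ?thesis unfolding 3(2)
        by (rule ex1_one[OF bN]) (use fst_low[of "offset T + i"] 3(1) T in \<open>simp_all add: init_symbol_def n_def offset_def border_def\<close>)
    next
      case (4 j)
      show ?thesis unfolding 4(2)
        by (rule ex1_one[OF bN]) (use fst_low[of "offset T + n + j"] 4(1) T in \<open>simp_all add: init_symbol_def n_def offset_def border_def\<close>)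
    next
      case 5
      show ?thesis unfolding 5 by (rule ex1_one[OF bN]) (use fst_low[of "border n T"] in \<open>simp_all add: init_symbol_def n_def offset_def border_def\<close>)
    next
      case 6
      show ?thesis unfolding 6 by (rule ex1_one[OF bN]) (use snd_low[of "offset T"] in \<open>simp_all add: init_symbol_def n_def offset_def border_def\<close>)
    next
      case (7 j)
      show ?thesis unfolding 7(2) by (rule ex1_one[OF bN]) (use snd_low[of j] 7(1) in \<open>simp_all add: init_symbol_def n_def offset_def border_def\<close>)
    next
      case (8 j)
      show ?thesis unfolding 8(2)
        by (rule ex1_one[OF bN]) (use snd_low[of "Suc (offset T + j)"] 8(1) in \<open>simp_all add: init_symbol_def n_def offset_def border_def\<close>)
    qed
  next
    case 3
    obtain j where j: "final_head M (border n T) T f j" "\<And>i. final_head M (border n T) T f i \<Longrightarrow> i = j"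
      using fin by blast
    show ?thesis unfolding 3
    proof (rule ex1I)
      show "?W * T + j < ncells n T \<and> final_constr (ntm_accept M) n T (?W * T + j) (f (?W * T + j))"
        using j(1) unfolding final_head_def final_constr_def by (simp add: ncells_def)
      fix m assume *: "m < ncells n T \<and> final_constr (ntm_accept M) n T m (f m)"
      then obtain i where i: "m = ?W * T + i"
        unfolding final_constr_def using le_Suc_ex by blast
      with * have "final_head M (border n T) T f i" unfolding final_head_def final_constr_def by (simp add: ncells_def)
      with j(2) i show "m = ?W * T + j" by simp
    qed
  qed
qed

text \<open>
  With \<open>q\<close> tiles, the proposition \<open>m (q + 1) + s\<close> stands for tile \<open>s\<close> at cell \<open>m\<close> if \<open>s < q\<close> and is
  the dummy proposition of cell \<open>m\<close> if \<open>s = q\<close>. The last proposition plays the role of \<open>p\<close>.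
\<close>

definition letter_of :: "tile list \<Rightarrow> nat \<Rightarrow> constr \<Rightarrow> (nat \<Rightarrow> bool) \<Rightarrow> bool \<Rightarrow> nat set" where
  "letter_of ts N F d b =
    {i. i < N * Suc (length ts) \<and>
      (if i mod Suc (length ts) < length ts
       then F (i div Suc (length ts)) (ts ! (i mod Suc (length ts))) else d (i div Suc (length ts)))} \<union>
    (if b then {N * Suc (length ts)} else {})"

abbreviation never :: "constr" where
  "never \<equiv> \<lambda>_ _. False"

abbreviation cset :: "tile list \<Rightarrow> nat \<Rightarrow> constr \<Rightarrow> nat set" where
  "cset ts N F \<equiv> letter_of ts N F (\<lambda>_. False) False"

definition dummies :: "tile list \<Rightarrow> nat \<Rightarrow> nat list" where
  "dummies ts N = map (\<lambda>m. m * Suc (length ts) + length ts) [0..<N]"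

section \<open>Numbering the propositions\<close>

lemma div_mod_index:
  "s < Suc q \<Longrightarrow> (m * Suc q + s) div Suc q = m" "s < Suc q \<Longrightarrow> (m * Suc q + s) mod Suc q = s"
  "s < Suc q \<Longrightarrow> m < N \<Longrightarrow> m * Suc q + s < N * Suc q" for m s q N :: nat
proof -
  show "(m * Suc q + s) div Suc q = m" "(m * Suc q + s) mod Suc q = s" if "s < Suc q"
    using that by (simp_all only: div_mult_self3 mod_mult_self3 div_less mod_less add_0_right)
  show "m * Suc q + s < N * Suc q" if "s < Suc q" "m < N"
  proof -
    have "m * Suc q + s < Suc m * Suc q" using that(1) by simp
    also have "\<dots> \<le> N * Suc q" using that(2) by (intro mult_le_mono1) simp
    finally show ?thesis .
  qed
qed

lemma index_in_letter:
  "s < length ts \<Longrightarrow> m < N \<Longrightarrow> m * Suc (length ts) + s \<in> letter_of ts N F d b \<longleftrightarrow> F m (ts ! s)"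
  "m < N \<Longrightarrow> m * Suc (length ts) + length ts \<in> letter_of ts N F d b \<longleftrightarrow> d m"
  "N * Suc (length ts) \<in> letter_of ts N F d b \<longleftrightarrow> b"
proof -
  show "m * Suc (length ts) + s \<in> letter_of ts N F d b \<longleftrightarrow> F m (ts ! s)" if "s < length ts" "m < N"
  proof -
    note i = div_mod_index[of s "length ts" m]
    have "m * Suc (length ts) + s < N * Suc (length ts)" by (rule div_mod_index(3)) (use that in simp_all)
    then show ?thesis unfolding letter_of_def using i(1,2) that by (simp del: mult_Suc_right)
  qed
  show "m * Suc (length ts) + length ts \<in> letter_of ts N F d b \<longleftrightarrow> d m" if "m < N"
  proof -
    note i = div_mod_index[of "length ts" "length ts" m]
    have "m * Suc (length ts) + length ts < N * Suc (length ts)" by (rule div_mod_index(3)) (use that in simp_all)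
    then show ?thesis unfolding letter_of_def using i(1,2) by (simp del: mult_Suc_right)
  qed
  show "N * Suc (length ts) \<in> letter_of ts N F d b \<longleftrightarrow> b"
    unfolding letter_of_def by simp
qed

lemma index_cases:
  assumes "i < N * Suc q + 1"
  obtains m s where "m < N" "s < q" "i = m * Suc q + s" | m where "m < N" "i = m * Suc q + q" | "i = N * Suc q"
proof (cases "i = N * Suc q")
  case False
  then have "i < N * Suc q" using assms by simp
  then have m: "i div Suc q < N" by (simp add: less_mult_imp_div_less)
  have i: "i = i div Suc q * Suc q + i mod Suc q" by (simp del: mult_Suc_right)
  show ?thesis
  proof (cases "i mod Suc q < q")
    case True
    then show ?thesis using that(1) m i by blast
  next
    case False
    have "i mod Suc q < Suc q" by (rule mod_less_divisor) simp
    with False have "i mod Suc q = q" by linarith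
    then show ?thesis using that(2) m i by metis
  qed
qed (use that in blast)

lemma letter_of_subset: "letter_of ts N F d b \<subseteq> {..<N * Suc (length ts) + 1}"
  by (auto simp: letter_of_def)

lemma letter_eqI:
  assumes "X \<subseteq> {..<N * Suc (length ts) + 1}"
    and "\<And>m s. m < N \<Longrightarrow> s < length ts \<Longrightarrow> m * Suc (length ts) + s \<in> X \<longleftrightarrow> F m (ts ! s)"
    and "\<And>m. m < N \<Longrightarrow> m * Suc (length ts) + length ts \<in> X \<longleftrightarrow> d m"
    and "N * Suc (length ts) \<in> X \<longleftrightarrow> b"
  shows "X = letter_of ts N F d b"
proof -
  have "i \<in> X \<longleftrightarrow> i \<in> letter_of ts N F d b" if "i < N * Suc (length ts) + 1" for i
    using that
  proof (cases rule: index_cases)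
    case (1 m s)
    show ?thesis unfolding 1(3) index_in_letter(1)[OF 1(2,1)] by (rule assms(2)[OF 1(1,2)])
  next
    case (2 m)
    show ?thesis unfolding 2(2) index_in_letter(2)[OF 2(1)] by (rule assms(3)[OF 2(1)])
  next
    case 3
    show ?thesis unfolding 3 index_in_letter(3) by (rule assms(4))
  qed
  then show ?thesis using assms(1) letter_of_subset[of ts N F d b] by blast
qed

lemma index_eq_iff: "s < Suc q \<Longrightarrow> s' < Suc q \<Longrightarrow> m * Suc q + s = m' * Suc q + s' \<longleftrightarrow> m = m' \<and> s = s'" for m q :: nat
  by (metis div_mod_index(1,2))

lemma ball_imageI: "(\<And>x. x \<in> A \<Longrightarrow> P (f x)) \<Longrightarrow> \<forall>y \<in> f ` A. P y"
  by blast

text \<open>The cell constraints have disjoint sets, so H contains a tile proposition for each of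
  the N cells and, by its size, nothing else. Whatever hits a constraint is therefore the selected
  tile of some cell.\<close>

lemma hitting_imp_choice:
  assumes H: "finite H" "card H \<le> N" "\<And>F. F \<in> set Fs \<Longrightarrow> H \<inter> cset ts N F \<noteq> {}"
    and cells: "\<And>m. m < N \<Longrightarrow> one m (\<lambda>_. True) \<in> set Fs"
  shows "\<exists>f. (\<forall>m<N. f m \<in> set ts) \<and> (\<forall>F \<in> set Fs. \<exists>m<N. F m (f m))"
proof -
  let ?q = "length ts"
  have mem: "\<exists>m s. m < N \<and> s < ?q \<and> i = m * Suc ?q + s \<and> F m (ts ! s)" if "i \<in> cset ts N F" for i F
  proof -
    have "i < N * Suc ?q + 1" using that letter_of_subset by blast
    then show ?thesis
      using that by (cases rule: index_cases) (auto simp only: index_in_letter)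
  qed
  have "\<exists>s. s < ?q \<and> m * Suc ?q + s \<in> H" if m: "m < N" for m
  proof -
    obtain i where i: "i \<in> H" "i \<in> cset ts N (one m (\<lambda>_. True))" using H(3)[OF cells[OF m]] by blast
    from mem[OF i(2)] obtain m' s where "s < ?q" "i = m' * Suc ?q + s" "m' = m"
      by (auto simp: two_def split: if_split_asm)
    with i(1) show ?thesis by blast
  qed
  then obtain sel where sel: "\<And>m. m < N \<Longrightarrow> sel m < ?q \<and> m * Suc ?q + sel m \<in> H" by metis
  let ?S = "(\<lambda>m. m * Suc ?q + sel m) ` {..<N}"
  have "inj_on (\<lambda>m. m * Suc ?q + sel m) {..<N}"
  proof (rule inj_onI)
    fix m m' assume "m \<in> {..<N}" "m' \<in> {..<N}" "m * Suc ?q + sel m = m' * Suc ?q + sel m'"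
    moreover from this have "sel m < Suc ?q" "sel m' < Suc ?q" using sel by (simp_all add: less_SucI)
    ultimately show "m = m'" using index_eq_iff by blast
  qed
  then have "card ?S = N" by (simp add: card_image)
  moreover have "?S \<subseteq> H" using sel by blast
  ultimately have "?S = H" using H by (intro card_seteq) auto
  have "\<exists>m<N. F m (ts ! sel m)" if F: "F \<in> set Fs" for F
  proof -
    obtain i where i: "i \<in> H" "i \<in> cset ts N F" using H(3)[OF F] by blast
    from mem[OF i(2)] obtain m s where m: "m < N" "s < ?q" "i = m * Suc ?q + s" "F m (ts ! s)" by blast
    from i(1) \<open>?S = H\<close> obtain m' where m': "m' < N" "i = m' * Suc ?q + sel m'" by blast
    have "m = m' \<and> s = sel m'"
      using m m' sel[OF m'(1)] index_eq_iff[of s ?q "sel m'" m m'] by simp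
    with m show ?thesis by blast
  qed
  with sel show ?thesis by (intro exI[of _ "\<lambda>m. ts ! sel m"]) simp
qed

lemma choice_imp_exact_hitting:
  assumes f: "\<And>m. m < N \<Longrightarrow> f m \<in> set ts"
    and exact: "\<And>F. F \<in> set Fs \<Longrightarrow> \<exists>!m. m < N \<and> F m (f m)"
  shows "\<exists>hs. distinct hs \<and> length hs = N \<and> set hs \<inter> insert (N * Suc (length ts)) (set (dummies ts N)) = {} \<and>
    set hs \<subseteq> {..<N * Suc (length ts) + 1} \<and> (\<forall>C \<in> set (map (cset ts N) Fs). \<exists>!h. h \<in> set hs \<inter> C)"
proof -
  let ?q = "length ts"
  have "\<forall>m. \<exists>k. m < N \<longrightarrow> k < ?q \<and> ts ! k = f m"
    using f by (simp add: in_set_conv_nth)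
  then obtain s where "\<forall>m. m < N \<longrightarrow> s m < ?q \<and> ts ! s m = f m" by (rule choice[THEN exE])
  then have s: "\<And>m. m < N \<Longrightarrow> s m < ?q \<and> ts ! s m = f m" by blast
  then have sl: "\<And>m. m < N \<Longrightarrow> s m < Suc ?q" by (simp add: less_SucI)
  define h where "h m = m * Suc ?q + s m" for m
  have inj: "h m = h m' \<longleftrightarrow> m = m'" if "m < N" "m' < N" for m m'
    using index_eq_iff[OF sl[OF that(1)] sl[OF that(2)], of m m'] by (auto simp only: h_def)
  let ?hs = "map h [0..<N]"
  have "distinct ?hs" using inj by (auto simp: distinct_map inj_on_def)
  moreover have "length ?hs = N" by simp
  moreover have "set ?hs \<inter> insert (N * Suc ?q) (set (dummies ts N)) = {}"
  proof -
    have "h m \<noteq> N * Suc ?q" if "m < N" for m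
      using div_mod_index(3)[OF sl[OF that] that] by (simp only: h_def less_not_refl2)
    moreover have "h m \<noteq> m' * Suc ?q + ?q" if "m < N" "m' < N" for m m'
      using index_eq_iff[OF sl[OF that(1)] lessI, of m m'] s[OF that(1)] by (simp only: h_def) simp
    ultimately show ?thesis unfolding dummies_def set_map set_upt by fastforce
  qed
  moreover have "set ?hs \<subseteq> {..<N * Suc ?q + 1}"
  proof -
    have "h m < N * Suc ?q + 1" if "m < N" for m
      using div_mod_index(3)[OF sl[OF that] that] by (simp only: h_def trans_less_add1)
    then show ?thesis by auto
  qed
  moreover have "\<exists>!k. k \<in> set ?hs \<inter> cset ts N F" if F: "F \<in> set Fs" for F
  proof -
    have hit: "h m \<in> cset ts N F \<longleftrightarrow> F m (f m)" if "m < N" for m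
      using index_in_letter(1)[of "s m" ts m N F "\<lambda>_. False" False] s[OF that] that by (simp only: h_def)
    obtain m where m: "m < N" "F m (f m)" "\<And>m'. m' < N \<Longrightarrow> F m' (f m') \<Longrightarrow> m' = m"
      using exact[OF F] by blast
    show ?thesis
    proof (rule ex1I)
      show "h m \<in> set ?hs \<inter> cset ts N F" using m(1,2) hit[OF m(1)] by auto
      fix k assume "k \<in> set ?hs \<inter> cset ts N F"
      then obtain m' where m': "m' < N" "k = h m'" "h m' \<in> cset ts N F" by auto
      then show "k = h m" using m(3)[OF m'(1)] hit[OF m'(1)] by simp
    qed
  qed
  then have "\<forall>C \<in> set (map (cset ts N) Fs). \<exists>!k. k \<in> set ?hs \<inter> C"
    unfolding set_map by (rule ball_imageI)
  ultimately show ?thesis by (intro exI[of _ ?hs] conjI)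
qed

section \<open>Generating the instance\<close>

definition cat :: "gen list \<Rightarrow> gen" where
  "cat gs = foldr GSeq gs GNil"

definition puts :: "bool list \<Rightarrow> gen" where
  "puts bs = cat (map GPut bs)"

lemma produce_cat [simp]: "produce x (cat gs) k p \<sigma> = concat (map (\<lambda>g. produce x g k p \<sigma>) gs)"
  by (induction gs) (simp_all add: cat_def)

lemma produce_puts [simp]: "produce x (puts bs) k p \<sigma> = bs"
  by (induction bs) (simp_all add: puts_def)

lemma gen_wf_cat [simp]: "gen_wf (cat gs) k r \<longleftrightarrow> (\<forall>g \<in> set gs. gen_wf g k r)"
  by (induction gs) (simp_all add: cat_def)

lemma gen_wf_puts [simp]: "gen_wf (puts bs) k r"
  by (auto simp: puts_def)

text \<open>The body of the generator only loops and compares. Sums and products are formed before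
  it, so \<open>fits\<close> holds of the body for every V.\<close>

primrec no_let :: "gen \<Rightarrow> bool" where
  "no_let GNil \<longleftrightarrow> True"
| "no_let (GPut b) \<longleftrightarrow> True"
| "no_let (GSeq g g') \<longleftrightarrow> no_let g \<and> no_let g'"
| "no_let (GFor s g) \<longleftrightarrow> no_let g"
| "no_let (GLen g) \<longleftrightarrow> no_let g"
| "no_let (GAdd i j b g) \<longleftrightarrow> False"
| "no_let (GMul i j g) \<longleftrightarrow> False"
| "no_let (GInput g) \<longleftrightarrow> no_let g"
| "no_let (GEq i j b l g g') \<longleftrightarrow> no_let g \<and> no_let g'"
| "no_let (GBit g g') \<longleftrightarrow> no_let g \<and> no_let g'"

lemma no_let_fits: "no_let g \<Longrightarrow> fits V x g k \<sigma>"
  by (induction g arbitrary: k \<sigma>) auto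

lemma no_let_cat [simp]: "no_let (cat gs) \<longleftrightarrow> (\<forall>g \<in> set gs. no_let g)"
  by (induction gs) (simp_all add: cat_def)

lemma no_let_puts [simp]: "no_let (puts bs)"
  by (auto simp: puts_def)

definition letter_bits :: "bool \<Rightarrow> tile list \<Rightarrow> nat \<Rightarrow> constr \<Rightarrow> (nat \<Rightarrow> bool) \<Rightarrow> bool \<Rightarrow> bool list" where
  "letter_bits \<delta> ts N F d b =
    concat (map (\<lambda>m. map (\<lambda>\<tau>. F m \<tau> \<noteq> \<delta>) ts @ [d m \<noteq> \<delta>]) [0..<N]) @ [b \<noteq> \<delta>]"

text \<open>The first bit announces the word in its list and the second its prefix letter;
  \<open>[False, True]\<close> ends the prefix and announces the letter of the period, which is {p}
  or its complement.\<close>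

definition word_bits :: "bool \<Rightarrow> tile list \<Rightarrow> nat \<Rightarrow> constr \<Rightarrow> (nat \<Rightarrow> bool) \<Rightarrow> bool \<Rightarrow> bool list" where
  "word_bits \<delta> ts N F d b = [True, True] @ letter_bits \<delta> ts N F d b @ [False, True] @
    letter_bits \<delta> ts N never (\<lambda>_. False) True @ [False]"

section \<open>Codes of letters and words\<close>

lemma map_upt_mult: "map h [0..<N * q] = concat (map (\<lambda>m. map (\<lambda>s. h (m * q + s)) [0..<q]) [0..<N])"
proof (induction N)
  case (Suc N)
  have "[0..<Suc N * q] = [0..<N * q] @ map (\<lambda>s. N * q + s) [0..<q]"
    using upt_add_eq_append[of 0 "N * q" q] map_add_upt[of "N * q" q] by (simp add: add.commute)
  then show ?case using Suc by (simp add: comp_def)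
qed simp

lemma enc_letter_flip:
  fixes ts :: "tile list" and N :: nat
  defines "K \<equiv> N * Suc (length ts) + 1"
  shows "enc_letter K (flip \<delta> {..<K} (letter_of ts N F d b)) = letter_bits \<delta> ts N F d b"
proof -
  let ?q = "length ts" and ?L = "letter_of ts N F d b"
  have "enc_letter K (flip \<delta> {..<K} ?L) = map (\<lambda>i. (i \<in> ?L) \<noteq> \<delta>) [0..<K]"
    unfolding enc_letter_def flip_def by (rule map_cong) auto
  also have "\<dots> = map (\<lambda>i. (i \<in> ?L) \<noteq> \<delta>) [0..<N * Suc ?q] @ [b \<noteq> \<delta>]"
    using index_in_letter(3)[of N ts F d b] by (simp add: K_def del: mult_Suc_right)
  also have "map (\<lambda>i. (i \<in> ?L) \<noteq> \<delta>) [0..<N * Suc ?q] =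
      concat (map (\<lambda>m. map (\<lambda>\<tau>. F m \<tau> \<noteq> \<delta>) ts @ [d m \<noteq> \<delta>]) [0..<N])"
    unfolding map_upt_mult
  proof (rule arg_cong[where f = concat], rule map_cong[OF refl])
    fix m assume "m \<in> set [0..<N]"
    then have m: "m < N" by simp
    have "map (\<lambda>s. (m * Suc ?q + s \<in> ?L) \<noteq> \<delta>) [0..<?q] = map (\<lambda>s. F m (ts ! s) \<noteq> \<delta>) [0..<?q]"
      by (rule map_cong[OF refl]) (use index_in_letter(1)[OF _ m, of _ ts F d b] in \<open>simp del: mult_Suc_right\<close>)
    also have "\<dots> = map (\<lambda>\<tau>. F m \<tau> \<noteq> \<delta>) ts"
      by (rule nth_equalityI) simp_all
    finally show "map (\<lambda>s. (m * Suc ?q + s \<in> ?L) \<noteq> \<delta>) [0..<Suc ?q] = map (\<lambda>\<tau>. F m \<tau> \<noteq> \<delta>) ts @ [d m \<noteq> \<delta>]"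
      using index_in_letter(2)[OF m, of ts F d b] by (simp del: mult_Suc_right)
  qed
  finally show ?thesis unfolding letter_bits_def .
qed

lemma singleton_letter: "{N * Suc (length ts)} = letter_of ts N never (\<lambda>_. False) True"
proof (rule letter_eqI)
  fix m s assume "m < N" "s < length ts"
  then have "m * Suc (length ts) + s < N * Suc (length ts)" by (intro div_mod_index(3)) simp_all
  then show "m * Suc (length ts) + s \<in> {N * Suc (length ts)} \<longleftrightarrow> False" by simp
next
  fix m assume "m < N"
  then have "m * Suc (length ts) + length ts < N * Suc (length ts)" by (intro div_mod_index(3)) simp_all
  then show "m * Suc (length ts) + length ts \<in> {N * Suc (length ts)} \<longleftrightarrow> False" by simp
qed simp_all

lemma empty_letter: "{} = letter_of ts N never (\<lambda>_. False) False"
  by (rule letter_eqI) simp_all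

lemma insert_letter: "insert (N * Suc (length ts)) (letter_of ts N F d b) = letter_of ts N F d True"
proof -
  have "letter_of ts N F d True = letter_of ts N F d b \<union> {N * Suc (length ts)}"
    by (auto simp: letter_of_def simp del: mult_Suc_right)
  then show ?thesis by simp
qed

lemma dummy_letter:
  assumes "j < N"
  shows "{j * Suc (length ts) + length ts} = letter_of ts N never (\<lambda>m. j = m) False"
proof (rule letter_eqI)
  have j: "j * Suc (length ts) + length ts < N * Suc (length ts)"
    using assms by (intro div_mod_index(3)) simp_all
  then show "{j * Suc (length ts) + length ts} \<subseteq> {..<N * Suc (length ts) + 1}" by simp
  show "m * Suc (length ts) + s \<in> {j * Suc (length ts) + length ts} \<longleftrightarrow> False" if "s < length ts" for m s
    using index_eq_iff[of s "length ts" "length ts" m j] that by simp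
  show "m * Suc (length ts) + length ts \<in> {j * Suc (length ts) + length ts} \<longleftrightarrow> j = m" for m
    using index_eq_iff[of "length ts" "length ts" "length ts" m j] by auto
  show "N * Suc (length ts) \<in> {j * Suc (length ts) + length ts} \<longleftrightarrow> False" using j by simp
qed

definition letter_code :: "bool \<Rightarrow> tile list \<Rightarrow> nat \<Rightarrow> nat set \<Rightarrow> bool list" where
  "letter_code \<delta> ts N L = True # enc_upword (N * Suc (length ts) + 1)
    (upw \<delta> {..<N * Suc (length ts) + 1} (N * Suc (length ts)) L)"

lemma letter_code_bits: "letter_code \<delta> ts N (letter_of ts N F d b) = word_bits \<delta> ts N F d b"
  unfolding letter_code_def enc_upword_def upw_def fst_conv snd_conv singleton_letter
    enc_list.simps enc_letter_flip word_bits_def by simp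

lemma enc_list_concat: "enc_list e xs = concat (map (\<lambda>x. True # e x) xs) @ [False]"
  by (induction xs) auto

text \<open>
  The registers of the generator. Register \<open>1\<close> holds the length of the input, register \<open>t\<close> the
  number \<open>T\<close> of steps, and the next ones the dimensions of the tiling.
\<close>

definition env :: "nat \<Rightarrow> nat \<Rightarrow> nat \<Rightarrow> (nat \<Rightarrow> nat) \<Rightarrow> bool" where
  "env t n T \<sigma> \<longleftrightarrow> \<sigma> 0 = 0 \<and> \<sigma> 1 = n \<and> \<sigma> (t + 1) = T + T \<and> \<sigma> (t + 2) = offset T \<and>
    \<sigma> (t + 3) = n + (T + T) \<and> \<sigma> (t + 4) = border n T \<and> \<sigma> (t + 5) = offset T + n \<and>
    \<sigma> (t + 6) = Suc (border n T) \<and> \<sigma> (t + 7) = Suc (border n T) * T \<and>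
    \<sigma> (t + 8) = Suc (border n T) * T + border n T \<and> \<sigma> (t + 9) = ncells n T"

lemma env_upd: "env t n T \<sigma> \<Longrightarrow> t + 10 \<le> r \<Longrightarrow> env t n T (\<sigma>(r := v))"
  unfolding env_def by auto

lemma envD:
  assumes "env t n T \<sigma>"
  shows "\<sigma> 0 = 0" "\<sigma> (t + 1) = T + T" "\<sigma> (t + 2) = offset T"
    "\<sigma> (t + 3) = n + (T + T)" "\<sigma> (t + 4) = border n T" "\<sigma> (t + 5) = offset T + n"
    "\<sigma> (t + 6) = Suc (border n T)" "\<sigma> (t + 7) = Suc (border n T) * T"
    "\<sigma> (t + 8) = Suc (border n T) * T + border n T" "\<sigma> (t + 9) = ncells n T"
  using assms by (simp_all add: env_def del: mult_Suc)

text \<open>The tiles are independent of the input, so the bits of a cell form a constant string;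
  only the choice between such strings is computed.\<close>

definition block :: "bool \<Rightarrow> tile list \<Rightarrow> (tile \<Rightarrow> bool) \<Rightarrow> bool \<Rightarrow> gen" where
  "block \<delta> ts P d = puts (map (\<lambda>\<tau>. P \<tau> \<noteq> \<delta>) ts @ [d \<noteq> \<delta>])"

definition word_gen :: "bool \<Rightarrow> tile list \<Rightarrow> nat \<Rightarrow> gen \<Rightarrow> bool \<Rightarrow> gen" where
  "word_gen \<delta> ts t c b = cat [puts [True, True], c, puts [b \<noteq> \<delta>], puts [False, True],
    GFor (t + 9) (block \<delta> ts (\<lambda>_. False) False), puts [True \<noteq> \<delta>], puts [False]]"

lemma produce_word_gen:
  assumes "env t n T \<sigma>"
    and "produce x c k p \<sigma> = concat (map (\<lambda>m. map (\<lambda>\<tau>. F m \<tau> \<noteq> \<delta>) ts @ [d m \<noteq> \<delta>]) [0..<ncells n T])"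
  shows "produce x (word_gen \<delta> ts t c b) k p \<sigma> = word_bits \<delta> ts (ncells n T) F d b"
  using assms(2) envD(10)[OF assms(1)]
  by (simp add: word_gen_def word_bits_def letter_bits_def block_def)

text \<open>\<open>(i, j, c, P)\<close> is the cell whose number is the sum of the registers i and j
  and the carry c, with a predicate for its tile. Such sums are what \<open>GEq\<close>
  compares.\<close>

type_synonym place = "nat \<times> nat \<times> bool \<times> (tile \<Rightarrow> bool)"

fun pair_gen :: "bool \<Rightarrow> tile list \<Rightarrow> nat \<Rightarrow> bool \<Rightarrow> nat \<Rightarrow> place \<Rightarrow> place \<Rightarrow> gen" where
  "pair_gen \<delta> ts t b k (i, j, c, P) (i', j', c', Q) = word_gen \<delta> ts t
    (GFor (t + 9) (GEq i j c k (block \<delta> ts P False)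
      (GEq i' j' c' k (block \<delta> ts Q False) (block \<delta> ts (\<lambda>_. False) False)))) b"

lemma produce_pair_gen:
  assumes env: "env t n T \<sigma>" and "i < k" "j < k" "i' < k" "j' < k"
  shows "produce x (pair_gen \<delta> ts t b k (i, j, c, P) (i', j', c', Q)) k p \<sigma> =
    word_bits \<delta> ts (ncells n T) (two (\<sigma> i + \<sigma> j + of_bool c) P (\<sigma> i' + \<sigma> j' + of_bool c') Q) (\<lambda>_. False) b"
  unfolding pair_gen.simps
proof (rule produce_word_gen[OF env])
  show "produce x (GFor (t + 9) (GEq i j c k (block \<delta> ts P False)
      (GEq i' j' c' k (block \<delta> ts Q False) (block \<delta> ts (\<lambda>_. False) False)))) k p \<sigma> =
    concat (map (\<lambda>m. map (\<lambda>\<tau>. two (\<sigma> i + \<sigma> j + of_bool c) P (\<sigma> i' + \<sigma> j' + of_bool c') Q m \<tau> \<noteq> \<delta>) ts @ [False \<noteq> \<delta>])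
      [0..<ncells n T])"
    unfolding produce.simps envD(10)[OF env]
    by (rule arg_cong[where f = concat], rule map_cong[OF refl])
      (use assms(2-5) in \<open>auto simp: two_def block_def\<close>)
qed

text \<open>One entry for each list in \<open>match_constrs\<close> and \<open>init_constrs\<close>,
  then the final constraint. Within a looping entry, register k counts constraints and register
  \<open>Suc k\<close> the cells of the current word.\<close>

definition constr_gens :: "bool \<Rightarrow> tile list \<Rightarrow> hcol list \<Rightarrow> vcol list \<Rightarrow> nat \<Rightarrow> nat \<Rightarrow> nat \<Rightarrow> bool \<Rightarrow> gen list" where
  "constr_gens \<delta> ts hs vs q0 qa t b =
    (let k = t + 10;
         pair = pair_gen \<delta> ts t b;
         single = (\<lambda>k pl. pair k pl pl)
     in [GFor (t + 9) (single (Suc k) (k, 0, False, \<lambda>_. True)),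
         GFor (t + 8) (cat (map (\<lambda>c. pair (Suc k) (k, 0, False, \<lambda>\<tau>. rgt \<tau> = c) (k, 0, True, \<lambda>\<tau>. lft \<tau> \<noteq> c)) hs)),
         GFor (t + 7) (cat (map (\<lambda>c. pair (Suc k) (k, 0, False, \<lambda>\<tau>. upper \<tau> = c)
           (k, t + 6, False, \<lambda>\<tau>. lower \<tau> \<noteq> c)) vs)),
         single k (0, 0, False, has_symbol None),
         GFor (t + 1) (single (Suc k) (k, 0, True, has_symbol (Some 0))),
         GInput (GBit (single (Suc k) (t + 2, k, False, has_symbol (Some 2)))
           (single (Suc k) (t + 2, k, False, has_symbol (Some 1)))),
         GFor (t + 1) (single (Suc k) (t + 5, k, False, has_symbol (Some 0))),
         single k (t + 4, 0, False, has_symbol None),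
         single k (t + 2, 0, False, has_head (Some q0)),
         GFor (t + 2) (single (Suc k) (k, 0, False, has_head None)),
         GFor (t + 3) (single (Suc k) (t + 2, k, True, has_head None)),
         word_gen \<delta> ts t (cat [GFor (t + 7) (block \<delta> ts (\<lambda>_. False) False),
           GFor (t + 6) (block \<delta> ts (\<lambda>\<tau>. snd (upper \<tau>) = Some qa) False)]) b])"

lemma concat_map_concat: "concat (map f (concat xss)) = concat (map (\<lambda>xs. concat (map f xs)) xss)"
  by (induction xss) auto

lemma produce_constr_gens:
  fixes x :: "bool list" and T :: nat
  defines "n \<equiv> length x"
  assumes env: "env t n T \<sigma>"
  shows "concat (map (\<lambda>g. produce x g (t + 10) p \<sigma>)
      (constr_gens \<delta> ts hs vs (ntm_start M) (ntm_accept M) t b)) =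
    concat (map (\<lambda>F. word_bits \<delta> ts (ncells n T) F (\<lambda>_. False) b) (constrs M hs vs x T))"
proof -
  \<comment> \<open>An opaque depth keeps the simplifier from rearranging the register
    numbers.\<close>
  obtain k where k: "t + 10 = k" by simp
  let ?wb = "\<lambda>F. word_bits \<delta> ts (ncells n T) F (\<lambda>_. False) b"
  have e: "env t n T (\<sigma>(k := v))" for v by (rule env_upd[OF env]) (simp add: k)
  note D = envD[OF env]
  note D' = D(2,3)[unfolded add_2_eq_Suc' Suc_eq_plus1[symmetric]]
  note E = envD[OF e]
  note E' = E(2,3)[unfolded add_2_eq_Suc' Suc_eq_plus1[symmetric]]
  have lt: "0 < k" "Suc t < k" "Suc (Suc t) < k" "t + 4 < k" "t + 5 < k" "t + 6 < k"
    using k by simp_all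
  have fin: "produce x (word_gen \<delta> ts t (cat [GFor (t + 7) (block \<delta> ts (\<lambda>_. False) False),
      GFor (t + 6) (block \<delta> ts (\<lambda>\<tau>. snd (upper \<tau>) = Some (ntm_accept M)) False)]) b) k p \<sigma> =
      ?wb (final_constr (ntm_accept M) n T)"
  proof (rule produce_word_gen[OF env])
    let ?W = "Suc (border n T)"
    let ?h = "\<lambda>m. map (\<lambda>\<tau>. final_constr (ntm_accept M) n T m \<tau> \<noteq> \<delta>) ts @ [False \<noteq> \<delta>]"
    \<comment> \<open>The final constraint is false on the first T rows and depends on the tile
      alone in the last row.\<close>
    have split: "[0..<ncells n T] = [0..<?W * T] @ map (\<lambda>j. ?W * T + j) [0..<?W]"
      unfolding ncells_def using upt_add_eq_append[of 0 "?W * T" ?W] map_add_upt[of "?W * T" ?W]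
      by (simp add: add.commute del: mult_Suc)
    have 1: "map ?h [0..<?W * T] = map (\<lambda>_. map (\<lambda>\<tau>. False \<noteq> \<delta>) ts @ [False \<noteq> \<delta>]) [0..<?W * T]"
      by (rule map_cong[OF refl]) (simp add: final_constr_def)
    have 2: "map (\<lambda>j. ?h (?W * T + j)) [0..<?W] =
        map (\<lambda>_. map (\<lambda>\<tau>. (snd (upper \<tau>) = Some (ntm_accept M)) \<noteq> \<delta>) ts @ [False \<noteq> \<delta>]) [0..<?W]"
      by (rule map_cong[OF refl]) (simp add: final_constr_def)
    show "produce x (cat [GFor (t + 7) (block \<delta> ts (\<lambda>_. False) False),
      GFor (t + 6) (block \<delta> ts (\<lambda>\<tau>. snd (upper \<tau>) = Some (ntm_accept M)) False)]) k p \<sigma> =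
      concat (map ?h [0..<ncells n T])"
      unfolding split map_append map_map comp_def 1 2
      by (simp only: produce_cat list.map produce.simps concat.simps D block_def produce_puts
          concat_append append_Nil2)
  qed
  have s: "produce x (pair_gen \<delta> ts t b k (i, j, c, P) (i', j', c', Q)) k p \<sigma> =
      ?wb (two (\<sigma> i + \<sigma> j + of_bool c) P (\<sigma> i' + \<sigma> j' + of_bool c') Q)"
    if "i < k" "j < k" "i' < k" "j' < k" for i j c P i' j' c' Q
    by (rule produce_pair_gen[OF env that])
  have l: "produce x (pair_gen \<delta> ts t b (Suc k) (i, j, c, P) (i', j', c', Q)) (Suc k) p (\<sigma>(k := m)) =
      ?wb (two ((\<sigma>(k := m)) i + (\<sigma>(k := m)) j + of_bool c) P ((\<sigma>(k := m)) i' + (\<sigma>(k := m)) j' + of_bool c') Q)"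
    if "i < Suc k" "j < Suc k" "i' < Suc k" "j' < Suc k" for i j c P i' j' c' Q m p
    by (rule produce_pair_gen[OF e that])
  have bit: "(if x ! i then ?wb (one m (has_symbol (Some 2))) else ?wb (one m (has_symbol (Some 1)))) =
      ?wb (one m (has_symbol (Some (bit_symbol (x ! i)))))" for i m
    by (simp add: bit_symbol_def)
  show ?thesis
    unfolding constr_gens_def Let_def constrs_def match_constrs_def init_constrs_def n_def[symmetric] k
    by (simp add: l s fin D D' E E' lt less_SucI bit bit[unfolded One_nat_def] fun_upd_same concat_map_concat comp_def n_def[symmetric]
        cong: if_cong del: pair_gen.simps mult_Suc upt_Suc fun_upd_apply)
qed

definition plain_gen :: "bool \<Rightarrow> tile list \<Rightarrow> nat \<Rightarrow> bool \<Rightarrow> gen" where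
  "plain_gen \<delta> ts t b = word_gen \<delta> ts t (GFor (t + 9) (block \<delta> ts (\<lambda>_. False) False)) b"

definition dummy_gen :: "bool \<Rightarrow> tile list \<Rightarrow> nat \<Rightarrow> bool \<Rightarrow> gen" where
  "dummy_gen \<delta> ts t b = (let k = t + 10 in
    GFor (t + 9) (word_gen \<delta> ts t (GFor (t + 9)
      (GEq k 0 False (Suc k) (block \<delta> ts (\<lambda>_. False) True) (block \<delta> ts (\<lambda>_. False) False))) b))"

lemma produce_plain_gen:
  assumes "env t n T \<sigma>"
  shows "produce x (plain_gen \<delta> ts t b) k p \<sigma> = word_bits \<delta> ts (ncells n T) never (\<lambda>_. False) b"
  unfolding plain_gen_def
  by (rule produce_word_gen[OF assms]) (simp add: envD(10)[OF assms] block_def)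

lemma produce_dummy_gen:
  assumes env: "env t n T \<sigma>"
  shows "produce x (dummy_gen \<delta> ts t b) (t + 10) p \<sigma> =
    concat (map (\<lambda>j. word_bits \<delta> ts (ncells n T) never (\<lambda>m. j = m) b) [0..<ncells n T])"
proof -
  obtain k where k: "t + 10 = k" by simp
  have e: "env t n T (\<sigma>(k := v))" for v by (rule env_upd[OF env]) (simp add: k)
  have "produce x (GFor (t + 9) (GEq k 0 False (Suc k) (block \<delta> ts (\<lambda>_. False) True) (block \<delta> ts (\<lambda>_. False) False)))
      (Suc k) p (\<sigma>(k := j)) =
      concat (map (\<lambda>m. map (\<lambda>\<tau>. False \<noteq> \<delta>) ts @ [(j = m) \<noteq> \<delta>]) [0..<ncells n T])" for j
    unfolding produce.simps envD(10)[OF e]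
    by (rule arg_cong[where f = concat], rule map_cong[OF refl])
      (use envD(1)[OF env] k in \<open>auto simp: block_def\<close>)
  then have "produce x (word_gen \<delta> ts t (GFor (t + 9)
      (GEq k 0 False (Suc k) (block \<delta> ts (\<lambda>_. False) True) (block \<delta> ts (\<lambda>_. False) False))) b) (Suc k) p (\<sigma>(k := j)) =
      word_bits \<delta> ts (ncells n T) never (\<lambda>m. j = m) b" for j
    by (rule produce_word_gen[OF e])
  then show ?thesis
    unfolding dummy_gen_def Let_def k produce.simps envD(10)[OF env] by simp
qed

definition pos_gens :: "kind \<Rightarrow> bool \<Rightarrow> tile list \<Rightarrow> hcol list \<Rightarrow> vcol list \<Rightarrow> nat \<Rightarrow> nat \<Rightarrow> nat \<Rightarrow> gen list" where
  "pos_gens \<kappa> \<delta> ts hs vs q0 qa t =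
    plain_gen \<delta> ts t True # (if \<kappa> = Diff then [] else [dummy_gen \<delta> ts t False]) @
    (if \<kappa> = Disj then constr_gens \<delta> ts hs vs q0 qa t False else [])"

definition neg_gens :: "kind \<Rightarrow> bool \<Rightarrow> tile list \<Rightarrow> hcol list \<Rightarrow> vcol list \<Rightarrow> nat \<Rightarrow> nat \<Rightarrow> nat \<Rightarrow> gen list" where
  "neg_gens \<kappa> \<delta> ts hs vs q0 qa t =
    plain_gen \<delta> ts t False # (if \<kappa> = Diff then [dummy_gen \<delta> ts t True] else []) @
    (if \<kappa> = Disj then [] else constr_gens \<delta> ts hs vs q0 qa t True)"

lemma produce_sign_gens:
  fixes x :: "bool list" and T :: nat
  defines "n \<equiv> length x"
  defines "N \<equiv> ncells n T"
  assumes env: "env t n T \<sigma>"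
  shows "concat (map (\<lambda>g. produce x g (t + 10) p \<sigma>) (pos_gens \<kappa> \<delta> ts hs vs (ntm_start M) (ntm_accept M) t)) =
      concat (map (letter_code \<delta> ts N) (pos_letters \<kappa> (N * Suc (length ts)) (dummies ts N)
        (map (cset ts N) (constrs M hs vs x T))))" (is ?pos)
    "concat (map (\<lambda>g. produce x g (t + 10) p \<sigma>) (neg_gens \<kappa> \<delta> ts hs vs (ntm_start M) (ntm_accept M) t)) =
      concat (map (letter_code \<delta> ts N) (neg_letters \<kappa> (N * Suc (length ts)) (dummies ts N)
        (map (cset ts N) (constrs M hs vs x T))))" (is ?neg)
proof -
  let ?q = "length ts"
  note plain = produce_plain_gen[OF env, folded N_def]
  note dummy = produce_dummy_gen[OF env, folded N_def]
  note constr = produce_constr_gens[of t x T \<sigma>, folded n_def, OF env, folded N_def]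
  have d1: "map (\<lambda>j. letter_code \<delta> ts N {j * Suc ?q + ?q}) [0..<N] =
      map (\<lambda>j. word_bits \<delta> ts N never (\<lambda>m. j = m) False) [0..<N]"
    by (rule map_cong[OF refl]) (simp add: dummy_letter letter_code_bits del: mult_Suc_right)
  have d2: "map (\<lambda>j. letter_code \<delta> ts N {N * Suc ?q, j * Suc ?q + ?q}) [0..<N] =
      map (\<lambda>j. word_bits \<delta> ts N never (\<lambda>m. j = m) True) [0..<N]"
    by (rule map_cong[OF refl]) (simp add: dummy_letter insert_letter letter_code_bits del: mult_Suc_right)
  have e: "letter_code \<delta> ts N {} = word_bits \<delta> ts N never (\<lambda>_. False) False"
    by (simp only: empty_letter[of ts N] letter_code_bits)
  show ?pos
    unfolding pos_gens_def pos_letters_def dummies_def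
    by (cases \<kappa>) (simp_all add: plain dummy constr d1 comp_def singleton_letter letter_code_bits del: mult_Suc_right)
  show ?neg
    unfolding neg_gens_def neg_letters_def dummies_def
    by (cases \<kappa>) (simp_all add: plain dummy constr d2 comp_def e insert_letter letter_code_bits del: mult_Suc_right)
qed

text \<open>The order of \<open>enc_instance\<close>. A loop over the N cells writes N (q + 1) and
  later 4 N in unary, with q the number of tiles; \<open>[True, False]\<close> adds the one and the
  end mark.\<close>

definition body_gen :: "kind \<Rightarrow> bool \<Rightarrow> tile list \<Rightarrow> hcol list \<Rightarrow> vcol list \<Rightarrow> nat \<Rightarrow> nat \<Rightarrow> nat \<Rightarrow> gen" where
  "body_gen \<kappa> \<delta> ts hs vs q0 qa t =
    cat ([GFor (t + 9) (puts (replicate (Suc (length ts)) True)), puts [True, False]] @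
      (if \<delta> then neg_gens else pos_gens) \<kappa> \<delta> ts hs vs q0 qa t @ [puts [False]] @
      (if \<delta> then pos_gens else neg_gens) \<kappa> \<delta> ts hs vs q0 qa t @ [puts [False]] @
      [GFor (t + 9) (puts (replicate 4 True)), puts [True, False]])"

lemma concat_replicate: "concat (map (\<lambda>_. replicate q b) [0..<N]) = replicate (N * q) b"
  by (induction N) (simp_all add: replicate_add[symmetric] add.commute)

lemma produce_body_gen:
  fixes x :: "bool list" and T :: nat and ts :: "tile list" and M :: ntm
    and hs :: "hcol list" and vs :: "vcol list"
  defines "n \<equiv> length x"
  defines "N \<equiv> ncells n T"
  assumes env: "env t n T \<sigma>"
  defines "K \<equiv> N * Suc (length ts) + 1"
  defines "Cs \<equiv> map (cset ts N) (constrs M hs vs x T)"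
  shows "produce x (body_gen \<kappa> \<delta> ts hs vs (ntm_start M) (ntm_accept M) t) (t + 10) p \<sigma> =
    enc_instance K
      (map (upw \<delta> {..<K} (N * Suc (length ts))) (fst_letters \<delta> \<kappa> (N * Suc (length ts)) (dummies ts N) Cs))
      (map (upw \<delta> {..<K} (N * Suc (length ts))) (snd_letters \<delta> \<kappa> (N * Suc (length ts)) (dummies ts N) Cs))
      (4 * N + 1)"
proof -
  have code: "(\<lambda>L. True # enc_upword K (upw \<delta> {..<K} (N * Suc (length ts)) L)) = letter_code \<delta> ts N"
    by (simp add: fun_eq_iff letter_code_def K_def del: mult_Suc_right)
  have unary: "replicate (m * q + 1) True @ [False] = replicate (m * q) True @ [True, False]" for m q
    by (simp add: replicate_append_same flip: append_Cons)
  note gens = produce_sign_gens[of t x T \<sigma>, folded n_def, OF env, folded N_def, of p \<kappa> _ ts hs vs M, folded Cs_def]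
  have reg: "\<sigma> (t + 9) = N" using envD(10)[OF env] by (simp add: N_def)
  have four: "4 * N + 1 = N * 4 + 1" by simp
  show ?thesis
    unfolding body_gen_def enc_instance_def enc_nat_def enc_list_concat map_map comp_def code four
    unfolding K_def unary fst_letters_def snd_letters_def
    by (cases \<delta>) (simp_all only: if_True if_False produce_cat map_append list.map concat_append
        concat.simps gens produce.simps produce_puts reg concat_replicate append_assoc append_Nil append_Nil2)
qed

section \<open>Computing the dimensions of the window\<close>

definition setup_gen :: "nat \<Rightarrow> gen \<Rightarrow> gen" where
  "setup_gen t g = GAdd t t False (GAdd (t + 1) 0 True (GAdd 1 (t + 1) False (GAdd (t + 2) (t + 3) False
    (GAdd (t + 2) 1 False (GAdd (t + 4) 0 True (GMul (t + 6) t (GAdd (t + 7) (t + 4) False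
    (GAdd (t + 8) 0 True g))))))))"

text \<open>Every intermediate value is at most \<open>ncells n T\<close>, so a single bound on V is
  enough.\<close>

lemma setup_gen:
  assumes \<sigma>: "\<sigma> 0 = 0" "\<sigma> 1 = n" "\<sigma> t = T" and t: "2 \<le> t"
  shows "\<exists>\<sigma>'. env t n T \<sigma>' \<and> produce x (setup_gen t g) (t + 1) p \<sigma> = produce x g (t + 10) p \<sigma>' \<and>
    (ncells n T \<le> V \<longrightarrow> fits V x g (t + 10) \<sigma>' \<longrightarrow> fits V x (setup_gen t g) (t + 1) \<sigma>)"
proof -
  have t': "t \<noteq> 0" "t \<noteq> Suc 0" using t by auto
  let ?B = "border n T"
  define \<sigma>' where "\<sigma>' = \<sigma>(t + 1 := T + T, t + 2 := offset T, t + 3 := n + (T + T), t + 4 := ?B,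
    t + 5 := offset T + n, t + 6 := Suc ?B, t + 7 := Suc ?B * T, t + 8 := Suc ?B * T + ?B, t + 9 := ncells n T)"
  have env: "env t n T \<sigma>'"
    using \<sigma> t' by (simp add: env_def \<sigma>'_def del: mult_Suc)
  have N: "ncells n T = Suc (Suc ?B * T + ?B)" by (simp add: ncells_def)
  have depth: "Suc (t + 1) = t + 2" "Suc (t + 2) = t + 3" "Suc (t + 3) = t + 4" "Suc (t + 4) = t + 5"
    "Suc (t + 5) = t + 6" "Suc (t + 6) = t + 7" "Suc (t + 7) = t + 8" "Suc (t + 8) = t + 9" "Suc (t + 9) = t + 10"
    by simp_all
  have B: "offset T + (n + (T + T)) = ?B" "Suc (T + T) = offset T" by (simp_all add: border_def offset_def)
  have eq: "produce x (setup_gen t g) (t + 1) p \<sigma> = produce x g (t + 10) p \<sigma>'"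
    unfolding setup_gen_def produce.simps depth
    using \<sigma> t' B N by (simp add: \<sigma>'_def del: mult_Suc)
  have "fits V x (setup_gen t g) (t + 1) \<sigma>" if V: "ncells n T \<le> V" and g: "fits V x g (t + 10) \<sigma>'"
  proof -
    have "T + T \<le> V" "offset T \<le> V" "n + (T + T) \<le> V" "?B \<le> V" "offset T + n \<le> V" "Suc ?B \<le> V"
      "Suc ?B * T \<le> V" "Suc ?B * T + ?B \<le> V"
      using V by (simp_all add: ncells_def border_def offset_def)
    then show ?thesis
      unfolding setup_gen_def fits.simps depth
      using \<sigma> t' B N V g by (simp add: \<sigma>'_def del: mult_Suc)
  qed
  with env eq show ?thesis by blast
qed

primrec pow_gen :: "nat \<Rightarrow> nat \<Rightarrow> gen \<Rightarrow> gen" where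
  "pow_gen 0 k g = g"
| "pow_gen (Suc e) k g = GMul k 3 (pow_gen e (Suc k) g)"

text \<open>The base in register 3 is positive, so the powers do not decrease and the last product
  bounds all the earlier ones.\<close>

lemma pow_gen:
  assumes "3 < k" "0 < \<sigma> 3"
  shows "\<exists>\<sigma>'. \<sigma>' (k + e) = \<sigma> k * \<sigma> 3 ^ e \<and> (\<forall>r<4. \<sigma>' r = \<sigma> r) \<and>
    produce x (pow_gen e k g) (Suc k) p \<sigma> = produce x g (Suc (k + e)) p \<sigma>' \<and>
    (\<sigma> k * \<sigma> 3 ^ e \<le> V \<longrightarrow> fits V x g (Suc (k + e)) \<sigma>' \<longrightarrow> fits V x (pow_gen e k g) (Suc k) \<sigma>)"
  using assms
proof (induction e arbitrary: k \<sigma>)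
  case 0
  then show ?case by auto
next
  case (Suc e)
  let ?\<sigma> = "\<sigma>(Suc k := \<sigma> k * \<sigma> 3)"
  have s: "?\<sigma> (Suc k) = \<sigma> k * \<sigma> 3" "?\<sigma> 3 = \<sigma> 3" "\<forall>r<4. ?\<sigma> r = \<sigma> r" using Suc.prems by auto
  have "3 < Suc k" using Suc.prems(1) by simp
  from Suc.IH[of "Suc k" ?\<sigma>, unfolded s(1,2), OF this Suc.prems(2)]
  obtain \<sigma>' where \<sigma>': "\<sigma>' (Suc k + e) = \<sigma> k * \<sigma> 3 * \<sigma> 3 ^ e" "\<forall>r<4. \<sigma>' r = ?\<sigma> r"
    "produce x (pow_gen e (Suc k) g) (Suc (Suc k)) p ?\<sigma> = produce x g (Suc (Suc k + e)) p \<sigma>'"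
    "\<sigma> k * \<sigma> 3 * \<sigma> 3 ^ e \<le> V \<longrightarrow> fits V x g (Suc (Suc k + e)) \<sigma>' \<longrightarrow> fits V x (pow_gen e (Suc k) g) (Suc (Suc k)) ?\<sigma>"
    by blast
  have "1 \<le> \<sigma> 3 ^ e" using Suc.prems(2) by (simp add: Suc_leI)
  then have le: "\<sigma> k * \<sigma> 3 \<le> \<sigma> k * (\<sigma> 3 * \<sigma> 3 ^ e)" by simp
  with \<sigma>' s show ?case
    by (intro exI[of _ \<sigma>']) (simp add: mult.assoc order_trans[OF le])
qed

text \<open>Registers 1 to 4 receive n, n + 1, n + 2 and 1; multiplying e times by register 3 leaves
  T = (n + 2) ^ e in register 4 + e.\<close>

definition main_gen :: "nat \<Rightarrow> gen \<Rightarrow> gen" where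
  "main_gen e g = GLen (GAdd 1 0 True (GAdd 2 0 True (GAdd 0 0 True (pow_gen e 4 (setup_gen (4 + e) g)))))"

lemma main_gen:
  fixes x :: "bool list" and e :: nat
  defines "n \<equiv> length x"
  defines "T \<equiv> (n + 2) ^ e"
  shows "\<exists>\<sigma>. env (4 + e) n T \<sigma> \<and> produce x (main_gen e g) 1 0 (\<lambda>_. 0) = produce x g (4 + e + 10) 0 \<sigma> \<and>
    (n + 2 \<le> V \<longrightarrow> ncells n T \<le> V \<longrightarrow> fits V x g (4 + e + 10) \<sigma> \<longrightarrow> fits V x (main_gen e g) 1 (\<lambda>_. 0))"
proof -
  let ?\<sigma> = "(\<lambda>_. 0)(1 := n, 2 := n + 1, 3 := n + 2, 4 := 1) :: nat \<Rightarrow> nat"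
  let ?g = "setup_gen (4 + e) g"
  obtain \<sigma> where \<sigma>: "\<sigma> (4 + e) = T" "\<forall>r<4. \<sigma> r = ?\<sigma> r"
    "produce x (pow_gen e 4 ?g) (Suc 4) 0 ?\<sigma> = produce x ?g (Suc (4 + e)) 0 \<sigma>"
    "T \<le> V \<Longrightarrow> fits V x ?g (Suc (4 + e)) \<sigma> \<Longrightarrow> fits V x (pow_gen e 4 ?g) (Suc 4) ?\<sigma>"
    using pow_gen[of 4 ?\<sigma> e x ?g 0 V] by (auto simp: T_def)
  have "\<sigma> 0 = 0" "\<sigma> 1 = n" using \<sigma>(2) by simp_all
  then obtain \<sigma>' where \<sigma>': "env (4 + e) n T \<sigma>'"
    "produce x ?g (4 + e + 1) 0 \<sigma> = produce x g (4 + e + 10) 0 \<sigma>'"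
    "ncells n T \<le> V \<Longrightarrow> fits V x g (4 + e + 10) \<sigma>' \<Longrightarrow> fits V x ?g (4 + e + 1) \<sigma>"
    using setup_gen[of \<sigma> n "4 + e" T x g 0 V] \<sigma>(1) by auto
  have upd: "(\<lambda>_. 0 :: nat)(1 := n, 2 := n + 1, 3 := n + 2, 4 := 1) = ?\<sigma>" by simp
  have p: "produce x (main_gen e g) 1 0 (\<lambda>_. 0) = produce x (pow_gen e 4 ?g) (Suc 4) 0 ?\<sigma>"
    by (simp add: main_gen_def n_def eval_nat_numeral)
  have f: "fits V x (main_gen e g) 1 (\<lambda>_. 0)" if "n + 2 \<le> V" "fits V x (pow_gen e 4 ?g) (Suc 4) ?\<sigma>"
    using that by (simp add: main_gen_def n_def eval_nat_numeral)
  have "T \<le> ncells n T" by (simp add: ncells_def)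
  then show ?thesis
    using \<sigma>' \<sigma>(3,4) p f by (intro exI[of _ \<sigma>']) (auto simp: add.commute)
qed

section \<open>Well-formedness and size of the generator\<close>

lemma gen_wf_word_gen: "gen_wf (word_gen \<delta> ts t c b) k r \<longleftrightarrow> gen_wf c k r \<and> t + 9 < k"
  by (auto simp: word_gen_def block_def)

lemma gen_wf_pair_gen:
  "gen_wf (pair_gen \<delta> ts t b l (i, j, c, P) (i', j', c', Q)) k r \<longleftrightarrow>
    t + 9 < k \<and> i < Suc k \<and> j < Suc k \<and> l < Suc k \<and> i' < Suc k \<and> j' < Suc k"
  by (auto simp: gen_wf_word_gen block_def)

lemma gen_wf_body_gen: "gen_wf (body_gen \<kappa> \<delta> ts hs vs q0 qa t) (t + 10) False"
  by (auto simp: body_gen_def pos_gens_def neg_gens_def plain_gen_def dummy_gen_def constr_gens_def Let_def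
      gen_wf_word_gen gen_wf_pair_gen block_def simp del: pair_gen.simps split: if_splits)

lemma no_let_body_gen: "no_let (body_gen \<kappa> \<delta> ts hs vs q0 qa t)"
  by (auto simp: body_gen_def pos_gens_def neg_gens_def plain_gen_def dummy_gen_def constr_gens_def Let_def
      word_gen_def block_def split: if_splits)

lemma gen_wf_pow_gen: "3 < k \<Longrightarrow> gen_wf g (Suc (k + e)) r \<Longrightarrow> gen_wf (pow_gen e k g) (Suc k) r"
  by (induction e arbitrary: k) auto

lemma gen_wf_main_gen: "gen_wf g (4 + e + 10) False \<Longrightarrow> gen_wf (main_gen e g) 1 False"
  unfolding main_gen_def
  using gen_wf_pow_gen[of 4 "setup_gen (4 + e) g" e False]
  by (simp add: setup_gen_def eval_nat_numeral)

text \<open>The constant 16 = 2 ^ 4 is chosen so that a factor (n + 2) ^ 4 absorbs it.\<close>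

lemma ncells_bound:
  assumes "n + 2 \<le> T"
  shows "ncells n T \<le> 16 * T ^ 2"
proof -
  have "Suc (border n T) \<le> 6 * T" using assms by (simp add: border_def offset_def)
  then have "Suc (border n T) * Suc T \<le> (6 * T) * (2 * T)" using assms by (intro mult_le_mono) simp_all
  then show ?thesis unfolding ncells_eq by (simp add: power2_eq_square)
qed

section \<open>The reduction\<close>

theorem theorem2:
  fixes Ut :: "unop set" and Bt Bl :: "binop set"
  assumes "Bt \<subseteq> Bin_tp" and "Bl \<subseteq> Bin_lg" and "Bl \<union> Bt \<noteq> {}" and "Ut \<subseteq> Unops"
  shows "NP_hard (LTL_Learn Ut Bt Bl \<infinity>)"
  unfolding NP_hard_def
proof
  fix A assume "A \<in> NP"
  then obtain M where M: "finite (ntm_trans M)" "ntm_poly_time M" and A: "A = {x. ntm_accepts M x}"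
    unfolding NP_def by blast
  obtain a d where time: "\<And>x t c. (ntm_step M ^^ t) (ntm_init M x) c \<Longrightarrow> t \<le> a * length x ^ d + a"
    using M(2) unfolding ntm_poly_time_def by blast
  obtain ts where ts: "set ts = tiles M" using finite_list[OF finite_tiles[OF M(1)]] by blast
  obtain hs where hs: "set hs = hcols M" using finite_list[OF finite_colours(2)[OF M(1)]] by blast
  obtain vs where vs: "set vs = vcols M" using finite_list[OF finite_colours(1)[OF M(1)]] by blast
  obtain g where g: "g \<in> Bt \<union> Bl" using assms(3) by blast
  define \<delta> \<kappa> where "\<delta> = op_dual g" and "\<kappa> = op_kind g"
  \<comment> \<open>Chosen for a (n ^ d + 1) \<le> (n + 2) ^ a (n + 2) ^ (d + 1); as e is at least
    1, it also gives n + 2 \<le> T.\<close>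
  define e where "e = d + a + 1"
  define T where "T x = (length x + 2) ^ e" for x :: "bool list"
  define N where "N x = ncells (length x) (T x)" for x
  define body where "body = body_gen \<kappa> \<delta> ts hs vs (ntm_start M) (ntm_accept M) (4 + e)"
  define f where "f x = produce x (main_gen e body) 1 0 (\<lambda>_. 0)" for x
  have T_ge: "length x + 2 \<le> T x" for x
    using self_le_power[of "length x + 2" e] by (simp add: T_def e_def)
  have steps: "t \<le> T x" if "(ntm_step M ^^ t) (ntm_init M x) c" for t x c
  proof -
    let ?n = "length x"
    have "a \<le> (?n + 2) ^ a" using less_exp[of a] power_mono[of 2 "?n + 2" a] by linarith
    moreover have "?n ^ d + 1 \<le> (?n + 2) ^ Suc d"
    proof -
      have "?n ^ d \<le> (?n + 2) ^ d" "1 \<le> (?n + 2) ^ d" by (simp_all add: power_mono)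
      moreover have "(?n + 2) ^ Suc d = 2 * (?n + 2) ^ d + ?n * (?n + 2) ^ d" by (simp add: algebra_simps)
      ultimately show ?thesis by linarith
    qed
    ultimately have "a * (?n ^ d + 1) \<le> (?n + 2) ^ a * (?n + 2) ^ Suc d" by (rule mult_le_mono)
    also have "\<dots> = T x" unfolding T_def e_def power_add[symmetric] by (rule arg_cong[where f = "power (?n + 2)"]) simp
    finally show ?thesis using time[OF that] by simp
  qed
  have "logspace_computable f"
    unfolding f_def
  proof (rule produce_logspace)
    show "gen_wf (main_gen e body) 1 False"
      by (rule gen_wf_main_gen) (simp only: body_def gen_wf_body_gen)
    fix x :: "bool list"
    \<comment> \<open>This is (n + 2) ^ 4 T ^ 2, which bounds 16 T ^ 2 and hence every
      register.\<close>
    let ?V = "(length x + 2) ^ (2 * e + 4)"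
    show "?V \<le> (length x + 2) ^ (2 * e + 4)" by simp
    have "16 \<le> (length x + 2) ^ 4" using power_mono[of 2 "length x + 2" 4] by simp
    then have "16 * T x ^ 2 \<le> (length x + 2) ^ 4 * T x ^ 2" by (rule mult_le_mono1)
    also have "\<dots> = ?V" unfolding T_def by (simp add: power_add power_mult[symmetric] mult.commute)
    finally have N: "ncells (length x) (T x) \<le> ?V" using ncells_bound[OF T_ge] order_trans by blast
    have n: "length x + 2 \<le> ?V" using self_le_power[of "length x + 2" "2 * e + 4"] by simp
    then show "length x < ?V" by simp
    show "fits ?V x (main_gen e body) 1 (\<lambda>_. 0)"
      using main_gen[of e x body ?V] n N no_let_fits[of body] no_let_body_gen
      unfolding body_def T_def by blast
  qed
  moreover have "x \<in> A \<longleftrightarrow> f x \<in> LTL_Learn Ut Bt Bl \<infinity>" for x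
  proof -
    define K where "K = N x * Suc (length ts) + 1"
    define p where "p = N x * Suc (length ts)"
    define Fs where "Fs = constrs M hs vs x (T x)"
    define Cs where "Cs = map (cset ts (N x)) Fs"
    define ps where "ps = map (upw \<delta> {..<K} p) (fst_letters \<delta> \<kappa> p (dummies ts (N x)) Cs)"
    define ns where "ns = map (upw \<delta> {..<K} p) (snd_letters \<delta> \<kappa> p (dummies ts (N x)) Cs)"
    obtain \<sigma> where \<sigma>: "env (4 + e) (length x) (T x) \<sigma>" "f x = produce x body (4 + e + 10) 0 \<sigma>"
      using main_gen[of e x body 0] unfolding f_def T_def by blast
    have fx: "f x = enc_instance K ps ns (4 * N x + 1)"
      unfolding \<sigma>(2) body_def ps_def ns_def K_def p_def Cs_def Fs_def N_def
      by (rule produce_body_gen[OF \<sigma>(1)])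
    have dummies: "distinct (dummies ts (N x))" "length (dummies ts (N x)) = N x"
      "p \<notin> set (dummies ts (N x))" "set (dummies ts (N x)) \<subseteq> {..<K}" "p \<in> {..<K}"
    proof -
      have less: "m * Suc (length ts) + length ts < p" if "m < N x" for m
        unfolding p_def using that by (intro div_mod_index(3)) simp_all
      show "distinct (dummies ts (N x))"
        using index_eq_iff[of "length ts" "length ts" "length ts"]
        by (auto simp: dummies_def distinct_map inj_on_def simp del: mult_Suc_right)
      show "length (dummies ts (N x)) = N x" by (simp add: dummies_def)
      show "p \<notin> set (dummies ts (N x))" unfolding dummies_def set_map set_upt using less by fastforce
      show "set (dummies ts (N x)) \<subseteq> {..<K}"
        unfolding dummies_def set_map set_upt K_def using less unfolding p_def by fastforce
      show "p \<in> {..<K}" by (simp add: p_def K_def)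
    qed
    have Cs: "p \<notin> C \<and> C \<inter> set (dummies ts (N x)) = {}" "C \<subseteq> {..<K}" if mem: "C \<in> set Cs" for C
    proof -
      obtain F where C: "C = cset ts (N x) F" using mem by (auto simp: Cs_def)
      have "m * Suc (length ts) + length ts \<notin> C" if "m < N x" for m
        unfolding C index_in_letter(2)[OF that] by simp
      moreover have "p \<notin> C" unfolding C p_def index_in_letter(3) by simp
      ultimately show "p \<notin> C \<and> C \<inter> set (dummies ts (N x)) = {}" by (auto simp: dummies_def)
      show "C \<subseteq> {..<K}" unfolding C K_def by (rule letter_of_subset)
    qed
    have wf: "set ps \<subseteq> upwords {..<K}" "set ns \<subseteq> upwords {..<K}"
    proof -
      have "upw \<delta> {..<K} p L \<in> upwords {..<K}" if "L \<subseteq> {..<K}" for L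
        using that dummies(5) by (auto simp: upw_def upwords_def flip_def)
      moreover have "L \<subseteq> {..<K}" if "L \<in> set (pos_letters \<kappa> p (dummies ts (N x)) Cs) \<union>
          set (neg_letters \<kappa> p (dummies ts (N x)) Cs)" for L
        using that dummies(4,5) Cs(2) by (auto simp: pos_letters_def neg_letters_def split: if_splits)
      ultimately show "set ps \<subseteq> upwords {..<K}" "set ns \<subseteq> upwords {..<K}"
        unfolding ps_def ns_def fst_letters_def snd_letters_def by auto
    qed
    \<comment> \<open>Membership speaks of some instance with this code; unambiguity of the code
      makes it the instance constructed here.\<close>
    have learn: "f x \<in> LTL_Learn Ut Bt Bl \<infinity> \<longleftrightarrow>
        learnable Ut Bt Bl \<infinity> {..<K} (set ps) (set ns) (4 * N x + 1)"
    proof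
      assume "f x \<in> LTL_Learn Ut Bt Bl \<infinity>"
      then obtain k ps' ns' B where *: "f x = enc_instance k ps' ns' B" "set ps' \<subseteq> upwords {..<k}"
        "set ns' \<subseteq> upwords {..<k}" "learnable Ut Bt Bl \<infinity> {..<k} (set ps') (set ns') B"
        unfolding LTL_Learn_def by blast
      have "K = k \<and> ps = ps' \<and> ns = ns' \<and> 4 * N x + 1 = B"
        by (rule enc_instance_inject[OF wf *(2,3)]) (use fx *(1) in simp)
      with *(4) show "learnable Ut Bt Bl \<infinity> {..<K} (set ps) (set ns) (4 * N x + 1)" by simp
    next
      assume "learnable Ut Bt Bl \<infinity> {..<K} (set ps) (set ns) (4 * N x + 1)"
      with fx wf show "f x \<in> LTL_Learn Ut Bt Bl \<infinity>" unfolding LTL_Learn_def by blast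
    qed
    have Tpos: "0 < T x" using T_ge[of x] by linarith
    show ?thesis
      unfolding learn
    proof
      assume "x \<in> A"
      then have acc: "ntm_accepts M x" by (simp add: A)
      have "\<exists>h. tiling M x (offset (T x)) (border (length x) (T x)) (T x) h \<and>
          (\<exists>!j. final_head M (border (length x) (T x)) (T x) h j)"
      proof (rule tiling_complete[OF acc])
        show "t \<le> T x" if "(ntm_step M ^^ t) (ntm_init M x) c" for t c by (rule steps[OF that])
        show "T x < offset (T x)" "offset (T x) + T x < border (length x) (T x)"
          using Tpos by (simp_all add: offset_def border_def)
      qed
      then obtain h where h: "tiling M x (offset (T x)) (border (length x) (T x)) (T x) h"
        "\<exists>!j. final_head M (border (length x) (T x)) (T x) h j"
        by blast
      have exact: "\<exists>!m. m < N x \<and> F m (h m)" if "F \<in> set Fs" for F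
        unfolding N_def by (rule tiling_imp_constrs[OF Tpos h]) (use that in \<open>simp add: Fs_def\<close>)
      have tile: "h m \<in> set ts" if "m < N x" for m
        using h(1) that unfolding tiling_def ts N_def ncells_eq by blast
      have "\<exists>hits. distinct hits \<and> length hits = N x \<and> set hits \<inter> insert p (set (dummies ts (N x))) = {} \<and>
          set hits \<subseteq> {..<K} \<and> (\<forall>C \<in> set Cs. \<exists>!k. k \<in> set hits \<inter> C)"
        unfolding p_def K_def Cs_def
      proof (rule choice_imp_exact_hitting)
        show "h m \<in> set ts" if "m < N x" for m by (rule tile[OF that])
        show "\<exists>!m. m < N x \<and> F m (h m)" if "F \<in> set Fs" for F by (rule exact[OF that])
      qed
      then obtain hits where hits: "distinct hits" "length hits = N x"
        "set hits \<inter> insert p (set (dummies ts (N x))) = {}"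
        "set hits \<subseteq> {..<K}" "\<forall>C \<in> set Cs. \<exists>!k. k \<in> set hits \<inter> C"
        by (elim exE conjE)
      show "learnable Ut Bt Bl \<infinity> {..<K} (set ps) (set ns) (4 * N x + 1)"
        unfolding ps_def ns_def set_map \<delta>_def \<kappa>_def
      proof (rule exact_hitting_imp_learnable[OF g dummies _ hits(1-4)])
        show "p \<notin> C \<and> C \<inter> set (dummies ts (N x)) = {}" if "C \<in> set Cs" for C by (rule Cs(1)[OF that])
        show "\<exists>!k. k \<in> set hits \<inter> C" if "C \<in> set Cs" for C by (rule bspec[OF hits(5) that])
      qed
    next
      assume "learnable Ut Bt Bl \<infinity> {..<K} (set ps) (set ns) (4 * N x + 1)"
      then have "\<exists>H. finite H \<and> card H \<le> N x \<and> (\<forall>C \<in> set Cs. H \<inter> C \<noteq> {})"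
        unfolding ps_def ns_def set_map
      proof (rule learnable_imp_hitting[OF _ dummies(1-3)])
        show "p \<notin> C \<and> C \<inter> set (dummies ts (N x)) = {}" if "C \<in> set Cs" for C by (rule Cs(1)[OF that])
      qed
      then obtain H where H: "finite H" "card H \<le> N x" "\<forall>C \<in> set Cs. H \<inter> C \<noteq> {}"
        by (elim exE conjE)
      have cells: "one m (\<lambda>_. True) \<in> set Fs" if "m < N x" for m
        unfolding Fs_def by (rule constrs_mem(1)) (use that in \<open>simp add: N_def\<close>)
      have "\<exists>h. (\<forall>m < N x. h m \<in> set ts) \<and> (\<forall>F \<in> set Fs. \<exists>m < N x. F m (h m))"
      proof (rule hitting_imp_choice[OF H(1,2)])
        show "H \<inter> cset ts (N x) F \<noteq> {}" if "F \<in> set Fs" for F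
          using H(3) that by (simp add: Cs_def)
        show "one m (\<lambda>_. True) \<in> set Fs" if "m < N x" for m by (rule cells[OF that])
      qed
      then obtain h where h: "\<forall>m < N x. h m \<in> set ts" "\<forall>F \<in> set Fs. \<exists>m < N x. F m (h m)"
        by (elim exE conjE)
      have h1: "h m \<in> tiles M" if "m < ncells (length x) (T x)" for m
        using h(1) that by (simp add: N_def ts)
      have h2: "\<exists>m < ncells (length x) (T x). F m (h m)" if "F \<in> set (constrs M hs vs x (T x))" for F
        using bspec[OF h(2), of F] that by (simp add: N_def Fs_def)
      have tl: "tiling M x (offset (T x)) (border (length x) (T x)) (T x) h"
        by (rule constrs_imp_tiling(1)[OF Tpos hs vs]) (rule h1 h2; assumption)+
      have "\<exists>j. final_head M (border (length x) (T x)) (T x) h j"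
        by (rule constrs_imp_tiling(2)[OF Tpos hs vs]) (rule h1 h2; assumption)+
      then obtain j where "final_head M (border (length x) (T x)) (T x) h j" by blast
      then have "ntm_accepts M x"
        by (rule tiling_sound[OF tl]) (use Tpos in \<open>simp_all add: offset_def border_def\<close>)
      then show "x \<in> A" by (simp add: A)
    qed
  qed
  ultimately show "logspace_reducible A (LTL_Learn Ut Bt Bl \<infinity>)"
    unfolding logspace_reducible_def by blast
qed

end
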